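(* If there is a constant $\epsilon>0$ and an algorithm that, given an OR-circuit $\mathcal{C}$, outputs in time $O(|\mathcal{C}|^{2-\epsilon})$ a SUM-circuit computing the same matrix as $\mathcal{C}$, then the strong exponential time hypothesis fails. Likewise, if there is a constant $\epsilon>0$ and an algorithm that, given an OR-circuit $\mathcal{C}$, outputs in time $O(|\mathcal{C}|^{2-\epsilon})$ an XOR-circuit computing the same matrix as $\mathcal{C}$, then the strong exponential time hypothesis fails.
   Context: A circuit is a directed acyclic graph whose in-degree-zero vertices are input gates $x_1,\dots,x_n$ and whose other vertices are gates of unbounded fan-in; some gates are outputs. Its size $|\mathcal{C}|$ is the number of wires; one assumes $|\mathcal{C}|\ge n$, and circuits are encoded (e.g. as topologically ordered lists of gates and wires) with binary length $|\mathcal{C}|\cdot\mathrm{polylog}(n)$, so that a circuit can be evaluated on an input in time $|\mathcal{C}|\cdot\mathrm{polylog}(n)$ in the RAM model. For a boolean matrix $A=(a_{ij})$: an OR-circuit computes $A$ if, with gates computing boolean OR, output $i$ computes $\bigvee_j a_{ij}x_j$; a SUM-circuit computes $A$ if, with gates computing integer sums, output $i$ computes the formal linear form $\sum_j a_{ij}x_j$ over the non-negative integers; an XOR-circuit computes $A$ if, with gates computing sums mod 2, output $i$ computes $\sum_j a_{ij}x_j$ over $\mathrm{GF}(2)$. The strong exponential time hypothesis (SETH) asserts that for no constant $\epsilon>0$ is there an algorithm (allowing randomized Monte Carlo algorithms) deciding satisfiability of CNF formulas with $n$ variables and $m$ clauses in time $2^{(1-\epsilon)n}\mathrm{poly}(n,m)$.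 *)

theory Defs
  imports
    "HOL-Probability.Probability_Mass_Function"
    "HOL-Library.Landau_Symbols"
    "HOL-Library.Poly_Mapping"
    "HOL-Library.Log_Nat"
    "HOL-Library.Z2"
    "Jordan_Normal_Form.Matrix"
begin

section \<open>Circuits\<close>

text \<open>
  A circuit is a directed acyclic graph presented in topological order: the vertices
  \<open>0, \<dots>, inputs C - 1\<close> are the input gates, vertex \<open>inputs C + k\<close> is the \<open>k\<close>-th remaining gate, and
  \<open>gates C ! k\<close> lists the tails of the wires entering it. Every finite directed acyclic graph whose
  sources are the input gates has such a presentation. The position of a vertex in \<open>outputs C\<close> is
  the row index of that output.
\<close>

datatype circuit =
  Circuit (inputs: nat) (gates: "nat list list") (outputs: "nat list")

definition wires :: "circuit \<Rightarrow> nat" where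
  "wires C = sum_list (map length (gates C))"

definition wf_circuit :: "circuit \<Rightarrow> bool" where
  "wf_circuit C \<longleftrightarrow>
     (\<forall>k < length (gates C). gates C ! k \<noteq> [] \<and> distinct (gates C ! k) \<and>
        set (gates C ! k) \<subseteq> {..<inputs C + k}) \<and>
     outputs C \<noteq> [] \<and> distinct (outputs C) \<and>
     set (outputs C) \<subseteq> {..<inputs C + length (gates C)} \<and>
     inputs C \<le> wires C"

definition vertex_values :: "('a list \<Rightarrow> 'a) \<Rightarrow> (nat \<Rightarrow> 'a) \<Rightarrow> circuit \<Rightarrow> 'a list" where
  "vertex_values f x C =
     foldl (\<lambda>vs ps. vs @ [f (map ((!) vs) ps)]) (map x [0..<inputs C]) (gates C)"

definition output_value :: "('a list \<Rightarrow> 'a) \<Rightarrow> (nat \<Rightarrow> 'a) \<Rightarrow> circuit \<Rightarrow> nat \<Rightarrow> 'a" where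
  "output_value f x C i = vertex_values f x C ! (outputs C ! i)"

definition circuit_dims :: "circuit \<Rightarrow> bool mat \<Rightarrow> bool" where
  "circuit_dims C A \<longleftrightarrow> A \<in> carrier_mat (length (outputs C)) (inputs C)"

definition OR_computes :: "circuit \<Rightarrow> bool mat \<Rightarrow> bool" where
  "OR_computes C A \<longleftrightarrow> circuit_dims C A \<and>
     (\<forall>x :: nat \<Rightarrow> bool. \<forall>i < dim_row A.
        output_value (\<lambda>bs. \<exists>b \<in> set bs. b) x C i \<longleftrightarrow> (\<exists>j < dim_col A. A $$ (i, j) \<and> x j))"

text \<open>
  Formal linear forms over the non-negative integers are finitely supported coefficient
  functions; the indeterminate \<open>x\<^sub>j\<close> is \<open>Poly_Mapping.single j 1\<close>.
\<close>

definition SUM_computes :: "circuit \<Rightarrow> bool mat \<Rightarrow> bool" where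
  "SUM_computes C A \<longleftrightarrow> circuit_dims C A \<and>
     (\<forall>i < dim_row A.
        output_value sum_list (\<lambda>j. Poly_Mapping.single j (1 :: nat)) C i =
          (\<Sum>j < dim_col A. Poly_Mapping.single j (of_bool (A $$ (i, j)))))"

definition XOR_computes :: "circuit \<Rightarrow> bool mat \<Rightarrow> bool" where
  "XOR_computes C A \<longleftrightarrow> circuit_dims C A \<and>
     (\<forall>x :: nat \<Rightarrow> bit. \<forall>i < dim_row A.
        output_value sum_list x C i = (\<Sum>j < dim_col A. of_bool (A $$ (i, j)) * x j))"

text \<open>
  Vertices are numbered from \<open>1\<close> in the encoding. A well-formed circuit is encoded by \<open>O(wires C)\<close>
  numbers of \<open>O(log (wires C))\<close> bits each, since \<open>inputs C \<le> wires C\<close> and every further gate is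
  entered by at least one wire.
\<close>

definition encode_circuit :: "circuit \<Rightarrow> nat list" where
  "encode_circuit C =
     inputs C # length (gates C) # concat (map (\<lambda>ps. length ps # map Suc ps) (gates C)) @
     length (outputs C) # map Suc (outputs C)"


section \<open>CNF formulas\<close>

text \<open>
  The literal \<open>(v, b)\<close> is satisfied when variable \<open>v\<close> has the value \<open>b\<close>. Clauses do not repeat
  literals, so that the length of a formula is polynomial in the numbers of variables and clauses.
\<close>

datatype cnf = CNF (num_vars: nat) (clauses: "(nat \<times> bool) list list")

definition wf_cnf :: "cnf \<Rightarrow> bool" where
  "wf_cnf \<phi> \<longleftrightarrow>
     (\<forall>cl \<in> set (clauses \<phi>). distinct cl \<and> (\<forall>(v, b) \<in> set cl. v < num_vars \<phi>))"

definition satisfiable :: "cnf \<Rightarrow> bool" where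
  "satisfiable \<phi> \<longleftrightarrow>
     (\<exists>\<alpha> :: nat \<Rightarrow> bool. \<forall>cl \<in> set (clauses \<phi>). \<exists>(v, b) \<in> set cl. \<alpha> v = b)"

definition encode_cnf :: "cnf \<Rightarrow> nat list" where
  "encode_cnf \<phi> =
     num_vars \<phi> # length (clauses \<phi>) #
     concat (map (\<lambda>cl. length cl # map (\<lambda>(v, b). 2 * v + of_bool b) cl) (clauses \<phi>))"


section \<open>Random access machines with logarithmic cost\<close>

text \<open>
  Programs are structured; a program mentions only finitely many registers and finitely many
  infinite arrays (interleaving these into one memory changes costs by a constant factor only).
  Each operation is charged the bit lengths of the numbers and addresses it handles, so running
  times agree, up to factors polylogarithmic in the running time and input length, with those on
  word machines whose words have logarithmically many bits.
\<close>

datatype operand = Imm nat | Reg nat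

datatype binop = Add | Sub | Mul | Div

datatype com =
    Skip
  | Move nat operand
  | Op binop nat operand operand
  | Load nat nat operand
  | Store nat operand operand
  | Flip nat
  | Seq com com
  | Cond operand com com
  | While operand com

record state =
  regs :: "nat \<Rightarrow> nat"
  arrays :: "nat \<Rightarrow> nat \<Rightarrow> nat"

primrec opval :: "state \<Rightarrow> operand \<Rightarrow> nat" where
  "opval s (Imm k) = k"
| "opval s (Reg r) = regs s r"

primrec apply_binop :: "binop \<Rightarrow> nat \<Rightarrow> nat \<Rightarrow> nat" where
  "apply_binop Add a b = a + b"
| "apply_binop Sub a b = a - b"
| "apply_binop Mul a b = a * b"
| "apply_binop Div a b = a div b"

definition bit_cost :: "nat \<Rightarrow> nat" where
  "bit_cost k = Suc (floorlog 2 k)"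

definition set_reg :: "nat \<Rightarrow> nat \<Rightarrow> state \<Rightarrow> state" where
  "set_reg r k s = s\<lparr>regs := (regs s)(r := k)\<rparr>"

definition set_cell :: "nat \<Rightarrow> nat \<Rightarrow> nat \<Rightarrow> state \<Rightarrow> state" where
  "set_cell a i k s = s\<lparr>arrays := (arrays s)(a := (arrays s a)(i := k))\<rparr>"

text \<open>
  \<open>exec p s \<omega> t s' \<omega>'\<close>: started in \<open>s\<close> with the coin tosses \<open>\<omega>\<close> at its disposal, \<open>p\<close> halts in
  \<open>s'\<close> after time \<open>t\<close>, with the tosses \<open>\<omega>'\<close> left over. There is no rule for tossing a coin when none
  is left, so a run on the empty list is a run without coin tosses.
\<close>

inductive exec :: "com \<Rightarrow> state \<Rightarrow> bool list \<Rightarrow> nat \<Rightarrow> state \<Rightarrow> bool list \<Rightarrow> bool" where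
  Skip: "exec Skip s \<omega> 1 s \<omega>"
| Move: "exec (Move r x) s \<omega> (bit_cost (opval s x)) (set_reg r (opval s x) s) \<omega>"
| Op: "exec (Op f r x y) s \<omega> (bit_cost (opval s x) + bit_cost (opval s y))
         (set_reg r (apply_binop f (opval s x) (opval s y)) s) \<omega>"
| Load: "exec (Load r a x) s \<omega> (bit_cost (opval s x) + bit_cost (arrays s a (opval s x)))
           (set_reg r (arrays s a (opval s x)) s) \<omega>"
| Store: "exec (Store a x y) s \<omega> (bit_cost (opval s x) + bit_cost (opval s y))
            (set_cell a (opval s x) (opval s y) s) \<omega>"
| Flip: "exec (Flip r) s (b # \<omega>) 1 (set_reg r (of_bool b) s) \<omega>"
| Seq: "exec p s \<omega> t s' \<omega>' \<Longrightarrow> exec q s' \<omega>' t' s'' \<omega>'' \<Longrightarrow>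
          exec (Seq p q) s \<omega> (t + t') s'' \<omega>''"
| CondT: "opval s x \<noteq> 0 \<Longrightarrow> exec p s \<omega> t s' \<omega>' \<Longrightarrow>
            exec (Cond x p q) s \<omega> (bit_cost (opval s x) + t) s' \<omega>'"
| CondF: "opval s x = 0 \<Longrightarrow> exec q s \<omega> t s' \<omega>' \<Longrightarrow>
            exec (Cond x p q) s \<omega> (bit_cost (opval s x) + t) s' \<omega>'"
| WhileF: "opval s x = 0 \<Longrightarrow> exec (While x p) s \<omega> (bit_cost (opval s x)) s \<omega>"
| WhileT: "opval s x \<noteq> 0 \<Longrightarrow> exec p s \<omega> t s' \<omega>' \<Longrightarrow> exec (While x p) s' \<omega>' t' s'' \<omega>'' \<Longrightarrow>
             exec (While x p) s \<omega> (bit_cost (opval s x) + t + t') s'' \<omega>''"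

text \<open>
  The input is placed in array \<open>0\<close> and its length in register \<open>0\<close>; everything else is \<open>0\<close>. The
  output is read off array \<open>1\<close>, its length being given by register \<open>1\<close>.
\<close>

definition initial_state :: "nat list \<Rightarrow> state" where
  "initial_state xs =
     \<lparr>regs = (\<lambda>r. if r = 0 then length xs else 0),
      arrays = (\<lambda>a i. if a = 0 \<and> i < length xs then xs ! i else 0)\<rparr>"

definition output_of :: "state \<Rightarrow> nat list" where
  "output_of s = map (arrays s 1) [0..<regs s 1]"


section \<open>Rewriting algorithms and the strong exponential time hypothesis\<close>

definition rewrites_OR_circuits ::
    "(circuit \<Rightarrow> bool mat \<Rightarrow> bool) \<Rightarrow> com \<Rightarrow> (nat \<Rightarrow> real) \<Rightarrow> bool" where
  "rewrites_OR_circuits computes p T \<longleftrightarrow>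
     (\<forall>C. wf_circuit C \<longrightarrow>
       (\<exists>t s C'. exec p (initial_state (encode_circuit C)) [] t s [] \<and>
          real t \<le> T (wires C) \<and>
          output_of s = encode_circuit C' \<and> wf_circuit C' \<and>
          (\<exists>A. OR_computes C A \<and> computes C' A)))"

text \<open>
  A coin toss takes one time unit, so \<open>T\<close> tosses suffice for a run of length at most \<open>T\<close>.
\<close>

definition monte_carlo_decides_within :: "com \<Rightarrow> nat list \<Rightarrow> bool \<Rightarrow> nat \<Rightarrow> bool" where
  "monte_carlo_decides_within p xs answer T \<longleftrightarrow>
     (\<forall>\<omega>. length \<omega> = T \<longrightarrow> (\<exists>t s \<omega>'. exec p (initial_state xs) \<omega> t s \<omega>' \<and> t \<le> T)) \<and>
     measure_pmf.prob (pmf_of_set {\<omega> :: bool list. length \<omega> = T})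
       {\<omega>. \<exists>t s \<omega>'. exec p (initial_state xs) \<omega> t s \<omega>' \<and> output_of s = [of_bool answer]}
       \<ge> 2 / 3"

definition SETH :: bool where
  "SETH \<longleftrightarrow> \<not> (\<exists>\<epsilon> > 0. \<exists>p. \<exists>c d :: nat. \<forall>\<phi>. wf_cnf \<phi> \<longrightarrow>
     (\<exists>T. real T \<le> 2 powr ((1 - \<epsilon>) * real (num_vars \<phi>)) *
                    real (c * (num_vars \<phi> + length (clauses \<phi>) + 1) ^ d) \<and>
          monte_carlo_decides_within p (encode_cnf \<phi>) (satisfiable \<phi>) T))"

end

theory Submission
  imports Defs
begin

text \<open>
  Split the variables of a formula with \<open>n\<close> variables and \<open>m\<close> clauses into two halves and let \<open>M\<close> be
  the number of assignments to one half. The matrix indexed by pairs of half assignments whose entry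
  says that some clause is falsified by both halves has a zero entry iff the formula is satisfiable,
  and routing through one gate per clause gives an OR-circuit for it with \<open>O(M m)\<close> wires. A rewriting
  algorithm turns this into an XOR-circuit of size \<open>O((M m)\<^sup>2 / M\<^sup>\<epsilon>)\<close> (a SUM-circuit
  is also an XOR-circuit, by reducing the coefficients mod 2). Evaluating it on random inputs and
  comparing every output with an all-ones row detects a zero entry with probability at least
  \<open>1/2\<close> per trial.
\<close>

section \<open>Reasoning about programs\<close>

text \<open>The matrix has about \<open>2 ^ n\<close> entries and is never written down. With
  \<open>M\<close> about \<open>2 ^ (n / 2)\<close>, the power \<open>M ^ (2 - \<epsilon>)\<close>
  is about \<open>2 ^ ((1 - \<epsilon> / 2) * n)\<close>; hence SETH is refuted with
  \<open>\<epsilon> / 2\<close>. Passing to GF(2) lets one evaluation test all entries at once: the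
  difference between a row and the all-ones row is a linear form whose coefficients mark the zeros
  of that row, and a nonzero linear form takes the value 1 on exactly half of all inputs. A matrix
  without zeros never shows a difference, so the error is one-sided, and two trials bring it to 1/4,
  below the allowed 1/3. The obstacle is that running times are bit costs and that the rewriting
  algorithm is an arbitrary program. Its actual time \<open>t\<close> on the constructed circuit is
  therefore carried along as a parameter: the program is moved to registers and arrays of its own,
  and the size of the circuit that it outputs is controlled only through \<open>t\<close>.\<close>

primrec written_regs :: "com \<Rightarrow> nat set" where
  "written_regs Skip = {}"
| "written_regs (Move r x) = {r}"
| "written_regs (Op f r x y) = {r}"
| "written_regs (Load r a x) = {r}"
| "written_regs (Store a x y) = {}"
| "written_regs (Flip r) = {r}"
| "written_regs (Seq p q) = written_regs p \<union> written_regs q"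
| "written_regs (Cond x p q) = written_regs p \<union> written_regs q"
| "written_regs (While x p) = written_regs p"

primrec written_arrays :: "com \<Rightarrow> nat set" where
  "written_arrays Skip = {}"
| "written_arrays (Move r x) = {}"
| "written_arrays (Op f r x y) = {}"
| "written_arrays (Load r a x) = {}"
| "written_arrays (Store a x y) = {a}"
| "written_arrays (Flip r) = {}"
| "written_arrays (Seq p q) = written_arrays p \<union> written_arrays q"
| "written_arrays (Cond x p q) = written_arrays p \<union> written_arrays q"
| "written_arrays (While x p) = written_arrays p"

definition same_except :: "nat set \<Rightarrow> nat set \<Rightarrow> state \<Rightarrow> state \<Rightarrow> bool" where
  "same_except R A s s' \<longleftrightarrow>
     (\<forall>r. r \<notin> R \<longrightarrow> regs s' r = regs s r) \<and> (\<forall>a. a \<notin> A \<longrightarrow> arrays s' a = arrays s a)"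

lemma same_except_refl [simp]: "same_except R A s s"
  by (simp add: same_except_def)

lemma same_except_trans:
  "same_except R A s s' \<Longrightarrow> same_except R A s' s'' \<Longrightarrow> same_except R A s s''"
  by (simp add: same_except_def)

lemma same_except_mono:
  "same_except R A s s' \<Longrightarrow> R \<subseteq> R' \<Longrightarrow> A \<subseteq> A' \<Longrightarrow> same_except R' A' s s'"
  by (auto simp: same_except_def)

lemma same_exceptD:
  assumes "same_except R A s s'"
  shows "r \<notin> R \<Longrightarrow> regs s' r = regs s r" "a \<notin> A \<Longrightarrow> arrays s' a = arrays s a"
  using assms by (auto simp: same_except_def)

lemma regs_set_reg [simp]: "regs (set_reg r v s) r' = (if r' = r then v else regs s r')"
  by (simp add: set_reg_def)

lemma arrays_set_reg [simp]: "arrays (set_reg r v s) = arrays s"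
  by (simp add: set_reg_def)

lemma regs_set_cell [simp]: "regs (set_cell a i v s) = regs s"
  by (simp add: set_cell_def)

lemma arrays_set_cell [simp]:
  "arrays (set_cell a i v s) a' = (if a' = a then (arrays s a)(i := v) else arrays s a')"
  by (simp add: set_cell_def)

lemma exec_same_except:
  "exec c s \<omega> t s' \<omega>' \<Longrightarrow> same_except (written_regs c) (written_arrays c) s s'"
  by (induction rule: exec.induct) (auto simp: same_except_def)

text \<open>
  The counter \<open>k\<close> is a ghost clock that ticks once per elementary operation. As long as all numbers
  handled are at most \<open>V\<close>, a tick takes time at most \<open>2 * bit_cost V\<close>.
\<close>

definition wp :: "nat \<Rightarrow> com \<Rightarrow> (nat \<Rightarrow> state \<Rightarrow> bool list \<Rightarrow> bool) \<Rightarrow> nat \<Rightarrow> state \<Rightarrow> bool list \<Rightarrow> bool"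
  where "wp V c Q k s \<omega> \<longleftrightarrow>
    (\<exists>t s' \<omega>' j. exec c s \<omega> t s' \<omega>' \<and> t \<le> j * (2 * bit_cost V) \<and> Q (k + j) s' \<omega>')"

lemma bit_cost_mono: "k \<le> V \<Longrightarrow> bit_cost k \<le> bit_cost V"
  by (simp add: bit_cost_def floorlog_mono)

lemma bit_cost_pos: "1 \<le> bit_cost V"
  by (simp add: bit_cost_def)

lemma wp_one:
  assumes "exec c s \<omega> t s' \<omega>'" "t \<le> 2 * bit_cost V" "Q (k + 1) s' \<omega>'"
  shows "wp V c Q k s \<omega>"
  unfolding wp_def
  by (intro exI[of _ t] exI[of _ s'] exI[of _ \<omega>'] exI[of _ 1]) (use assms in simp)

lemma wp_Move:
  assumes "opval s x \<le> V" "Q (k + 1) (set_reg r (opval s x) s) \<omega>"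
  shows "wp V (Move r x) Q k s \<omega>"
  using bit_cost_mono[OF assms(1)] assms(2) by (intro wp_one[OF exec.Move]) auto

lemma wp_Skip: "Q (k + 1) s \<omega> \<Longrightarrow> wp V Skip Q k s \<omega>"
  using bit_cost_pos[of V] by (intro wp_one[OF exec.Skip]) auto

lemma wp_Op:
  assumes "opval s x \<le> V" "opval s y \<le> V"
    "Q (k + 1) (set_reg r (apply_binop f (opval s x) (opval s y)) s) \<omega>"
  shows "wp V (Op f r x y) Q k s \<omega>"
  using bit_cost_mono[OF assms(1)] bit_cost_mono[OF assms(2)] assms(3)
  by (intro wp_one[OF exec.Op]) auto

lemma wp_Load:
  assumes "opval s x \<le> V" "arrays s a (opval s x) \<le> V"
    "Q (k + 1) (set_reg r (arrays s a (opval s x)) s) \<omega>"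
  shows "wp V (Load r a x) Q k s \<omega>"
  using bit_cost_mono[OF assms(1)] bit_cost_mono[OF assms(2)] assms(3)
  by (intro wp_one[OF exec.Load]) auto

lemma wp_Store:
  assumes "opval s x \<le> V" "opval s y \<le> V"
    "Q (k + 1) (set_cell a (opval s x) (opval s y) s) \<omega>"
  shows "wp V (Store a x y) Q k s \<omega>"
  using bit_cost_mono[OF assms(1)] bit_cost_mono[OF assms(2)] assms(3)
  by (intro wp_one[OF exec.Store]) auto

lemma wp_Flip:
  assumes "Q (k + 1) (set_reg r (of_bool b) s) \<omega>"
  shows "wp V (Flip r) Q k s (b # \<omega>)"
  using bit_cost_pos[of V] assms by (intro wp_one[OF exec.Flip]) auto

lemma wp_Seq:
  assumes "wp V p (wp V q Q) k s \<omega>"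
  shows "wp V (Seq p q) Q k s \<omega>"
proof -
  obtain t s' \<omega>' j where 1: "exec p s \<omega> t s' \<omega>'" "t \<le> j * (2 * bit_cost V)"
    and q: "wp V q Q (k + j) s' \<omega>'"
    using assms unfolding wp_def[of V p] by blast
  obtain t' s'' \<omega>'' j' where 2: "exec q s' \<omega>' t' s'' \<omega>''" "t' \<le> j' * (2 * bit_cost V)"
    "Q (k + j + j') s'' \<omega>''"
    using q unfolding wp_def by blast
  show ?thesis
    unfolding wp_def using 1 2
    by (intro exI[of _ "t + t'"] exI[of _ s''] exI[of _ \<omega>''] exI[of _ "j + j'"] conjI)
      (auto intro: exec.Seq simp: add_mult_distrib add.assoc)
qed

text \<open>Common core of the rules for \<open>Cond\<close> and \<open>While\<close>: evaluating a
  guard costs one tick, after which the run is that of \<open>c\<close>.\<close>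

lemma wp_step:
  assumes "wp V c Q (k + 1) s \<omega>"
    and "\<And>t s' \<omega>'. exec c s \<omega> t s' \<omega>' \<Longrightarrow> exec c' s \<omega> (u + t) s' \<omega>'" "u \<le> 2 * bit_cost V"
  shows "wp V c' Q k s \<omega>"
proof -
  obtain t s' \<omega>' j where 1: "exec c s \<omega> t s' \<omega>'" "t \<le> j * (2 * bit_cost V)"
    and 2: "Q (k + 1 + j) s' \<omega>'"
    using assms by (auto simp: wp_def)
  show ?thesis
    unfolding wp_def using 1 2 assms(2)[OF 1(1)] assms(3)
    by (intro exI[of _ "u + t"] exI[of _ s'] exI[of _ \<omega>'] exI[of _ "1 + j"] conjI)
      (auto simp: add_mult_distrib add.assoc)
qed

lemma wp_Cond:
  assumes "opval s x \<le> V" "opval s x \<noteq> 0 \<Longrightarrow> wp V p Q (k + 1) s \<omega>"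
    "opval s x = 0 \<Longrightarrow> wp V q Q (k + 1) s \<omega>"
  shows "wp V (Cond x p q) Q k s \<omega>"
proof (cases "opval s x = 0")
  case True
  show ?thesis
    using bit_cost_mono[OF assms(1)] by (intro wp_step[OF assms(3)[OF True] exec.CondF[OF True]]) auto
next
  case False
  show ?thesis
    using bit_cost_mono[OF assms(1)] by (intro wp_step[OF assms(2)[OF False] exec.CondT[OF False]]) auto
qed

lemma wp_WhileF:
  assumes "opval s x = 0" "Q (k + 1) s \<omega>"
  shows "wp V (While x p) Q k s \<omega>"
  by (intro wp_one[OF exec.WhileF]) (use assms bit_cost_mono[of 0 V] in auto)

lemma wp_WhileT:
  assumes "opval s x \<noteq> 0" "opval s x \<le> V" "wp V (Seq p (While x p)) Q (k + 1) s \<omega>"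
  shows "wp V (While x p) Q k s \<omega>"
proof (rule wp_step[OF assms(3)])
  fix t s' \<omega>' assume "exec (Seq p (While x p)) s \<omega> t s' \<omega>'"
  then obtain t1 t2 s1 \<omega>1 where "t = t1 + t2" "exec p s \<omega> t1 s1 \<omega>1" "exec (While x p) s1 \<omega>1 t2 s' \<omega>'"
    by (auto elim: exec.cases)
  then show "exec (While x p) s \<omega> (bit_cost (opval s x) + t) s' \<omega>'"
    using exec.WhileT[OF assms(1)] by (simp add: add.assoc[symmetric])
qed (use bit_cost_mono[OF assms(2)] in auto)

text \<open>The syntactic frame property of \<open>c\<close> may be assumed of the final state, so
  postconditions need not list the registers and arrays that \<open>c\<close> leaves alone.\<close>

lemma wp_conseq:
  assumes "wp V c Q k s \<omega>"
    and "\<And>k' s' \<omega>'. same_except (written_regs c) (written_arrays c) s s' \<Longrightarrow> Q k' s' \<omega>' \<Longrightarrow> Q' k' s' \<omega>'"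
  shows "wp V c Q' k s \<omega>"
  using assms exec_same_except unfolding wp_def by metis

lemma wp_seq_conseq:
  assumes "wp V c Q k s \<omega>"
    and "\<And>k' s' \<omega>'. same_except (written_regs c) (written_arrays c) s s' \<Longrightarrow> Q k' s' \<omega>' \<Longrightarrow> wp V d Q' k' s' \<omega>'"
  shows "wp V (Seq c d) Q' k s \<omega>"
  by (intro wp_Seq wp_conseq[OF assms])

lemma wp_shift: "wp V c Q (a + k) s \<omega> = wp V c (\<lambda>k. Q (a + k)) k s \<omega>"
  by (simp add: wp_def add.assoc)

text \<open>Guards only test for being nonzero, so "counter below bound" becomes the truncated
  difference, kept in register 2. Nested loops can share this register because it is recomputed
  after every execution of the body.\<close>

definition For :: "nat \<Rightarrow> operand \<Rightarrow> com \<Rightarrow> com" where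
  "For i x body = Seq (Move i (Imm 0)) (Seq (Op Sub 2 x (Reg i))
     (While (Reg 2) (Seq body (Seq (Op Add i (Reg i) (Imm 1)) (Op Sub 2 x (Reg i))))))"

lemma written_regs_For [simp]: "written_regs (For i x body) = insert i (insert 2 (written_regs body))"
  by (auto simp: For_def)

lemma written_arrays_For [simp]: "written_arrays (For i x body) = written_arrays body"
  by (auto simp: For_def)

text \<open>The only loop rule; the number of remaining iterations ensures termination. Overhead is
  two ticks before the loop, three per iteration and one for the final test. The invariant must
  ignore the counter and register 2 (\<open>insens\<close>), since both change between the end of
  the body and the next test.\<close>

lemma wp_For:
  assumes lim: "opval s x = n" "n \<le> V" "1 \<le> V"
    and i: "i \<noteq> 2" "i \<notin> written_regs body" "\<And>r. x = Reg r \<Longrightarrow> r \<notin> insert i (insert 2 (written_regs body))"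
    and insens: "\<And>j k s \<omega> u v. I j k s \<omega> \<Longrightarrow> I j k (set_reg 2 u (set_reg i v s)) \<omega>"
    and init: "I 0 (k + 2) s \<omega>"
    and step: "\<And>j k' s' \<omega>'. j < n \<Longrightarrow> same_except (insert i (insert 2 (written_regs body))) (written_arrays body) s s' \<Longrightarrow>
      regs s' i = j \<Longrightarrow> I j k' s' \<omega>' \<Longrightarrow> wp V body (\<lambda>k s \<omega>. I (Suc j) (k + 3) s \<omega>) k' s' \<omega>'"
    and fin: "\<And>k' s' \<omega>'. same_except (insert i (insert 2 (written_regs body))) (written_arrays body) s s' \<Longrightarrow>
      I n k' s' \<omega>' \<Longrightarrow> Q (k' + 1) s' \<omega>'"
  shows "wp V (For i x body) Q k s \<omega>"
proof -
  define R where "R = insert i (insert 2 (written_regs body))"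
  have x: "opval s' x = n" if "same_except R (written_arrays body) s s'" for s'
    using lim(1) i(3) that by (cases x) (auto simp: same_except_def R_def)
  have sr: "same_except R (written_arrays body) s (set_reg 2 u (set_reg i v s'))" if "same_except R (written_arrays body) s s'" for s' u v
    using that by (auto simp: same_except_def R_def)
  have loop: "wp V (While (Reg 2) (Seq body (Seq (Op Add i (Reg i) (Imm 1)) (Op Sub 2 x (Reg i))))) Q k' s' \<omega>'"
    if "same_except R (written_arrays body) s s'" "regs s' i = j" "regs s' 2 = n - j" "j \<le> n" "I j k' s' \<omega>'"
    for j k' s' \<omega>'
    using that
  proof (induction "n - j" arbitrary: j k' s' \<omega>')
    case 0
    then show ?case
      using fin[of s' k' \<omega>'] by (intro wp_WhileF) (auto simp: R_def)
  next
    case (Suc d)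
    then have j: "j < n" by simp
    let ?W = "While (Reg 2) (Seq body (Seq (Op Add i (Reg i) (Imm 1)) (Op Sub 2 x (Reg i))))"
    \<comment> \<open>One of the three ticks, the loop test, precedes the body; the clock is shifted
      so that only the two ticks of \<open>Add\<close> and \<open>Sub\<close> remain to be charged
      after it.\<close>
    have "wp V body (\<lambda>k. I (Suc j) (k + 2)) (k' + 1) s' \<omega>'"
      using step[OF j Suc.prems(1)[unfolded R_def] Suc.prems(2,5)]
        wp_shift[of V body "\<lambda>k. I (Suc j) (k + 2)" 1 k' s' \<omega>']
      by (simp add: eval_nat_numeral)
    then have "wp V body (wp V (Seq (Op Add i (Reg i) (Imm 1)) (Op Sub 2 x (Reg i))) (wp V ?W Q)) (k' + 1) s' \<omega>'"
    proof (rule wp_conseq)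
      fix k1 s1 \<omega>1
      assume s1: "same_except (written_regs body) (written_arrays body) s' s1" and I1: "I (Suc j) (k1 + 2) s1 \<omega>1"
      have sr1: "same_except R (written_arrays body) s s1"
        by (rule same_except_trans[OF Suc.prems(1)], rule same_except_mono[OF s1]) (auto simp: R_def)
      have r: "regs s1 i = j"
        using s1 i(2) Suc.prems(2) by (simp add: same_except_def)
      show "wp V (Seq (Op Add i (Reg i) (Imm 1)) (Op Sub 2 x (Reg i))) (wp V ?W Q) k1 s1 \<omega>1"
      proof (intro wp_Seq wp_Op)
        let ?s2 = "set_reg i (apply_binop Add (opval s1 (Reg i)) (opval s1 (Imm 1))) s1"
        have e: "?s2 = set_reg i (Suc j) s1" by (simp add: r)
        have o: "opval ?s2 x = n" by (rule x) (use sr1 in \<open>auto simp: same_except_def R_def\<close>)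
        show "opval ?s2 x \<le> V" "opval ?s2 (Reg i) \<le> V" "opval s1 (Reg i) \<le> V" "opval s1 (Imm 1) \<le> V"
          using lim j r o by auto
        show "wp V ?W Q (k1 + 1 + 1) (set_reg 2 (apply_binop Sub (opval ?s2 x) (opval ?s2 (Reg i))) ?s2) \<omega>1"
          unfolding e o[unfolded e]
        proof (rule Suc.hyps(1)[of "Suc j"])
          show "same_except R (written_arrays body) s (set_reg 2 (apply_binop Sub n (opval (set_reg i (Suc j) s1) (Reg i))) (set_reg i (Suc j) s1))"
            by (rule sr[OF sr1])
          show "I (Suc j) (k1 + 1 + 1) (set_reg 2 (apply_binop Sub n (opval (set_reg i (Suc j) s1) (Reg i))) (set_reg i (Suc j) s1)) \<omega>1"
            using insens[OF I1] by simp
        qed (use Suc.hyps(2) j i(1) in auto)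
      qed
    qed
    then show ?case
      by (intro wp_WhileT wp_Seq) (use Suc.prems Suc.hyps(2) lim in auto)
  qed
  show ?thesis
    unfolding For_def
  proof (intro wp_Seq wp_Move wp_Op)
    let ?s1 = "set_reg i (opval s (Imm 0)) s"
    have o: "opval ?s1 x = n"
      by (rule x) (auto simp: same_except_def R_def)
    show "opval ?s1 x \<le> V" "opval ?s1 (Reg i) \<le> V" "opval s (Imm 0) \<le> V"
      using o lim by auto
    show "wp V (While (Reg 2) (Seq body (Seq (Op Add i (Reg i) (Imm 1)) (Op Sub 2 x (Reg i))))) Q (k + 1 + 1)
      (set_reg 2 (apply_binop Sub (opval ?s1 x) (opval ?s1 (Reg i))) ?s1) \<omega>"
      by (rule loop[of _ 0]) (use sr[of s] i(1) o insens init in auto)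
  qed
qed

section \<open>Subroutines\<close>

primrec shift_operand :: "nat \<Rightarrow> operand \<Rightarrow> operand" where
  "shift_operand d (Imm k) = Imm k"
| "shift_operand d (Reg r) = Reg (r + d)"

text \<open>Relocation of a program: a given rewriting algorithm may use any registers and arrays,
  so it is moved above those of the surrounding code.\<close>

primrec shift_com :: "nat \<Rightarrow> nat \<Rightarrow> com \<Rightarrow> com" where
  "shift_com d e Skip = Skip"
| "shift_com d e (Move r x) = Move (r + d) (shift_operand d x)"
| "shift_com d e (Op f r x y) = Op f (r + d) (shift_operand d x) (shift_operand d y)"
| "shift_com d e (Load r a x) = Load (r + d) (a + e) (shift_operand d x)"
| "shift_com d e (Store a x y) = Store (a + e) (shift_operand d x) (shift_operand d y)"
| "shift_com d e (Flip r) = Flip (r + d)"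
| "shift_com d e (Seq p q) = Seq (shift_com d e p) (shift_com d e q)"
| "shift_com d e (Cond x p q) = Cond (shift_operand d x) (shift_com d e p) (shift_com d e q)"
| "shift_com d e (While x p) = While (shift_operand d x) (shift_com d e p)"

definition embeds :: "nat \<Rightarrow> nat \<Rightarrow> state \<Rightarrow> state \<Rightarrow> bool" where
  "embeds d e s S \<longleftrightarrow>
     (\<forall>r. regs S (r + d) = regs s r) \<and> (\<forall>a i. arrays S (a + e) i = arrays s a i)"

lemma embeds_opval: "embeds d e s S \<Longrightarrow> opval S (shift_operand d x) = opval s x"
  by (cases x) (auto simp: embeds_def)

text \<open>The time is preserved exactly because costs depend on the values and cell indices
  handled, not on the names of registers and arrays. Additional coin tosses \<open>\<rho>\<close>
  pass through untouched, so a run without tosses can be embedded in a randomized one.\<close>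

lemma exec_shift_com:
  assumes "exec p s \<omega> t s' \<omega>'" "embeds d e s S"
  shows "\<exists>S'. exec (shift_com d e p) S (\<omega> @ \<rho>) t S' (\<omega>' @ \<rho>) \<and> embeds d e s' S' \<and>
    same_except {d..} {e..} S S'"
  using assms
proof (induction arbitrary: S rule: exec.induct)
  case (Skip s \<omega>)
  then show ?case unfolding shift_com.simps using exec.Skip same_except_refl by blast
next
  case (Move r x s \<omega>)
  show ?case
    unfolding shift_com.simps embeds_opval[OF Move, symmetric]
    by (intro exI conjI, rule exec.Move)
      (use Move in \<open>auto simp: embeds_def same_except_def embeds_opval[OF Move]\<close>)
next
  case (Op f r x y s \<omega>)
  show ?case
    unfolding shift_com.simps embeds_opval[OF Op, symmetric]
    by (intro exI conjI, rule exec.Op)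
      (use Op in \<open>auto simp: embeds_def same_except_def embeds_opval[OF Op]\<close>)
next
  case (Load r a x s \<omega>)
  have "arrays s a (opval s x) = arrays S (a + e) (opval S (shift_operand d x))"
    using Load by (simp add: embeds_opval[OF Load]) (simp add: embeds_def)
  note eq = this embeds_opval[OF Load, symmetric]
  show ?case
    unfolding shift_com.simps eq(2) eq(1)[unfolded eq(2)]
    by (intro exI conjI, rule exec.Load)
      (use Load in \<open>auto simp: embeds_def same_except_def embeds_opval[OF Load]\<close>)
next
  case (Store a x y s \<omega>)
  show ?case
    unfolding shift_com.simps embeds_opval[OF Store, symmetric]
    by (intro exI conjI, rule exec.Store)
      (use Store in \<open>auto simp: embeds_def same_except_def embeds_opval[OF Store]\<close>)
next
  case (Flip r s b \<omega>)
  show ?case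
    unfolding shift_com.simps append_Cons
    by (intro exI conjI, rule exec.Flip)
      (use Flip in \<open>auto simp: embeds_def same_except_def\<close>)
next
  case (Seq p s \<omega> t s' \<omega>' q t' s'' \<omega>'')
  obtain S' where 1: "exec (shift_com d e p) S (\<omega> @ \<rho>) t S' (\<omega>' @ \<rho>)" "embeds d e s' S'"
    "same_except {d..} {e..} S S'"
    using Seq.IH(1) Seq.prems by blast
  obtain S'' where 2: "exec (shift_com d e q) S' (\<omega>' @ \<rho>) t' S'' (\<omega>'' @ \<rho>)"
    "embeds d e s'' S''" "same_except {d..} {e..} S' S''"
    using Seq.IH(2) 1(2) by blast
  show ?case
    unfolding shift_com.simps using exec.Seq[OF 1(1) 2(1)] 2(2) same_except_trans[OF 1(3) 2(3)] by blast
next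
  case (CondT s x p \<omega> t s' \<omega>' q)
  then obtain S' where "exec (shift_com d e p) S (\<omega> @ \<rho>) t S' (\<omega>' @ \<rho>)" "embeds d e s' S'"
    "same_except {d..} {e..} S S'"
    by blast
  moreover from this(1) have "exec (shift_com d e (Cond x p q)) S (\<omega> @ \<rho>) (bit_cost (opval s x) + t) S' (\<omega>' @ \<rho>)"
    using exec.CondT[of S "shift_operand d x"] CondT.hyps(1)
    by (simp add: embeds_opval[OF CondT.prems])
  ultimately show ?case by blast
next
  case (CondF s x q \<omega> t s' \<omega>' p)
  then obtain S' where "exec (shift_com d e q) S (\<omega> @ \<rho>) t S' (\<omega>' @ \<rho>)" "embeds d e s' S'"
    "same_except {d..} {e..} S S'"
    by blast
  moreover from this(1) have "exec (shift_com d e (Cond x p q)) S (\<omega> @ \<rho>) (bit_cost (opval s x) + t) S' (\<omega>' @ \<rho>)"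
    using exec.CondF[of S "shift_operand d x"] CondF.hyps(1)
    by (simp add: embeds_opval[OF CondF.prems])
  ultimately show ?case by blast
next
  case (WhileF s x p \<omega>)
  have "exec (shift_com d e (While x p)) S (\<omega> @ \<rho>) (bit_cost (opval s x)) S (\<omega> @ \<rho>)"
    using exec.WhileF[of S "shift_operand d x"] WhileF.hyps(1)
    by (simp add: embeds_opval[OF WhileF.prems])
  then show ?case using WhileF.prems same_except_refl by blast
next
  case (WhileT s x p \<omega> t s' \<omega>' t' s'' \<omega>'')
  obtain S' where 1: "exec (shift_com d e p) S (\<omega> @ \<rho>) t S' (\<omega>' @ \<rho>)" "embeds d e s' S'"
    "same_except {d..} {e..} S S'"
    using WhileT.IH(1) WhileT.prems by blast
  obtain S'' where 2: "exec (shift_com d e (While x p)) S' (\<omega>' @ \<rho>) t' S'' (\<omega>'' @ \<rho>)"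
    "embeds d e s'' S''" "same_except {d..} {e..} S' S''"
    using WhileT.IH(2) 1(2) by blast
  have "exec (shift_com d e (While x p)) S (\<omega> @ \<rho>) (bit_cost (opval s x) + t + t') S'' (\<omega>'' @ \<rho>)"
    using exec.WhileT[of S "shift_operand d x" "shift_com d e p", OF _ 1(1)] 2(1) WhileT.hyps(1)
    by (simp add: embeds_opval[OF WhileT.prems])
  then show ?case
    using 2 1(3) same_except_trans by blast
qed

text \<open>Every \<open>Store\<close> takes at least one time unit and creates at most one nonzero
  cell. The output length in register 1 alone gives no such bound, since a short run can make that
  number exponentially large.\<close>

lemma exec_card_nonzero_cells:
  assumes "exec p s \<omega> t s' \<omega>'" "finite {i. arrays s a i \<noteq> 0}"
  shows "finite {i. arrays s' a i \<noteq> 0} \<and>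
    card {i. arrays s' a i \<noteq> 0} \<le> card {i. arrays s a i \<noteq> 0} + t"
  using assms
proof (induction rule: exec.induct)
  case (Store b x y s \<omega>)
  let ?s' = "set_cell b (opval s x) (opval s y) s"
  have sub: "{i. arrays ?s' a i \<noteq> 0} \<subseteq> insert (opval s x) {i. arrays s a i \<noteq> 0}"
    by auto
  have "card {i. arrays ?s' a i \<noteq> 0} \<le> card (insert (opval s x) {i. arrays s a i \<noteq> 0})"
    using Store sub by (intro card_mono) auto
  also have "\<dots> \<le> card {i. arrays s a i \<noteq> 0} + 1"
    using card_insert_le_m1 card_insert_if[OF Store] by auto
  also have "1 \<le> bit_cost (opval s x) + bit_cost (opval s y)"
    using bit_cost_pos[of "opval s x"] by linarith
  finally show ?case
    using Store finite_subset[OF sub] by simp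
qed auto

section \<open>Evaluating circuits\<close>

text \<open>Appending never changes earlier values, and a gate only reads earlier vertices; hence
  its defining equation also holds with the final list of values on the right-hand side.\<close>

lemma foldl_vertex_values:
  fixes f :: "'a list \<Rightarrow> 'a"
  defines "F \<equiv> foldl (\<lambda>vs ps. vs @ [f (map ((!) vs) ps)])"
  shows "length (F vs gs) = length vs + length gs"
    and "v < length vs \<Longrightarrow> F vs gs ! v = vs ! v"
    and "k < length gs \<Longrightarrow> set (gs ! k) \<subseteq> {..<length vs + k} \<Longrightarrow>
      F vs gs ! (length vs + k) = f (map ((!) (F vs gs)) (gs ! k))"
proof -
  have snoc: "F vs (gs @ [ps]) = F vs gs @ [f (map ((!) (F vs gs)) ps)]" for vs gs ps
    by (simp add: F_def)
  show len: "length (F vs gs) = length vs + length gs" for gs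
    by (induction gs rule: rev_induct) (simp_all add: snoc, simp add: F_def)
  show "v < length vs \<Longrightarrow> F vs gs ! v = vs ! v"
    by (induction gs rule: rev_induct) (simp add: F_def, simp add: snoc nth_append len)
  show "k < length gs \<Longrightarrow> set (gs ! k) \<subseteq> {..<length vs + k} \<Longrightarrow>
      F vs gs ! (length vs + k) = f (map ((!) (F vs gs)) (gs ! k))"
  proof (induction gs rule: rev_induct)
    case (snoc ps gs)
    have gk: "(gs @ [ps]) ! k = (if k < length gs then gs ! k else ps)"
      using snoc.prems(1) by (auto simp: nth_append less_Suc_eq)
    have eq: "map ((!) (F vs (gs @ [ps]))) ((gs @ [ps]) ! k) = map ((!) (F vs gs)) ((gs @ [ps]) ! k)"
      using snoc.prems by (intro map_cong) (auto simp: \<open>\<And>vs gs ps. F vs (gs @ [ps]) = _\<close> nth_append len)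
    have "F vs (gs @ [ps]) ! (length vs + k) = f (map ((!) (F vs gs)) ((gs @ [ps]) ! k))"
      using snoc by (auto simp: \<open>\<And>vs gs ps. F vs (gs @ [ps]) = _\<close> nth_append len gk less_Suc_eq)
    then show ?case by (simp only: eq)
  qed simp
qed

lemma vertex_values_input: "v < inputs C \<Longrightarrow> vertex_values f x C ! v = x v"
  by (simp add: vertex_values_def foldl_vertex_values)

lemma vertex_values_gate:
  assumes "wf_circuit C" "k < length (gates C)"
  shows "vertex_values f x C ! (inputs C + k) =
    f (map ((!) (vertex_values f x C)) (gates C ! k))"
  using assms foldl_vertex_values(3)[of k "gates C" "map x [0..<inputs C]" f]
  by (simp add: vertex_values_def wf_circuit_def)

text \<open>A map that commutes with the gate operation commutes with the evaluation of every
  vertex, by induction along the topological order.\<close>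

lemma vertex_values_hom:
  assumes "wf_circuit C" and x: "\<And>j. j < inputs C \<Longrightarrow> h (x j) = y j"
    and f: "\<And>vs. h (f vs) = g (map h vs)"
    and "v < inputs C + length (gates C)"
  shows "h (vertex_values f x C ! v) = vertex_values g y C ! v"
  using assms(4)
proof (induction v rule: less_induct)
  case (less v)
  show ?case
  proof (cases "v < inputs C")
    case True
    then show ?thesis by (simp add: vertex_values_input x)
  next
    case False
    then obtain k where v: "v = inputs C + k" using le_Suc_ex by (metis not_less)
    then have k: "k < length (gates C)" using less.prems by simp
    have "set (gates C ! k) \<subseteq> {..<inputs C + k}"
      using assms(1) k by (simp add: wf_circuit_def)
    then have "map h (map ((!) (vertex_values f x C)) (gates C ! k)) =
        map ((!) (vertex_values g y C)) (gates C ! k)"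
      unfolding map_map using less v by (intro map_cong) auto
    then show ?thesis
      by (simp only: v vertex_values_gate[OF assms(1) k] f)
  qed
qed

text \<open>Substituting \<open>x\<close> into a formal linear form with coefficients reduced mod 2
  is additive; call this map \<open>h\<close>. It carries the SUM evaluation on the indeterminates
  to the XOR evaluation on \<open>x\<close>, vertex by vertex.\<close>

lemma SUM_computes_imp_XOR_computes:
  assumes wf: "wf_circuit C" and C: "SUM_computes C A"
  shows "XOR_computes C A"
  unfolding XOR_computes_def
proof (intro conjI allI impI)
  show dims: "circuit_dims C A"
    using C by (simp add: SUM_computes_def)
  fix x :: "nat \<Rightarrow> bit" and i
  assume i: "i < dim_row A"
  define h :: "(nat \<Rightarrow>\<^sub>0 nat) \<Rightarrow> bit"
    where "h p = (\<Sum>j < inputs C. of_nat (Poly_Mapping.lookup p j) * x j)" for p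
  have h0: "h 0 = 0" and hadd: "h (p + q) = h p + h q" for p q
    unfolding h_def lookup_add of_nat_add distrib_right sum.distrib by simp_all
  have hsingle: "h (Poly_Mapping.single j c) = of_nat c * x j" if "j < inputs C" for j c
  proof -
    have "h (Poly_Mapping.single j c) = (\<Sum>j' < inputs C. if j' = j then of_nat c * x j else 0)"
      unfolding h_def by (intro sum.cong) (auto simp: lookup_single when_def)
    then show ?thesis using that by simp
  qed
  have hlist: "h (sum_list vs) = sum_list (map h vs)" for vs
    by (induction vs) (simp_all add: h0 hadd)
  have hsum: "h (sum g S) = (\<Sum>j\<in>S. h (g j))" for g and S :: "nat set"
    by (induction S rule: infinite_finite_induct) (simp_all add: h0 hadd)
  have "outputs C ! i < inputs C + length (gates C)"
    using wf dims i nth_mem[of i "outputs C"] by (auto simp: wf_circuit_def circuit_dims_def simp del: nth_mem)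
  then have "output_value sum_list x C i =
      h (output_value sum_list (\<lambda>j. Poly_Mapping.single j 1) C i)"
    unfolding output_value_def
    by (intro vertex_values_hom[OF wf, symmetric]) (simp_all add: hsingle hlist)
  also have "\<dots> = h (\<Sum>j < dim_col A. Poly_Mapping.single j (of_bool (A $$ (i, j))))"
    using C i by (simp only: SUM_computes_def)
  also have "\<dots> = (\<Sum>j < dim_col A. of_bool (A $$ (i, j)) * x j)"
    unfolding hsum using dims by (intro sum.cong) (auto simp: circuit_dims_def hsingle)
  finally show "output_value sum_list x C i = (\<Sum>j < dim_col A. of_bool (A $$ (i, j)) * x j)" .
qed

section \<open>From formulas to circuits\<close>

abbreviation then_com (infixr ";;" 55) where "p ;; q \<equiv> Seq p q"

text \<open>
  Symbolic execution always works on the first subgoal, so the continuation has to come before the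
  side conditions on the sizes of the operands.
\<close>

lemmas wp_basic = wp_Op[rotated 2] wp_Load[rotated 2] wp_Store[rotated 2] wp_Move[rotated 1]
  wp_Cond[rotated 1] wp_Skip

lemma opval_set_reg [simp]:
  "opval (set_reg r v s) x = (if x = Reg r then v else opval s x)"
  by (cases x) auto

text \<open>
  Registers: 2 scratch of \<open>For\<close>; 3, 4 the numbers \<open>n\<close>, \<open>m\<close> of variables and clauses;
  5 \<open>h = (n + 1) div 2\<close>; 6 \<open>M = 2 ^ h\<close>; 19 \<open>M + 1\<close>; 21 the answer.
  Arrays: 2 the powers \<open>2 ^ v\<close>, twice in succession, so that variables \<open>v\<close> and \<open>v + h\<close> of the two
  halves are decoded alike; 3, 4 truth tables of the clauses on the two halves; 5 vertex values.
  The rewriting algorithm runs with registers shifted by 100 and arrays by 20, so register 100 and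
  array 20 are its input, and register 101 and array 21 its output.
\<close>

definition powers_body :: com where
  "powers_body = Store 2 (Reg 7) (Reg 6) ;; Op Add 8 (Reg 7) (Reg 5) ;; Store 2 (Reg 8) (Reg 6) ;;
     Op Add 6 (Reg 6) (Reg 6)"

definition prepare :: com where
  "prepare = Load 3 0 (Imm 0) ;; Load 4 0 (Imm 1) ;; Op Add 5 (Reg 3) (Imm 1) ;;
     Op Div 5 (Reg 5) (Imm 2) ;; Move 6 (Imm 1) ;; For 7 (Reg 5) powers_body"

lemma wp_powers:
  assumes s: "regs s 5 = h" "regs s 6 = 1" and V: "2 ^ h \<le> V" "2 * h \<le> V"
  shows "wp V (For 7 (Reg 5) powers_body) (\<lambda>k' s' \<omega>'. \<omega>' = \<omega> \<and> k' \<le> k + 3 + 7 * h \<and> regs s' 6 = 2 ^ h \<and>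
    (\<forall>v<h. arrays s' 2 v = 2 ^ v \<and> arrays s' 2 (v + h) = 2 ^ v)) k s \<omega>"
proof (rule wp_For[where n = h and I = "\<lambda>j k' s' \<omega>'. \<omega>' = \<omega> \<and> k' \<le> k + 2 + 7 * j \<and> regs s' 6 = 2 ^ j \<and>
      (\<forall>v<j. arrays s' 2 v = 2 ^ v \<and> arrays s' 2 (v + h) = 2 ^ v)"])
  fix j k' s' \<omega>'
  assume j: "j < h" and fr: "same_except (insert 7 (insert 2 (written_regs powers_body))) (written_arrays powers_body) s s'"
    and i: "regs s' 7 = j" and I: "\<omega>' = \<omega> \<and> k' \<le> k + 2 + 7 * j \<and> regs s' 6 = 2 ^ j \<and>
      (\<forall>v<j. arrays s' 2 v = 2 ^ v \<and> arrays s' 2 (v + h) = 2 ^ v)"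
  have "(2::nat) ^ j \<le> 2 ^ h" using j by simp
  then have V': "(2::nat) ^ j \<le> V" using V by linarith
  have r: "regs s' 5 = h" using same_exceptD(1)[OF fr] s by (simp add: powers_body_def)
  show "wp V powers_body (\<lambda>k' s' \<omega>'. \<omega>' = \<omega> \<and> k' + 3 \<le> k + 2 + 7 * Suc j \<and> regs s' 6 = 2 ^ Suc j \<and>
      (\<forall>v<Suc j. arrays s' 2 v = 2 ^ v \<and> arrays s' 2 (v + h) = 2 ^ v)) k' s' \<omega>'"
    unfolding powers_body_def
    apply (rule wp_Seq | ((rule wp_Store wp_Op); (use i r I j V V' in simp)?))+
    done
qed (use s V order_trans[OF one_le_power[of "2::nat" h] V(1)] in \<open>auto simp: powers_body_def\<close>)

lemma wp_prepare:
  assumes s: "arrays s 0 0 = n" "arrays s 0 1 = m"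
    and h: "h = (n + 1) div 2" and V: "n + 3 \<le> V" "m \<le> V" "2 ^ h \<le> V"
  shows "wp V prepare (\<lambda>k' s' \<omega>'. \<omega>' = \<omega> \<and> k' \<le> k + 8 + 7 * h \<and> regs s' 3 = n \<and> regs s' 4 = m \<and>
    regs s' 5 = h \<and> regs s' 6 = 2 ^ h \<and> (\<forall>v<h. arrays s' 2 v = 2 ^ v \<and> arrays s' 2 (v + h) = 2 ^ v)) k s \<omega>"
proof -
  have h2: "2 * h \<le> V" using h V by linarith
  show ?thesis
    unfolding prepare_def
    apply (rule wp_Seq | ((rule wp_Load wp_Op wp_Move); (use s V h in simp)?))+
    apply (rule wp_conseq[OF wp_powers[where h = h and V = V]])
    using V h2 s h by (auto simp: powers_body_def same_except_def)
qed


text \<open>An assignment to the lower half is a number \<open>a\<close> whose bit \<open>v\<close>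
  is the value of variable \<open>v\<close>. Literals of the upper half count as falsified, so that
  a clause is falsified by a pair of half assignments iff all its literals satisfy both
  \<open>falsifiesL\<close> and \<open>falsifiesR\<close>.\<close>

definition falsifiesL :: "nat \<Rightarrow> nat \<Rightarrow> nat \<times> bool \<Rightarrow> bool" where
  "falsifiesL h a l \<longleftrightarrow> (fst l < h \<longrightarrow> odd (a div 2 ^ fst l) \<noteq> snd l)"

definition falsifiesR :: "nat \<Rightarrow> nat \<Rightarrow> nat \<times> bool \<Rightarrow> bool" where
  "falsifiesR h a l \<longleftrightarrow> (h \<le> fst l \<longrightarrow> odd (a div 2 ^ (fst l - h)) \<noteq> snd l)"

text \<open>Registers 12 and 13 are the flags "clause falsified so far" for the lower and the upper
  half. A nonzero register 17 means that the literal is satisfied; \<open>h - v\<close> in register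
  18 decides which half the variable is in, hence which flag is cleared.\<close>

definition mark :: com where
  "mark = Cond (Reg 17)
     (Op Sub 18 (Reg 5) (Reg 16) ;; Cond (Reg 18) (Move 12 (Imm 0)) (Move 13 (Imm 0))) Skip"

text \<open>The literal number \<open>2 * v + b\<close> is split into \<open>v\<close> and
  \<open>b\<close>, and bit \<open>v\<close> or \<open>v - h\<close> of the assignment is isolated
  by dividing by the tabulated power of 2. The same number \<open>a\<close> is treated as an
  assignment to either half, so one pass serves both truth tables.\<close>

definition literal_body :: com where
  "literal_body =
     Op Add 15 (Reg 9) (Reg 14) ;; Load 15 0 (Reg 15) ;;
     Op Div 16 (Reg 15) (Imm 2) ;;
     Op Add 17 (Reg 16) (Reg 16) ;; Op Sub 15 (Reg 15) (Reg 17) ;;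
     Load 17 2 (Reg 16) ;; Op Div 17 (Reg 11) (Reg 17) ;;
     Op Div 18 (Reg 17) (Imm 2) ;; Op Add 18 (Reg 18) (Reg 18) ;; Op Sub 17 (Reg 17) (Reg 18) ;;
     Op Add 17 (Reg 17) (Reg 15) ;;
     Op Sub 18 (Reg 17) (Imm 1) ;; Op Sub 17 (Imm 1) (Reg 17) ;; Op Add 17 (Reg 17) (Reg 18) ;;
     mark"

text \<open>Array 3 is indexed by clause, then assignment; array 4 by assignment, then clause. Each
  fan-in list is later read off one contiguous row: a clause gate collects lower half assignments,
  an output gate collects clauses.\<close>

definition assignment_body :: com where
  "assignment_body =
     Move 12 (Imm 1) ;; Move 13 (Imm 1) ;; For 14 (Reg 10) literal_body ;;
     Op Mul 15 (Reg 7) (Reg 6) ;; Op Add 15 (Reg 15) (Reg 11) ;; Store 3 (Reg 15) (Reg 12) ;;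
     Op Mul 15 (Reg 11) (Reg 4) ;; Op Add 15 (Reg 15) (Reg 7) ;; Store 4 (Reg 15) (Reg 13)"

definition clause_body :: com where
  "clause_body =
     Load 10 0 (Reg 9) ;; Op Add 9 (Reg 9) (Imm 1) ;; For 11 (Reg 6) assignment_body ;;
     Op Add 9 (Reg 9) (Reg 10)"

definition tabulate :: com where
  "tabulate = Move 9 (Imm 2) ;; For 7 (Reg 4) clause_body"

text \<open>The machine has no remainder operation; this is how the programs take parities.\<close>

lemma minus_double_half: "y - (y div 2 + y div 2) = of_bool (odd (y::nat))"
  by (cases "even y") (auto elim!: evenE oddE)

lemma wp_mark:
  assumes "regs s 17 \<noteq> 0 \<longleftrightarrow> sat" "regs s 16 = v" "regs s 5 = h" "regs s 17 \<le> V" "v \<le> V" "h \<le> V"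
    and Q: "\<And>k' s'. same_except {12, 13, 18} {} s s' \<Longrightarrow> k' \<le> k + 4 \<Longrightarrow>
      regs s' 12 = (if sat \<and> v < h then 0 else regs s 12) \<Longrightarrow>
      regs s' 13 = (if sat \<and> h \<le> v then 0 else regs s 13) \<Longrightarrow> Q k' s' \<omega>"
  shows "wp V mark Q k s \<omega>"
proof -
  have *: "wp V (Op Sub 18 (Reg 5) (Reg 16) ;; Cond (Reg 18) (Move 12 (Imm 0)) (Move 13 (Imm 0))) Q (k + 1) s \<omega>"
    if sat
  proof (rule wp_Seq, rule wp_Op)
    show "wp V (Cond (Reg 18) (Move 12 (Imm 0)) (Move 13 (Imm 0))) Q (k + 1 + 1)
        (set_reg 18 (apply_binop Sub (opval s (Reg 5)) (opval s (Reg 16))) s) \<omega>"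
      by (rule wp_Cond; (rule wp_Move Q)?) (use assms(2-6) that in \<open>auto intro!: wp_Move Q simp: same_except_def\<close>)
  qed (use assms in auto)
  have **: "wp V Skip Q (k + 1) s \<omega>" if "\<not> sat"
    by (intro wp_Skip Q) (use that in auto)
  show ?thesis
    unfolding mark_def by (rule wp_Cond) (use assms(1,4) * ** in auto)
qed

lemma wp_literal:
  fixes v :: nat
  assumes r: "regs s 9 = p" "regs s 14 = j" "regs s 11 = a" "regs s 5 = h"
    "arrays s 0 (p + j) = 2 * v + of_bool b" "arrays s 2 v = 2 ^ (if v < h then v else v - h)"
    and V: "p + j \<le> V" "2 * v + 2 \<le> V" "a \<le> V" "h \<le> V" "2 ^ (if v < h then v else v - h) \<le> V"
    "2 \<le> V"
    and Q: "\<And>k' s'. same_except {12, 13, 15, 16, 17, 18} {} s s' \<Longrightarrow> k' \<le> k + 18 \<Longrightarrow>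
      regs s' 12 = (if falsifiesL h a (v, b) then regs s 12 else 0) \<Longrightarrow>
      regs s' 13 = (if falsifiesR h a (v, b) then regs s 13 else 0) \<Longrightarrow> Q k' s' \<omega>"
  shows "wp V literal_body Q k s \<omega>"
proof -
  define w where "w = (2::nat) ^ (if v < h then v else v - h)"
  define y where "y = a div w"
  define c where "c = (of_bool b :: nat)"
  define o' where "o' = (of_bool (odd y) :: nat)"
  have y: "y \<le> V" using V(3) div_le_dividend le_trans unfolding y_def by blast
  have fals: "falsifiesL h a (v, b) \<longleftrightarrow> (v < h \<longrightarrow> odd y \<noteq> b)" "falsifiesR h a (v, b) \<longleftrightarrow> (h \<le> v \<longrightarrow> odd y \<noteq> b)"
    by (auto simp: falsifiesL_def falsifiesR_def y_def w_def)
  have half: "y div 2 + y div 2 \<le> V" "y div 2 \<le> V" using y by linarith+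
  have c: "c \<le> 1" "o' \<le> 1" by (auto simp: c_def o'_def)
  have lit: "(2 * v + c) div 2 = v" "(2 * v + c) - (v + v) = c"
    using c by linarith+
  have vV: "p \<le> V" "j \<le> V" "v \<le> V" "2 * v + c \<le> V" "v + v \<le> V" "c \<le> V" "o' \<le> V" "o' + c \<le> V"
    using V c by linarith+
  \<comment> \<open>Two bits are equal iff their sum differs from 1; the two truncated differences
    add up to the distance of the sum from 1.\<close>
  have sat: "(1 - (o' + c) + (o' + c - 1) \<noteq> 0) \<longleftrightarrow> odd y = b" "1 - (o' + c) + (o' + c - 1) \<le> V"
    using vV V by (auto simp: c_def o'_def)
  note r' = r(1-4) r(5)[folded c_def] r(6)[folded w_def]
  note f = r' y_def[symmetric] lit minus_double_half[of y, folded o'_def] V(1-4,6) V(5)[folded w_def] y half vV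
  show ?thesis
    unfolding literal_body_def
    apply (rule wp_Seq | (rule wp_Op[rotated 2] wp_Load[rotated 2]; (simp add: f)?))+
    apply (rule wp_mark[where sat = "odd y = b" and v = v and h = h])
    apply (use sat in \<open>auto simp: f\<close>)[6]
    apply (rule Q)
    using V(6) vV by (auto simp: same_except_def fals)
qed

section \<open>Writing the encoding of a circuit\<close>

definition cells :: "nat list \<Rightarrow> nat \<Rightarrow> nat" where
  "cells xs i = (if i < length xs then xs ! i else 0)"

lemma cells_snoc: "cells (xs @ [v]) = (cells xs)(length xs := v)"
  by (auto simp: cells_def nth_append fun_eq_iff)

lemma cells_update: "(cells (xs @ a # ys))(length xs := b) = cells (xs @ b # ys)"
  by (auto simp: cells_def nth_append nth_Cons fun_eq_iff split: nat.split)

text \<open>This is the shape of an initial state with input \<open>xs\<close> after relocation by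
  100 registers and 20 arrays, so that the shifted rewriting algorithm can start right after the
  writing.\<close>

definition holds :: "nat list \<Rightarrow> state \<Rightarrow> bool" where
  "holds xs s \<longleftrightarrow> regs s 100 = length xs \<and> arrays s 20 = cells xs"

lemma holds_set_reg [simp]: "r \<noteq> 100 \<Longrightarrow> holds xs (set_reg r v s) = holds xs s"
  by (simp add: holds_def)

definition push :: "operand \<Rightarrow> com" where
  "push x = Store 20 (Reg 100) x ;; Op Add 100 (Reg 100) (Imm 1)"

lemma wp_push:
  assumes "holds xs s" "length xs < V" "opval s x \<le> V" "x \<noteq> Reg 100"
    and Q: "\<And>s'. holds (xs @ [opval s x]) s' \<Longrightarrow> same_except {100} {20} s s' \<Longrightarrow> Q (k + 2) s' \<omega>"
  shows "wp V (push x) Q k s \<omega>"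
  unfolding push_def
  apply (rule wp_Seq | ((rule wp_Store wp_Op); (use assms(1-3) in \<open>simp add: holds_def\<close>)?))+
  using Q[of "set_reg 100 (Suc (length xs)) (set_cell 20 (length xs) (opval s x) s)"] assms
  by (simp add: holds_def cells_snoc same_except_def)

definition emit_range :: "operand \<Rightarrow> operand \<Rightarrow> com" where
  "emit_range x off = For 7 x (Op Add 12 (Reg 7) off ;; push (Reg 12))"

lemma wp_emit_range:
  assumes s: "holds xs s" "opval s x = n" "opval s off = d"
    and ops: "x \<notin> Reg ` {2, 7, 12, 100}" "off \<notin> Reg ` {2, 7, 12, 100}"
    and V: "length xs + n + d + 1 \<le> V"
  shows "wp V (emit_range x off) (\<lambda>k' s' \<omega>'. \<omega>' = \<omega> \<and> k' \<le> k + 3 + 6 * n \<and>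
    holds (xs @ map (\<lambda>i. i + d) [0..<n]) s') k s \<omega>"
  unfolding emit_range_def
proof (rule wp_For[where n = n and I = "\<lambda>j k' s' \<omega>'. \<omega>' = \<omega> \<and> k' \<le> k + 2 + 6 * j \<and>
    holds (xs @ map (\<lambda>i. i + d) [0..<j]) s'"])
  let ?c = "Op Add 12 (Reg 7) off ;; push (Reg 12)"
  fix j k' s' \<omega>'
  assume j: "j < n" and fr: "same_except (insert 7 (insert 2 (written_regs ?c))) (written_arrays ?c) s s'"
    and i: "regs s' 7 = j" and I: "\<omega>' = \<omega> \<and> k' \<le> k + 2 + 6 * j \<and>
    holds (xs @ map (\<lambda>i. i + d) [0..<j]) s'"
  have off: "opval s' off = d"
    using ops s fr by (cases off) (auto simp: same_except_def push_def)
  show "wp V ?c (\<lambda>k' s' \<omega>'. \<omega>' = \<omega> \<and> k' + 3 \<le> k + 2 + 6 * Suc j \<and>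
    holds (xs @ map (\<lambda>i. i + d) [0..<Suc j]) s') k' s' \<omega>'"
    apply (rule wp_Seq | (rule wp_Op; (use off i j V in simp)?))+
    apply (rule wp_push[where xs = "xs @ map (\<lambda>i. i + d) [0..<j]"])
    using I V j off i by auto
qed (use s V ops in \<open>auto simp: push_def\<close>)

definition emit_cell :: "nat \<Rightarrow> operand \<Rightarrow> com" where
  "emit_cell tbl off = Op Add 12 (Reg 9) (Reg 11) ;; Load 12 tbl (Reg 12) ;;
       Cond (Reg 12) (Op Add 12 (Reg 11) off ;; push (Reg 12)) Skip"

text \<open>The length of a list of wires is only known after it is written; its cell is patched afterwards.\<close>

definition emit_body :: "operand \<Rightarrow> nat \<Rightarrow> operand \<Rightarrow> com" where
  "emit_body y tbl off =
     Move 8 (Reg 100) ;; push (Imm 0) ;; push (Imm 1) ;; Op Mul 9 (Reg 7) y ;;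
     For 11 y (emit_cell tbl off) ;;
     Op Sub 9 (Reg 100) (Reg 8) ;; Op Sub 9 (Reg 9) (Imm 1) ;; Store 20 (Reg 8) (Reg 9)"

definition emit :: "operand \<Rightarrow> operand \<Rightarrow> nat \<Rightarrow> operand \<Rightarrow> com" where
  "emit x y tbl off = For 7 x (emit_body y tbl off)"


lemma written_regs_emit_cell [simp]: "written_regs (emit_cell tbl off) = {12, 100}" "written_arrays (emit_cell tbl off) = {20}"
  by (auto simp: emit_cell_def push_def)

lemma wp_emit_cell:
  assumes s: "holds xs s" "regs s 9 = b" "regs s 11 = j" "opval s off = d"
    "arrays s tbl (b + j) = of_bool u"
    and ops: "off \<notin> Reg ` {12, 100}" and V: "length xs < V" "b + j \<le> V" "j + d \<le> V" "1 \<le> V"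
  shows "wp V (emit_cell tbl off)
    (\<lambda>k' s' \<omega>'. \<omega>' = \<omega> \<and> k' \<le> k + 6 \<and> holds (xs @ (if u then [j + d] else [])) s') k s \<omega>"
proof -
  have V': "b \<le> V" "j \<le> V" "d \<le> V" "of_bool u \<le> V" and off: "off \<noteq> Reg 12" using V ops by auto
  show ?thesis
    unfolding emit_cell_def
    apply (rule wp_Seq | (rule wp_basic; (use s off V V' in \<open>simp split del: if_split split_of_bool\<close>)?))+
     apply (rule wp_push[where xs = xs])
    using s off V V' by (auto intro!: wp_Skip)
qed

lemma wp_emit_cells:
  assumes s: "holds xs s" "opval s y = c" "opval s off = d" "regs s 9 = b"
    "\<And>j. j < c \<Longrightarrow> arrays s tbl (b + j) = of_bool (U j)"
    and ops: "{y, off} \<inter> Reg ` {2, 9, 11, 12, 100} = {}" "tbl \<noteq> 20"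
    and V: "length xs + c + d + 1 \<le> V" "b + c \<le> V"
  shows "wp V (For 11 y (emit_cell tbl off)) (\<lambda>k' s' \<omega>'. \<omega>' = \<omega> \<and> k' \<le> k + 3 + 9 * c \<and>
    holds (xs @ map (\<lambda>j. j + d) (filter U [0..<c])) s') k s \<omega>"
proof (rule wp_For[where n = c and I = "\<lambda>j k' s' \<omega>'. \<omega>' = \<omega> \<and> k' \<le> k + 2 + 9 * j \<and>
    holds (xs @ map (\<lambda>j. j + d) (filter U [0..<j])) s'"])
  fix j k' s' \<omega>'
  let ?c = "emit_cell tbl off"
  assume j: "j < c" and fr: "same_except (insert 11 (insert 2 (written_regs ?c))) (written_arrays ?c) s s'"
    and rj: "regs s' 11 = j" and I: "\<omega>' = \<omega> \<and> k' \<le> k + 2 + 9 * j \<and>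
    holds (xs @ map (\<lambda>j. j + d) (filter U [0..<j])) s'"
  have s': "opval s' off = d" "regs s' 9 = b" and tbl: "arrays s' tbl = arrays s tbl"
    using ops s fr by (cases off; auto simp: same_except_def)+
  have l: "length (filter U [0..<j]) \<le> j"
    using length_filter_le[of U "[0..<j]"] by simp
  show "wp V ?c (\<lambda>k' s' \<omega>'. \<omega>' = \<omega> \<and> k' + 3 \<le> k + 2 + 9 * Suc j \<and>
    holds (xs @ map (\<lambda>j. j + d) (filter U [0..<Suc j])) s') k' s' \<omega>'"
  proof (rule wp_conseq[OF wp_emit_cell[OF conjunct2[OF conjunct2[OF I]] s'(2) rj s'(1), of tbl "U j"]])
    show "arrays s' tbl (b + j) = of_bool (U j)" using s(5) j tbl by simp
  qed (use l j V ops I in auto)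
qed (use ops V s in auto)

lemma wp_emit_body:
  assumes s: "holds xs s" "opval s y = c" "opval s off = d" "regs s 7 = i"
    "\<And>j. j < c \<Longrightarrow> arrays s tbl (i * c + j) = of_bool (U j)"
    and ops: "{y, off} \<inter> Reg ` {2, 7, 8, 9, 11, 12, 100} = {}" "tbl \<noteq> 20"
    and V: "length xs + c + d + 3 \<le> V" "i * c + c \<le> V" "i \<le> V"
  defines "bs \<equiv> 1 # map (\<lambda>j. j + d) (filter U [0..<c])"
  shows "wp V (emit_body y tbl off) (\<lambda>k' s' \<omega>'. \<omega>' = \<omega> \<and> k' \<le> k + 12 + 9 * c \<and>
    holds (xs @ length bs # bs) s') k s \<omega>"
proof -
  have lbs: "length bs \<le> c + 1"
    using length_filter_le[of U "[0..<c]"] by (simp add: bs_def)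
  have r: "regs s 100 = length xs" using s by (simp add: holds_def)
  \<comment> \<open>The length cell is first written as 0 and then overwritten; \<open>bs\<close>
    starts with 1, the encoding of the dummy input 0 wired into the gate. The final
    \<open>Sub\<close> by 1 keeps the length cell itself from being counted.\<close>
  let ?Q = "\<lambda>k' s' \<omega>'. \<omega>' = \<omega> \<and> k' \<le> k + 12 + 9 * c \<and>
    regs s' 100 = length xs + Suc (length bs) \<and>
    arrays s' 20 = (cells (xs @ 0 # bs))(length xs := length bs)"
  have "wp V (emit_body y tbl off) ?Q k s \<omega>"
    unfolding emit_body_def
  proof (rule wp_Seq, rule wp_Move)
    show "opval s (Reg 100) \<le> V" using r V by simp
    let ?s1 = "set_reg 8 (opval s (Reg 100)) s"
    have h1: "holds xs ?s1" using s by simp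
    show "wp V (push (Imm 0) ;; push (Imm 1) ;; Op Mul 9 (Reg 7) y ;; For 11 y (emit_cell tbl off) ;;
      Op Sub 9 (Reg 100) (Reg 8) ;; Op Sub 9 (Reg 9) (Imm 1) ;; Store 20 (Reg 8) (Reg 9)) ?Q (k + 1) ?s1 \<omega>"
    proof (rule wp_Seq, rule wp_push[OF h1], goal_cases)
      case (4 s2)
      show ?case
      proof (rule wp_Seq, rule wp_push[OF 4(1)], goal_cases)
        case (4 s3)
        note fr = \<open>same_except {100} {20} ?s1 s2\<close> \<open>same_except {100} {20} s2 s3\<close>
        have h3: "holds (xs @ [0, 1]) s3" using 4(1) by simp
        have s3: "opval s3 y = c" "opval s3 off = d" "regs s3 7 = i" "regs s3 8 = length xs"
          "arrays s3 tbl = arrays s tbl"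
          using fr s ops r by (cases y; cases off; auto simp: same_except_def)+
        have "wp V (For 11 y (emit_cell tbl off) ;; Op Sub 9 (Reg 100) (Reg 8) ;;
          Op Sub 9 (Reg 9) (Imm 1) ;; Store 20 (Reg 8) (Reg 9)) ?Q (k + 6) (set_reg 9 (i * c) s3) \<omega>"
        proof (rule wp_seq_conseq[OF wp_emit_cells[where xs = "xs @ [0, 1]" and c = c and d = d and b = "i * c" and U = U]], goal_cases)
          case (10 k' s' \<omega>')
          have r8: "regs s' 8 = length xs" using 10(1) s3 by (simp add: same_except_def)
          have h: "holds (xs @ 0 # bs) s'" using 10(2) by (simp add: bs_def)
          show ?case
            apply (rule wp_Seq | (rule wp_basic; (use r8 h V lbs in \<open>simp add: holds_def\<close>)?))+
            using 10(2) h r8 by (auto simp: holds_def)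
        qed (use s s3 h3 ops V in auto)
        moreover have "k + 1 + 2 + 2 + 1 = k + 6" by simp
        moreover have "set_reg 9 (apply_binop Mul (opval s3 (Reg 7)) (opval s3 y)) s3 = set_reg 9 (i * c) s3"
          using s3 by simp
        ultimately have main: "wp V (For 11 y (emit_cell tbl off) ;; Op Sub 9 (Reg 100) (Reg 8) ;;
          Op Sub 9 (Reg 9) (Imm 1) ;; Store 20 (Reg 8) (Reg 9)) ?Q (k + 1 + 2 + 2 + 1)
          (set_reg 9 (apply_binop Mul (opval s3 (Reg 7)) (opval s3 y)) s3) \<omega>"
          by (simp only:)
        have "opval s3 (Reg 7) \<le> V" "opval s3 y \<le> V" using s3 V by simp_all
        then show ?case
          by (rule wp_Seq[OF wp_Op]) (rule main)
      qed (use V in auto)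
    qed (use V in auto)
  qed
  then show ?thesis
    by (rule wp_conseq) (auto simp: holds_def cells_update)
qed

text \<open>Serves both layers of gates. Every block has at most \<open>c + 2\<close> cells: the
  length, the dummy wire and at most \<open>c\<close> further wires, which gives the bound on the
  array index in \<open>V\<close>.\<close>

lemma wp_emit:
  assumes s: "holds xs s" "opval s x = n" "opval s y = c" "opval s off = d"
    "\<And>i j. i < n \<Longrightarrow> j < c \<Longrightarrow> arrays s tbl (i * c + j) = of_bool (U i j)"
    and ops: "{x, y, off} \<inter> Reg ` {2, 7, 8, 9, 11, 12, 100} = {}" "tbl \<noteq> 20"
    and V: "length xs + n * (c + 2) + d + c + n + 3 \<le> V"
  defines "blk \<equiv> \<lambda>i. 1 # map (\<lambda>j. j + d) (filter (U i) [0..<c])"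
  shows "wp V (emit x y tbl off) (\<lambda>k' s' \<omega>'. \<omega>' = \<omega> \<and> k' \<le> k + 3 + n * (15 + 9 * c) \<and>
    holds (xs @ concat (map (\<lambda>i. length (blk i) # blk i) [0..<n])) s') k s \<omega>"
  unfolding emit_def
proof (rule wp_For[where n = n and I = "\<lambda>i k' s' \<omega>'. \<omega>' = \<omega> \<and> k' \<le> k + 2 + i * (15 + 9 * c) \<and>
    holds (xs @ concat (map (\<lambda>i. length (blk i) # blk i) [0..<i])) s'"])
  fix i k' s' \<omega>'
  let ?c = "emit_body y tbl off"
  let ?xs = "xs @ concat (map (\<lambda>i. length (blk i) # blk i) [0..<i])"
  assume i: "i < n" and fr: "same_except (insert 7 (insert 2 (written_regs ?c))) (written_arrays ?c) s s'"
    and ri: "regs s' 7 = i" and I: "\<omega>' = \<omega> \<and> k' \<le> k + 2 + i * (15 + 9 * c) \<and> holds ?xs s'"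
  have wrc: "written_regs ?c = {8, 100, 9, 11, 2, 12}" "written_arrays ?c = {20}"
    by (auto simp: emit_body_def push_def)
  have s': "opval s' y = c" "opval s' off = d" and tbl: "arrays s' tbl = arrays s tbl"
    using ops s fr unfolding wrc by (cases y; cases off; auto simp: same_except_def)+
  have blklen: "length (blk i) \<le> c + 1" for i
    using length_filter_le[of "U i" "[0..<c]"] by (simp add: blk_def)
  have "length (concat (map (\<lambda>i. length (blk i) # blk i) [0..<i])) \<le> i * (c + 2)" for i
  proof (induction i)
    case (Suc i)
    then show ?case using blklen[of i] by simp
  qed simp
  then have len: "length ?xs \<le> length xs + i * (c + 2)" by simp
  have icn: "Suc i * (c + 2) \<le> n * (c + 2)" using i by (intro mult_le_mono1) simp
  then have len': "length ?xs + c + 2 \<le> length xs + n * (c + 2)" using len by simp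
  have ic: "i * c + c \<le> V"
    using icn V by (simp add: algebra_simps)
  show "wp V ?c (\<lambda>k' s' \<omega>'. \<omega>' = \<omega> \<and> k' + 3 \<le> k + 2 + Suc i * (15 + 9 * c) \<and>
    holds (xs @ concat (map (\<lambda>i. length (blk i) # blk i) [0..<Suc i])) s') k' s' \<omega>'"
  proof (rule wp_conseq[OF wp_emit_body[where xs = ?xs and c = c and d = d and i = i and U = "U i"]], goal_cases)
    case 1 show ?case using I by blast
  next
    case 2 show ?case by (rule s'(1))
  next
    case 3 show ?case by (rule s'(2))
  next
    case 4 show ?case by (rule ri)
  next
    case (5 j) then show ?case using s(5)[OF i] tbl by simp
  next
    case 6 show ?case using ops(1) by blast
  next
    case 7 show ?case by (rule ops(2))
  next
    case 8 show ?case using len' V by linarith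
  next
    case 9 show ?case by (rule ic)
  next
    case 10 show ?case using i V by linarith
  next
    case (11 k'' s'' \<omega>'')
    have "k'' + 3 \<le> k + 2 + Suc i * (15 + 9 * c)"
      using 11 I by simp
    then show ?case using 11 I by (simp add: blk_def)
  qed
qed (use s V ops in \<open>simp_all add: emit_body_def push_def\<close>)


section \<open>Verification of the truth tables\<close>

lemma wp_literals:
  assumes r: "regs s 9 = p" "regs s 11 = a" "regs s 5 = h" "regs s 10 = length cl"
    "regs s 12 = 1" "regs s 13 = 1"
    "\<And>j. j < length cl \<Longrightarrow> arrays s 0 (p + j) = (case cl ! j of (v, b) \<Rightarrow> 2 * v + of_bool b)"
    "\<And>v. v < h \<Longrightarrow> arrays s 2 v = 2 ^ v \<and> arrays s 2 (v + h) = 2 ^ v"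
    and cl: "\<And>v b. (v, b) \<in> set cl \<Longrightarrow> v < 2 * h"
    and V: "p + length cl \<le> V" "4 * h + 2 \<le> V" "a \<le> V" "2 ^ h \<le> V"
  shows "wp V (For 14 (Reg 10) literal_body) (\<lambda>k' s' \<omega>'. \<omega>' = \<omega> \<and> k' \<le> k + 3 + 21 * length cl \<and>
    regs s' 12 = of_bool (\<forall>l\<in>set cl. falsifiesL h a l) \<and>
    regs s' 13 = of_bool (\<forall>l\<in>set cl. falsifiesR h a l)) k s \<omega>"
proof (rule wp_For[where n = "length cl" and I = "\<lambda>j k' s' \<omega>'. \<omega>' = \<omega> \<and> k' \<le> k + 2 + 21 * j \<and>
    regs s' 12 = of_bool (\<forall>l\<in>set (take j cl). falsifiesL h a l) \<and>
    regs s' 13 = of_bool (\<forall>l\<in>set (take j cl). falsifiesR h a l)"])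
  fix j k' s' \<omega>'
  assume j: "j < length cl" and fr: "same_except (insert 14 (insert 2 (written_regs literal_body))) (written_arrays literal_body) s s'"
    and rj: "regs s' 14 = j" and I: "\<omega>' = \<omega> \<and> k' \<le> k + 2 + 21 * j \<and>
    regs s' 12 = of_bool (\<forall>l\<in>set (take j cl). falsifiesL h a l) \<and>
    regs s' 13 = of_bool (\<forall>l\<in>set (take j cl). falsifiesR h a l)"
  have wrl: "written_regs literal_body = {12, 13, 15, 16, 17, 18}" "written_arrays literal_body = {}"
    by (auto simp: literal_body_def mark_def)
  have s': "regs s' 9 = p" "regs s' 11 = a" "regs s' 5 = h" "arrays s' 0 = arrays s 0" "arrays s' 2 = arrays s 2"
    using fr r(1-3) unfolding wrl by (simp_all add: same_except_def)
  obtain v b where vb: "cl ! j = (v, b)" by (cases "cl ! j")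
  have v: "v < 2 * h" using cl[of v b] j vb nth_mem[of j cl] by simp
  let ?e = "if v < h then v else v - h"
  have pw: "arrays s' 2 v = 2 ^ ?e"
    using r(8)[of v] r(8)[of "v - h"] v s' by auto
  have "(2::nat) ^ ?e \<le> 2 ^ h" using v by (intro power_increasing) auto
  then have pV: "(2::nat) ^ ?e \<le> V" using V by linarith
  have tk: "take (Suc j) cl = take j cl @ [(v, b)]" using j vb by (simp add: take_Suc_conv_app_nth)
  show "wp V literal_body (\<lambda>k' s' \<omega>'. \<omega>' = \<omega> \<and> k' + 3 \<le> k + 2 + 21 * Suc j \<and>
    regs s' 12 = of_bool (\<forall>l\<in>set (take (Suc j) cl). falsifiesL h a l) \<and>
    regs s' 13 = of_bool (\<forall>l\<in>set (take (Suc j) cl). falsifiesR h a l)) k' s' \<omega>'"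
  proof (rule wp_literal[OF s'(1) rj s'(2,3) _ pw])
    show "arrays s' 0 (p + j) = 2 * v + of_bool b" using r(7)[OF j] vb s' by simp
    fix k'' s'' assume "same_except {12, 13, 15, 16, 17, 18} {} s' s''" "k'' \<le> k' + 18"
      and "regs s'' 12 = (if falsifiesL h a (v, b) then regs s' 12 else 0)"
      "regs s'' 13 = (if falsifiesR h a (v, b) then regs s' 13 else 0)"
    then show "\<omega>' = \<omega> \<and> k'' + 3 \<le> k + 2 + 21 * Suc j \<and>
      regs s'' 12 = of_bool (\<forall>l\<in>set (take (Suc j) cl). falsifiesL h a l) \<and>
      regs s'' 13 = of_bool (\<forall>l\<in>set (take (Suc j) cl). falsifiesR h a l)"
      using I unfolding tk by auto
  qed (use V v j pV in auto)
qed (use r V in \<open>auto simp: literal_body_def mark_def\<close>)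

lemma wp_assignment:
  assumes r: "regs s 9 = p" "regs s 11 = a" "regs s 5 = h" "regs s 10 = length cl"
    "regs s 7 = i" "regs s 6 = M" "regs s 4 = m"
    "\<And>j. j < length cl \<Longrightarrow> arrays s 0 (p + j) = (case cl ! j of (v, b) \<Rightarrow> 2 * v + of_bool b)"
    "\<And>v. v < h \<Longrightarrow> arrays s 2 v = 2 ^ v \<and> arrays s 2 (v + h) = 2 ^ v"
    and cl: "\<And>v b. (v, b) \<in> set cl \<Longrightarrow> v < 2 * h"
    and V: "p + length cl \<le> V" "4 * h + 2 \<le> V" "2 ^ h \<le> V" "i * M + a \<le> V" "a * m + i \<le> V" "M \<le> V" "m \<le> V"
  shows "wp V assignment_body (\<lambda>k' s' \<omega>'. \<omega>' = \<omega> \<and> k' \<le> k + 11 + 21 * length cl \<and>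
    arrays s' 3 = (arrays s 3)(i * M + a := of_bool (\<forall>l\<in>set cl. falsifiesL h a l)) \<and>
    arrays s' 4 = (arrays s 4)(a * m + i := of_bool (\<forall>l\<in>set cl. falsifiesR h a l))) k s \<omega>"
proof -
  have V1: "1 \<le> V" "a \<le> V" "i \<le> V" "of_bool u \<le> V" "i * M \<le> V" "a * m \<le> V" for u using V by auto
  show ?thesis
    unfolding assignment_body_def
    apply (rule wp_Seq, rule wp_Move, use V1 in simp)
    apply (rule wp_Seq, rule wp_Move, use V1 in simp)
    apply (rule wp_seq_conseq[OF wp_literals[where h = h and a = a and cl = cl and p = p]])
    apply (use r cl V V1 in \<open>auto\<close>)[13]
    subgoal premises prems for k' s' \<omega>'
    proof -
      have fr: "regs s' 7 = i" "regs s' 6 = M" "regs s' 11 = a" "regs s' 4 = m"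
        "arrays s' 3 = arrays s 3" "arrays s' 4 = arrays s 4"
        using prems(1) r by (simp_all add: same_except_def literal_body_def mark_def)
      show ?thesis
        apply (rule wp_Seq | (rule wp_basic; (use fr prems(2) V V1 in \<open>simp split del: if_split split_of_bool\<close>)?))+
        done
    qed
    done
qed

lemma mixed_radix_less:
  assumes "i < m" "j < M"
  shows "i * M + j < m * (M :: nat)"
proof -
  have "Suc i * M \<le> m * M" using assms by (intro mult_le_mono1) simp
  then show ?thesis using assms by simp
qed

text \<open>Uniqueness of quotient and remainder. It ensures that a write into one of the
  two-dimensional tables leaves all other entries unchanged.\<close>

lemma mixed_radix_eq:
  assumes "a < M" "j < M"
  shows "i' * M + a = i * M + (j :: nat) \<longleftrightarrow> i' = i \<and> a = j"
proof
  assume e: "i' * M + a = i * M + j"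
  from arg_cong[OF e, of "\<lambda>x. x div M"] arg_cong[OF e, of "\<lambda>x. x mod M"] show "i' = i \<and> a = j"
    using assms by simp
qed simp

lemma wp_clause:
  assumes r: "regs s 9 = p" "regs s 5 = h" "regs s 7 = i" "regs s 6 = M" "regs s 4 = m"
    "arrays s 0 p = length cl"
    "\<And>j. j < length cl \<Longrightarrow> arrays s 0 (Suc p + j) = (case cl ! j of (v, b) \<Rightarrow> 2 * v + of_bool b)"
    "\<And>v. v < h \<Longrightarrow> arrays s 2 v = 2 ^ v \<and> arrays s 2 (v + h) = 2 ^ v"
    and cl: "\<And>v b. (v, b) \<in> set cl \<Longrightarrow> v < 2 * h"
    and tab: "\<And>i' a. i' < i \<Longrightarrow> a < M \<Longrightarrow> arrays s 3 (i' * M + a) = TL i' a"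
       "\<And>i' a. i' < i \<Longrightarrow> a < M \<Longrightarrow> arrays s 4 (a * m + i') = TR i' a"
    and T: "\<And>a. TL i a = of_bool (\<forall>l\<in>set cl. falsifiesL h a l)" "\<And>a. TR i a = of_bool (\<forall>l\<in>set cl. falsifiesR h a l)"
    and i: "i < m"
    and V: "Suc p + length cl \<le> V" "4 * h + 2 \<le> V" "2 ^ h \<le> V" "M * m + M + m \<le> V"
  shows "wp V clause_body (\<lambda>k' s' \<omega>'. \<omega>' = \<omega> \<and> k' \<le> k + 6 + M * (14 + 21 * length cl) \<and>
    regs s' 9 = Suc p + length cl \<and>
    (\<forall>i'\<le>i. \<forall>a<M. arrays s' 3 (i' * M + a) = TL i' a \<and> arrays s' 4 (a * m + i') = TR i' a)) k s \<omega>"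
proof -
  \<comment> \<open>Earlier clauses are complete for all \<open>M\<close> assignments, the current
    clause \<open>i\<close> only for assignments below \<open>j\<close>.\<close>
  let ?I = "\<lambda>j k' s' \<omega>'. \<omega>' = \<omega> \<and> k' \<le> k + 2 + 2 + j * (14 + 21 * length cl) \<and>
    (\<forall>i'<i. \<forall>a<M. arrays s' 3 (i' * M + a) = TL i' a \<and> arrays s' 4 (a * m + i') = TR i' a) \<and>
    (\<forall>a<j. arrays s' 3 (i * M + a) = TL i a \<and> arrays s' 4 (a * m + i) = TR i a)"
  have wra: "written_regs assignment_body = {2, 12, 13, 14, 15, 16, 17, 18}" "written_arrays assignment_body = {3, 4}"
    by (auto simp: assignment_body_def literal_body_def mark_def)
  \<comment> \<open>\<open>wp_For\<close> adds the tick of the final test to the clock; the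
    postcondition is therefore the invariant one tick earlier, and \<open>1 \<le> k'\<close> makes
    the truncated subtraction exact.\<close>
  have loop: "wp V (For 11 (Reg 6) assignment_body) (\<lambda>k' s' \<omega>'. ?I M (k' - 1) s' \<omega>' \<and> 1 \<le> k') (k + 2) s1 \<omega>"
    if fr1: "same_except {9, 10} {} s s1" and r1: "regs s1 9 = Suc p" "regs s1 10 = length cl" for s1
  proof (rule wp_For[where n = M and I = ?I])
    fix j k' s' \<omega>'
    assume j: "j < M" and fr: "same_except (insert 11 (insert 2 (written_regs assignment_body))) (written_arrays assignment_body) s1 s'"
      and rj: "regs s' 11 = j" and I: "?I j k' s' \<omega>'"
    have s': "regs s' 9 = Suc p" "regs s' 10 = length cl" "regs s' 5 = h" "regs s' 7 = i" "regs s' 6 = M"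
      "regs s' 4 = m" "arrays s' 0 = arrays s 0" "arrays s' 2 = arrays s 2"
      using fr fr1 r r1 unfolding wra by (simp_all add: same_except_def)
    from mixed_radix_less[OF i j] mixed_radix_less[OF j i] have ij: "i * M + j \<le> V" "j * m + i \<le> V" using V(4) by (simp_all add: mult.commute)
    have inj3: "i' * M + a = i * M + j \<longleftrightarrow> i' = i \<and> a = j" if "a < M" for i' a
      using that j by (rule mixed_radix_eq)
    have inj4: "a * m + i' = j * m + i \<longleftrightarrow> i' = i \<and> a = j" if "i' < m" for i' a
      using that i mixed_radix_eq[of i' m i a j] by auto
    show "wp V assignment_body (\<lambda>k. ?I (Suc j) (k + 3)) k' s' \<omega>'"
    proof (rule wp_conseq[OF wp_assignment[where cl = cl, OF s'(1) rj s'(3,2,4,5,6)]], goal_cases)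
      case (11 k'' s'' \<omega>'')
      note a3 = 11(2)[THEN conjunct2, THEN conjunct2, THEN conjunct1]
        and a4 = 11(2)[THEN conjunct2, THEN conjunct2, THEN conjunct2]
      have "k'' + 3 \<le> k + 2 + 2 + Suc j * (14 + 21 * length cl)"
        using 11(2) I by simp
      moreover have "\<forall>i'<i. \<forall>a<M. arrays s'' 3 (i' * M + a) = TL i' a \<and> arrays s'' 4 (a * m + i') = TR i' a"
        using I inj3 inj4 i unfolding a3 a4 by auto
      moreover have "\<forall>a<Suc j. arrays s'' 3 (i * M + a) = TL i a \<and> arrays s'' 4 (a * m + i) = TR i a"
        using I inj3 inj4 i j unfolding a3 a4 by (auto simp: T less_Suc_eq)
      ultimately show ?case using 11(2) I by blast
    qed (use r(6-8) s' cl V ij in auto)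
  qed (use fr1 r tab V in \<open>auto simp: wra same_except_def\<close>)
  have lV: "length cl \<le> V" "p \<le> V" "Suc p \<le> V" "1 \<le> V" using V by auto
  let ?Q = "\<lambda>k' s' \<omega>'. \<omega>' = \<omega> \<and> k' \<le> k + 6 + M * (14 + 21 * length cl) \<and>
    regs s' 9 = Suc p + length cl \<and>
    (\<forall>i'\<le>i. \<forall>a<M. arrays s' 3 (i' * M + a) = TL i' a \<and> arrays s' 4 (a * m + i') = TR i' a)"
  let ?s1 = "set_reg 9 (Suc p) (set_reg 10 (length cl) s)"
  have main: "wp V (For 11 (Reg 6) assignment_body ;; Op Add 9 (Reg 9) (Reg 10)) ?Q (k + 2) ?s1 \<omega>"
  proof (rule wp_seq_conseq[OF loop])
    fix k' s' \<omega>'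
    assume fr: "same_except (written_regs (For 11 (Reg 6) assignment_body)) (written_arrays (For 11 (Reg 6) assignment_body)) ?s1 s'"
      and J: "?I M (k' - 1) s' \<omega>' \<and> 1 \<le> k'"
    have s': "regs s' 9 = Suc p" "regs s' 10 = length cl"
      using fr by (simp_all add: same_except_def wra)
    have Q: "?Q (k' + 1) (set_reg 9 (Suc p + length cl) s') \<omega>'"
    proof (intro conjI)
      show "\<omega>' = \<omega>" using J by blast
      show "k' + 1 \<le> k + 6 + M * (14 + 21 * length cl)" using J by linarith
      show "\<forall>i'\<le>i. \<forall>a<M. arrays (set_reg 9 (Suc p + length cl) s') 3 (i' * M + a) = TL i' a \<and>
          arrays (set_reg 9 (Suc p + length cl) s') 4 (a * m + i') = TR i' a"
        using J by (metis le_neq_implies_less arrays_set_reg)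
    qed simp
    show "wp V (Op Add 9 (Reg 9) (Reg 10)) ?Q k' s' \<omega>'"
    proof (rule wp_Op)
      show "?Q (k' + 1) (set_reg 9 (apply_binop Add (opval s' (Reg 9)) (opval s' (Reg 10))) s') \<omega>'"
        unfolding opval.simps apply_binop.simps s' by (rule Q)
    qed (use s' lV in simp_all)
  qed (auto simp: same_except_def)
  show ?thesis
    unfolding clause_body_def
    apply (rule wp_Seq, rule wp_Load; (use r(1,6) lV in \<open>simp only: opval.simps\<close>)?)
    apply (rule wp_Seq, rule wp_Op; (use r(1) lV in simp)?)
    using main unfolding add_2_eq_Suc' by (simp only: opval.simps apply_binop.simps r(1,6) regs_set_reg add_Suc add_Suc_right add_0_right One_nat_def if_False if_True)
qed

text \<open>Formulas and circuits are both encoded as two header numbers, hence the 2, followed by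
  length-prefixed blocks. This is the index at which block \<open>k\<close> starts; for
  \<open>k\<close> the number of blocks it is the index just behind the last one.\<close>

definition positions :: "'a list list \<Rightarrow> nat \<Rightarrow> nat" where
  "positions xss k = 2 + (\<Sum>i<k. Suc (length (xss ! i)))"

lemma positions_simps: "positions xss 0 = 2" "positions xss (Suc k) = Suc (positions xss k) + length (xss ! k)"
  by (simp_all add: positions_def)

lemma positions_le: "k \<le> length xss \<Longrightarrow> positions xss k \<le> positions xss (length xss)"
  unfolding positions_def by (intro add_left_mono sum_mono2) auto

lemma wp_tabulate:
  assumes r: "regs s 5 = h" "regs s 6 = M" "regs s 4 = length cls"
    "\<And>k. k < length cls \<Longrightarrow> arrays s 0 (positions cls k) = length (cls ! k)"
    "\<And>k j. k < length cls \<Longrightarrow> j < length (cls ! k) \<Longrightarrow>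
      arrays s 0 (Suc (positions cls k) + j) = (case cls ! k ! j of (v, b) \<Rightarrow> 2 * v + of_bool b)"
    "\<And>v. v < h \<Longrightarrow> arrays s 2 v = 2 ^ v \<and> arrays s 2 (v + h) = 2 ^ v"
    and cl: "\<And>cl v b. cl \<in> set cls \<Longrightarrow> (v, b) \<in> set cl \<Longrightarrow> v < 2 * h"
      "\<And>cl. cl \<in> set cls \<Longrightarrow> length cl \<le> D"
    and V: "positions cls (length cls) \<le> V" "4 * h + 2 \<le> V" "2 ^ h \<le> V" "M * length cls + M + length cls \<le> V"
  shows "wp V tabulate (\<lambda>k' s' \<omega>'. \<omega>' = \<omega> \<and> k' \<le> k + 4 + length cls * (9 + M * (14 + 21 * D)) \<and>
    (\<forall>i<length cls. \<forall>a<M.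
      arrays s' 3 (i * M + a) = of_bool (\<forall>l\<in>set (cls ! i). falsifiesL h a l) \<and>
      arrays s' 4 (a * length cls + i) = of_bool (\<forall>l\<in>set (cls ! i). falsifiesR h a l))) k s \<omega>"
  unfolding tabulate_def
proof (rule wp_Seq, rule wp_Move, use V in simp)
  let ?m = "length cls"
  let ?I = "\<lambda>j k' s' \<omega>'. \<omega>' = \<omega> \<and> k' \<le> k + 3 + j * (9 + M * (14 + 21 * D)) \<and> regs s' 9 = positions cls j \<and>
    (\<forall>i<j. \<forall>a<M.
      arrays s' 3 (i * M + a) = of_bool (\<forall>l\<in>set (cls ! i). falsifiesL h a l) \<and>
      arrays s' 4 (a * length cls + i) = of_bool (\<forall>l\<in>set (cls ! i). falsifiesR h a l))"
  let ?s = "set_reg 9 (opval s (Imm 2)) s"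
  have wrc: "written_regs clause_body = {2, 9, 10, 11, 12, 13, 14, 15, 16, 17, 18}" "written_arrays clause_body = {3, 4}"
    by (auto simp: clause_body_def assignment_body_def literal_body_def mark_def)
  show "wp V (For 7 (Reg 4) clause_body) (\<lambda>k' s' \<omega>'. \<omega>' = \<omega> \<and> k' \<le> k + 4 + length cls * (9 + M * (14 + 21 * D)) \<and>
    (\<forall>i<length cls. \<forall>a<M.
      arrays s' 3 (i * M + a) = of_bool (\<forall>l\<in>set (cls ! i). falsifiesL h a l) \<and>
      arrays s' 4 (a * length cls + i) = of_bool (\<forall>l\<in>set (cls ! i). falsifiesR h a l))) (k + 1) ?s \<omega>"
  proof (rule wp_For[where n = "length cls" and I = ?I])
    fix j k' s' \<omega>'
    assume j: "j < ?m" and fr: "same_except (insert 7 (insert 2 (written_regs clause_body))) (written_arrays clause_body) ?s s'"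
      and rj: "regs s' 7 = j" and I: "?I j k' s' \<omega>'"
    have s': "regs s' 5 = h" "regs s' 6 = M" "regs s' 4 = ?m" "arrays s' 0 = arrays s 0" "arrays s' 2 = arrays s 2"
      using fr r(1-3) unfolding wrc by (simp_all add: same_except_def)
    have r9: "regs s' 9 = positions cls j" using I by blast
    have cj: "cls ! j \<in> set cls" using j by simp
    have p: "Suc (positions cls j) + length (cls ! j) \<le> V"
      using positions_le[of "Suc j" cls] j V(1) by (simp add: positions_simps)
    have D: "M * (14 + 21 * length (cls ! j)) \<le> M * (14 + 21 * D)"
      using cl(2)[OF cj] by (intro mult_le_mono2) simp
    show "wp V clause_body (\<lambda>k. ?I (Suc j) (k + 3)) k' s' \<omega>'"
    proof (rule wp_conseq[OF wp_clause[where cl = "cls ! j"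
          and TL = "\<lambda>i a. of_bool (\<forall>l\<in>set (cls ! i). falsifiesL h a l)"
          and TR = "\<lambda>i a. of_bool (\<forall>l\<in>set (cls ! i). falsifiesR h a l)", OF r9 s'(1) rj s'(2,3)]], goal_cases)
      case (1)
      then show ?case using r(4)[OF j] s' by simp
    next
      case (2 j')
      then show ?case using r(5)[OF j] s' by simp
    next
      case (3 v)
      then show ?case using r(6) s' by simp
    next
      case (4 v b)
      then show ?case using cl(1)[OF cj] by blast
    next
      case (14 k'' s'' \<omega>'')
      have "k'' + 3 \<le> k + 3 + Suc j * (9 + M * (14 + 21 * D))"
        using 14(2) I D unfolding mult_Suc by linarith
      then show ?case using 14(2) I by (simp add: positions_simps less_Suc_eq_le)
    qed (use I j p V in simp_all)
  qed (use r V in \<open>auto simp: wrc positions_simps\<close>)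
qed

text \<open>Every emitted vertex number is one larger than the vertex. Input \<open>Suc a\<close>,
  for the lower half assignment \<open>a\<close>, appears as \<open>a + 2\<close>; clause gate
  \<open>i\<close> is vertex \<open>M + 2 + i\<close> and appears as \<open>i + (M + 3)\<close>;
  output gate \<open>a\<close> appears as \<open>a + (M + 3 + m)\<close>.\<close>

definition build :: com where
  "build =
     Op Add 19 (Reg 6) (Imm 1) ;; push (Reg 19) ;;
     Op Add 8 (Reg 19) (Reg 4) ;; push (Reg 8) ;;
     push (Reg 19) ;; emit_range (Reg 19) (Imm 1) ;;
     emit (Reg 4) (Reg 6) 3 (Imm 2) ;;
     Op Add 20 (Reg 6) (Imm 3) ;;
     emit (Reg 6) (Reg 4) 4 (Reg 20) ;;
     push (Reg 19) ;; Op Add 8 (Reg 6) (Imm 2) ;; push (Reg 8) ;;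
     Op Add 20 (Reg 20) (Reg 4) ;; emit_range (Reg 6) (Reg 20)"

text \<open>
  Input \<open>0\<close> is a dummy wired into every gate, so that no gate has fan-in zero; its column is all ones.
  Gate \<open>0\<close> reads all inputs: it provides the all-ones row with which the other rows are compared, and
  enough wires for \<open>inputs C \<le> wires C\<close>.
\<close>

definition or_circuit :: "nat \<Rightarrow> nat \<Rightarrow> (nat \<Rightarrow> nat \<Rightarrow> bool) \<Rightarrow> (nat \<Rightarrow> nat \<Rightarrow> bool) \<Rightarrow> circuit" where
  "or_circuit M m A B = Circuit (Suc M)
     ([0..<Suc M] #
      map (\<lambda>i. 0 # map Suc (filter (A i) [0..<M])) [0..<m] @
      map (\<lambda>a. 0 # map (\<lambda>i. i + (M + 2)) (filter (B a) [0..<m])) [0..<M])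
     (Suc M # map (\<lambda>a. a + (M + m + 2)) [0..<M])"

text \<open>Regroups the encoding into the pieces in the order in which \<open>build\<close> writes
  them.\<close>

lemma encode_or_circuit:
  "encode_circuit (or_circuit M m A B) =
     [M + 1, M + 1 + m, M + 1] @ map (\<lambda>i. i + 1) [0..<M + 1] @
     concat (map (\<lambda>i. let r = 1 # map (\<lambda>a. a + 2) (filter (A i) [0..<M]) in length r # r) [0..<m]) @
     concat (map (\<lambda>a. let r = 1 # map (\<lambda>i. i + (M + 3)) (filter (B a) [0..<m]) in length r # r) [0..<M]) @
     [M + 1, M + 2] @ map (\<lambda>a. a + (M + 3 + m)) [0..<M]"
  by (simp add: encode_circuit_def or_circuit_def Let_def comp_def eval_nat_numeral del: upt_Suc)

lemma length_concat_rows: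
  "length (concat (map (\<lambda>i. let r = 1 # map (f i) (filter (U i) [0..<c]) in length r # r) [0..<n])) \<le> n * (c + 2)"
proof (induction n)
  case (Suc n)
  have "length (filter (U n) [0..<c]) \<le> c"
    using length_filter_le[of "U n" "[0..<c]"] by simp
  with Suc show ?case by (simp add: Let_def)
qed simp

lemma wp_build:
  assumes r: "regs s 6 = M" "regs s 4 = m" "holds [] s"
    "\<And>i a. i < m \<Longrightarrow> a < M \<Longrightarrow> arrays s 3 (i * M + a) = of_bool (A i a)"
    "\<And>a i. i < m \<Longrightarrow> a < M \<Longrightarrow> arrays s 4 (a * m + i) = of_bool (B a i)"
    and V: "2 * M * m + 10 * (M + m) + 20 \<le> V"
  shows "wp V build (\<lambda>k' s' \<omega>'. \<omega>' = \<omega> \<and> k' \<le> k + 100 * (M + 1) * (m + 1) \<and>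
    regs s' 19 = M + 1 \<and> holds (encode_circuit (or_circuit M m A B)) s') k s \<omega>"
proof -
  define C3 where "C3 = concat (map (\<lambda>i. let r = 1 # map (\<lambda>a. a + 2) (filter (A i) [0..<M]) in length r # r) [0..<m])"
  define C4 where "C4 = concat (map (\<lambda>a. let r = 1 # map (\<lambda>i. i + (M + 3)) (filter (B a) [0..<m]) in length r # r) [0..<M])"
  define L2 where "L2 = [M + 1, M + 1 + m, M + 1] @ map (\<lambda>i. i + 1) [0..<M + 1]"
  define L3 where "L3 = L2 @ C3"
  define L4 where "L4 = L3 @ C4"
  define L5 where "L5 = L4 @ [M + 1, M + 2]"
  define x y where "x = m * (15 + 9 * M)" and "y = M * (15 + 9 * m)"
  let ?Q = "\<lambda>k' s' \<omega>'. \<omega>' = \<omega> \<and> k' \<le> k + 100 * (M + 1) * (m + 1) \<and>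
    regs s' 19 = M + 1 \<and> holds (encode_circuit (or_circuit M m A B)) s'"
  \<comment> \<open>Everything that the later stages read, apart from register 20 and the list
    written so far.\<close>
  define J where "J s' \<longleftrightarrow> regs s' 6 = M \<and> regs s' 4 = m \<and> regs s' 19 = M + 1 \<and>
    arrays s' 3 = arrays s 3 \<and> arrays s' 4 = arrays s 4" for s' :: state
  have JD: "regs s' 6 = M" "regs s' 4 = m" "regs s' 19 = M + 1" "arrays s' 3 = arrays s 3" "arrays s' 4 = arrays s 4"
    if "J s'" for s' using that by (auto simp: J_def)
  have J_set: "J (set_reg r v s') = J s'" if "r \<notin> {4, 6, 19}" for r v s'
    using that by (auto simp: J_def)
  have J_same: "J s2" if "same_except R S s1 s2" "R \<inter> {4, 6, 19} = {}" "S \<inter> {3, 4} = {}" "J s1" for R S s1 s2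
    using that by (auto simp: J_def same_except_def)
  have l3: "length C3 \<le> m * (M + 2)" and l4: "length C4 \<le> M * (m + 2)"
    unfolding C3_def C4_def by (rule length_concat_rows)+
  have V': "M * m + 10 * M + 10 * m + 20 \<le> V" "length L2 = M + 4"
    "length L3 + 2 * M + 7 \<le> V" "length L4 + 2 * M + m + 7 \<le> V" "length L4 + 2 = length L5"
    "length L2 + m * (M + 2) + 2 + M + m + 3 \<le> V" "length L3 + M * (m + 2) + (M + 3) + m + M + 3 \<le> V"
    using V l3 l4 by (simp_all add: L2_def L3_def L4_def L5_def algebra_simps)
  have wre: "written_regs (emit_range p q) = {7, 2, 12, 100}" "written_arrays (emit_range p q) = {20}"
    "written_regs (emit p q r t) = {7, 2, 8, 100, 9, 11, 12}" "written_arrays (emit p q r t) = {20}" for p q r t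
    by (auto simp: emit_range_def emit_def emit_body_def push_def)
  \<comment> \<open>The suffixes of \<open>build\<close> are verified from the last one backwards,
    each under a clock bound that the preceding stage can guarantee; \<open>x\<close> and
    \<open>y\<close> abbreviate the costs of the two layers of gates.\<close>
  have 9: "wp V (emit_range (Reg 6) (Reg 20)) ?Q k' s' \<omega>"
    if "k' \<le> k + 30 + 6 * M + x + y" "J s'" "regs s' 20 = M + 3 + m" "holds L5 s'" for k' s'
  proof (rule wp_conseq[OF wp_emit_range[OF that(4), where n = M and d = "M + 3 + m"]], goal_cases)
    case (6 k2 s2 \<omega>2)
    have "k' + 3 + 6 * M \<le> k + 100 * (M + 1) * (m + 1)"
      using that(1) by (simp add: x_def y_def algebra_simps)
    moreover have "encode_circuit (or_circuit M m A B) = L5 @ map (\<lambda>i. i + (M + 3 + m)) [0..<M]"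
      unfolding encode_or_circuit by (simp add: L5_def L4_def L3_def L2_def C3_def C4_def)
    moreover have "regs s2 19 = M + 1" using 6(1) JD[OF that(2)] by (simp add: wre same_except_def)
    ultimately show ?case using 6(2) by simp
  qed (use JD[OF that(2)] that(3) V' in auto)
  have 8: "wp V (push (Reg 19) ;; Op Add 8 (Reg 6) (Imm 2) ;; push (Reg 8) ;;
     Op Add 20 (Reg 20) (Reg 4) ;; emit_range (Reg 6) (Reg 20)) ?Q k' s' \<omega>"
    if k': "k' \<le> k + 24 + 6 * M + x + y" and s': "J s'" "regs s' 20 = M + 3" "holds L4 s'" for k' s'
  proof (rule wp_Seq, rule wp_push[OF s'(3)], goal_cases)
    case (4 s2)
    have J2: "J s2" by (rule J_same[OF 4(2) _ _ s'(1)]) auto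
    have r2: "regs s2 20 = M + 3" using 4(2) s'(2) by (simp add: same_except_def)
    have h2: "holds (L4 @ [M + 1]) (set_reg 8 (M + 2) s2)" using 4(1) JD[OF s'(1)] by simp
    show ?case
    proof (rule wp_Seq, rule wp_Op, goal_cases)
      case 3
      have e: "set_reg 8 (apply_binop Add (opval s2 (Reg 6)) (opval s2 (Imm 2))) s2 = set_reg 8 (M + 2) s2"
        using JD[OF J2] by simp
      show ?case
        unfolding e
      proof (rule wp_Seq, rule wp_push[OF h2], goal_cases)
        case (4 s3)
        have J3: "J s3" by (rule J_same[OF 4(2)]) (use J2 J_set in auto)
        have r3: "regs s3 20 = M + 3" using 4(2) r2 by (simp add: same_except_def)
        have h3: "holds L5 s3" using 4(1) by (simp add: L5_def)
        show ?case
          by (rule wp_Seq, rule wp_Op, use JD[OF J3] r3 V' in simp, use JD[OF J3] r3 V' in simp, rule 9)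
            (use JD[OF J3] r3 J_set h3 J3 k' in auto)
      qed (use V' in auto)
    qed (use JD[OF J2] V' in auto)
  qed (use V' JD[OF s'(1)] in auto)
  have 7: "wp V (Op Add 20 (Reg 6) (Imm 3) ;; emit (Reg 6) (Reg 4) 4 (Reg 20) ;;
     push (Reg 19) ;; Op Add 8 (Reg 6) (Imm 2) ;; push (Reg 8) ;;
     Op Add 20 (Reg 20) (Reg 4) ;; emit_range (Reg 6) (Reg 20)) ?Q k' s' \<omega>"
    if k': "k' \<le> k + 20 + 6 * M + x" and s': "J s'" "holds L3 s'" for k' s'
  proof (rule wp_Seq, rule wp_Op, goal_cases)
    case 3
    have e: "set_reg 20 (apply_binop Add (opval s' (Reg 6)) (opval s' (Imm 3))) s' = set_reg 20 (M + 3) s'"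
      using JD[OF s'(1)] by simp
    show ?case
      unfolding e
    proof (rule wp_seq_conseq[OF wp_emit[where xs = L3 and n = M and c = m and d = "M + 3" and U = B]], goal_cases)
      case (5 i j)
      then show ?case using r(5) JD[OF s'(1)] by simp
    next
      case (8)
      then show ?case using V' by simp
    next
      case (9 k2 s2 \<omega>2)
      have J2: "J s2" by (rule J_same[OF 9(1)]) (use s' J_set in \<open>auto simp: wre\<close>)
      have r2: "regs s2 20 = M + 3" using 9(1) by (simp add: same_except_def wre)
      have h: "holds L4 s2" using 9(2) by (simp add: L4_def C4_def Let_def)
      have w: "\<omega>2 = \<omega>" and "k2 \<le> k + 24 + 6 * M + x + y"
        using 9(2) k' by (simp_all add: y_def)
      then show ?case using 8 J2 r2 h by blast
    qed (use JD[OF s'(1)] s'(2) in auto)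
  qed (use JD[OF s'(1)] V' in auto)
  have stage6: "wp V (emit (Reg 4) (Reg 6) 3 (Imm 2) ;; Op Add 20 (Reg 6) (Imm 3) ;; emit (Reg 6) (Reg 4) 4 (Reg 20) ;;
     push (Reg 19) ;; Op Add 8 (Reg 6) (Imm 2) ;; push (Reg 8) ;;
     Op Add 20 (Reg 20) (Reg 4) ;; emit_range (Reg 6) (Reg 20)) ?Q k' s' \<omega>"
    if k': "k' \<le> k + 17 + 6 * M" and s': "J s'" "holds L2 s'" for k' s'
  proof (rule wp_seq_conseq[OF wp_emit[where xs = L2 and n = m and c = M and d = 2 and U = A]], goal_cases)
    case (5 i j)
    then show ?case using r(4) JD[OF s'(1)] by simp
  next
    case (8)
    then show ?case using V' by simp
  next
    case (9 k2 s2 \<omega>2)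
    have J2: "J s2" by (rule J_same[OF 9(1)]) (use s' J_set in \<open>auto simp: wre\<close>)
    have h: "holds L3 s2" using 9(2) by (simp add: L3_def C3_def Let_def)
    have w: "\<omega>2 = \<omega>" and "k2 \<le> k + 20 + 6 * M + x"
      using 9(2) k' by (simp_all add: x_def)
    then show ?case using 7 J2 h by blast
  qed (use JD[OF s'(1)] s'(2) in auto)
  have 5: "wp V (emit_range (Reg 19) (Imm 1) ;;
     emit (Reg 4) (Reg 6) 3 (Imm 2) ;; Op Add 20 (Reg 6) (Imm 3) ;; emit (Reg 6) (Reg 4) 4 (Reg 20) ;;
     push (Reg 19) ;; Op Add 8 (Reg 6) (Imm 2) ;; push (Reg 8) ;;
     Op Add 20 (Reg 20) (Reg 4) ;; emit_range (Reg 6) (Reg 20)) ?Q k' s' \<omega>"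
    if k': "k' \<le> k + 8" and s': "J s'" "holds [M + 1, M + 1 + m, M + 1] s'" for k' s'
  proof (rule wp_seq_conseq[OF wp_emit_range[OF s'(2), where n = "M + 1" and d = 1]], goal_cases)
    case (6 k2 s2 \<omega>2)
    have J2: "J s2" by (rule J_same[OF 6(1)]) (use s' J_set in \<open>auto simp: wre\<close>)
    have h: "holds L2 s2" using 6(2) by (simp add: L2_def)
    have w: "\<omega>2 = \<omega>" and "k2 \<le> k + 17 + 6 * M"
      using 6(2) k' by simp_all
    then show ?case using stage6 J2 h by blast
  qed (use JD[OF s'(1)] V' in auto)
  show ?thesis
    unfolding build_def
  proof (rule wp_Seq, rule wp_Op, goal_cases)
    case 3
    have e: "set_reg 19 (apply_binop Add (opval s (Reg 6)) (opval s (Imm 1))) s = set_reg 19 (M + 1) s"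
      using r by simp
    have h: "holds [] (set_reg 19 (M + 1) s)" and J1: "J (set_reg 19 (M + 1) s)"
      using r by (auto simp: J_def)
    show ?case
      unfolding e
    proof (rule wp_Seq, rule wp_push[OF h], goal_cases)
      case (4 s2)
      have J2: "J s2" by (rule J_same[OF 4(2) _ _ J1]) auto
      have e: "set_reg 8 (apply_binop Add (opval s2 (Reg 19)) (opval s2 (Reg 4))) s2 = set_reg 8 (M + 1 + m) s2"
        using JD[OF J2] by simp
      have h2: "holds [M + 1] (set_reg 8 (M + 1 + m) s2)" using 4(1) by simp
      show ?case
      proof (rule wp_Seq, rule wp_Op, goal_cases)
        case 3
        show ?case
          unfolding e
        proof (rule wp_Seq, rule wp_push[OF h2], goal_cases)
          case (4 s3)
          have J3: "J s3" by (rule J_same[OF 4(2)]) (use J2 J_set in auto)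
          show ?case
          proof (rule wp_Seq, rule wp_push[OF 4(1)], goal_cases)
            case (4 s4)
            have J4: "J s4" by (rule J_same[OF 4(2)]) (use J3 in auto)
            have h4: "holds [M + 1, M + 1 + m, M + 1] s4" using 4(1) JD[OF J3] by simp
            show ?case by (rule 5[OF _ J4 h4]) simp
          qed (use V' JD[OF J3] in auto)
        qed (use V' in auto)
      qed (use V' JD[OF J2] in auto)
    qed (use V' in auto)
  qed (use r V' in auto)
qed

section \<open>Evaluating a circuit on a random input\<close>

lemma length_blocks:
  assumes "k \<le> length xss"
  shows "length (concat (map (\<lambda>xs. length xs # map f xs) (take k xss))) + 2 = positions xss k"
  using assms by (induction k) (auto simp: positions_simps take_Suc_conv_app_nth)

text \<open>Random access into a sequence of length-prefixed blocks; \<open>f\<close> is the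
  encoding of the entries, namely \<open>Suc\<close> for wires and the numbering of literals for
  clauses.\<close>

lemma nth_blocks:
  assumes "k < length xss"
  shows "(a # b # concat (map (\<lambda>xs. length xs # map f xs) xss) @ ys) ! positions xss k = length (xss ! k)"
    and "j < length (xss ! k) \<Longrightarrow>
      (a # b # concat (map (\<lambda>xs. length xs # map f xs) xss) @ ys) ! (Suc (positions xss k) + j) = f (xss ! k ! j)"
proof -
  let ?f = "\<lambda>xs. length xs # map f xs"
  have xss: "xss = take k xss @ xss ! k # drop (Suc k) xss"
    using assms by (simp add: id_take_nth_drop)
  have split: "a # b # concat (map ?f xss) @ ys =
      (a # b # concat (map ?f (take k xss))) @ length (xss ! k) # map f (xss ! k) @ concat (map ?f (drop (Suc k) xss)) @ ys"
    by (subst (1) xss) simp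
  have len: "length (a # b # concat (map ?f (take k xss))) = positions xss k"
    using length_blocks[OF less_imp_le[OF assms], of f] by simp
  show "(a # b # concat (map ?f xss) @ ys) ! positions xss k = length (xss ! k)"
    unfolding split len[symmetric] by (rule nth_append_length)
  show "(a # b # concat (map ?f xss) @ ys) ! (Suc (positions xss k) + j) = f (xss ! k ! j)"
    if "j < length (xss ! k)"
    unfolding split add_Suc_shift len[symmetric] nth_append_length_plus using that by (simp add: nth_append)
qed

text \<open>The machine adds the incoming values of a gate as natural numbers and takes the parity
  once at the end; this matches that with the sum over GF(2).\<close>

lemma odd_sum_list_bit:
  "odd (\<Sum>v\<leftarrow>ps. of_bool (g v = 1) :: nat) \<longleftrightarrow> (\<Sum>v\<leftarrow>ps. g v) = (1 :: bit)"
  by (induction ps) auto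

definition wire_body :: com where
  "wire_body = Load 15 21 (Reg 9) ;; Op Sub 15 (Reg 15) (Imm 1) ;; Load 15 5 (Reg 15) ;;
     Op Add 13 (Reg 13) (Reg 15) ;; Op Add 9 (Reg 9) (Imm 1)"

definition gate_body :: com where
  "gate_body = Load 12 21 (Reg 9) ;; Op Add 9 (Reg 9) (Imm 1) ;; Move 13 (Imm 0) ;;
     For 14 (Reg 12) wire_body ;;
     Op Div 15 (Reg 13) (Imm 2) ;; Op Add 15 (Reg 15) (Reg 15) ;; Op Sub 13 (Reg 13) (Reg 15) ;;
     Store 5 (Reg 11) (Reg 13) ;; Op Add 11 (Reg 11) (Imm 1)"

text \<open>The sum of the two truncated differences is the absolute difference. The flag in
  register 21 is only ever raised, so it accumulates over outputs and over trials.\<close>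

definition compare_body :: com where
  "compare_body = Op Add 15 (Reg 9) (Reg 7) ;; Load 15 21 (Reg 15) ;; Op Sub 15 (Reg 15) (Imm 1) ;;
     Load 15 5 (Reg 15) ;; Op Sub 16 (Reg 15) (Reg 13) ;; Op Sub 15 (Reg 13) (Reg 15) ;;
     Op Add 15 (Reg 15) (Reg 16) ;; Cond (Reg 15) (Move 21 (Imm 1)) Skip"

definition compare :: com where
  "compare = Load 12 21 (Reg 9) ;; Op Add 9 (Reg 9) (Imm 1) ;; Load 13 21 (Reg 9) ;;
     Op Sub 13 (Reg 13) (Imm 1) ;; Load 13 5 (Reg 13) ;; For 7 (Reg 12) compare_body"

definition flip_body :: com where
  "flip_body = Flip 8 ;; Store 5 (Reg 7) (Reg 8)"

definition trial :: com where
  "trial = For 7 (Reg 19) flip_body ;; Load 10 21 (Imm 1) ;; Move 9 (Imm 2) ;; Move 11 (Reg 19) ;;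
     For 7 (Reg 10) gate_body ;; compare"

lemma written_regs_wire_body: "written_regs wire_body = {9, 13, 15}" "written_arrays wire_body = {}"
  and written_regs_gate_body: "written_regs gate_body = {2, 9, 11, 12, 13, 14, 15}" "written_arrays gate_body = {5}"
  and written_regs_compare_body: "written_regs compare_body = {15, 16, 21}" "written_arrays compare_body = {}"
  and written_regs_flip_body: "written_regs flip_body = {8}" "written_arrays flip_body = {5}"
  by (auto simp: wire_body_def gate_body_def compare_body_def flip_body_def)

lemma wp_wires:
  assumes r: "regs s 9 = p" "regs s 12 = length ps" "regs s 13 = 0"
    "\<And>j. j < length ps \<Longrightarrow> arrays s 21 (p + j) = Suc (ps ! j)"
    "\<And>v. v \<in> set ps \<Longrightarrow> arrays s 5 v = of_bool (b v)"
    and V: "p + length ps + 1 \<le> V" "\<And>v. v \<in> set ps \<Longrightarrow> Suc v \<le> V"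
  shows "wp V (For 14 (Reg 12) wire_body) (\<lambda>k' s' \<omega>'. \<omega>' = \<omega> \<and> k' \<le> k + 3 + 8 * length ps \<and>
    regs s' 9 = p + length ps \<and> regs s' 13 = (\<Sum>v\<leftarrow>ps. of_bool (b v))) k s \<omega>"
proof (rule wp_For[where n = "length ps" and I = "\<lambda>j k' s' \<omega>'. \<omega>' = \<omega> \<and> k' \<le> k + 2 + 8 * j \<and>
    regs s' 9 = p + j \<and> regs s' 13 = (\<Sum>v\<leftarrow>take j ps. of_bool (b v))"])
  fix j k' s' \<omega>'
  assume j: "j < length ps" and fr: "same_except (insert 14 (insert 2 (written_regs wire_body))) (written_arrays wire_body) s s'"
    and I: "\<omega>' = \<omega> \<and> k' \<le> k + 2 + 8 * j \<and>
      regs s' 9 = p + j \<and> regs s' 13 = (\<Sum>v\<leftarrow>take j ps. of_bool (b v))"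
  define a where "a = (\<Sum>v\<leftarrow>take j ps. of_bool (b v) :: nat)"
  define u where "u = (of_bool (b (ps ! j)) :: nat)"
  \<comment> \<open>The running sum of bits is at most the number of wires read, so it stays below
    \<open>V\<close>.\<close>
  have "(\<Sum>v\<leftarrow>qs. of_bool (b v) :: nat) \<le> length qs" for qs :: "nat list"
    by (induction qs) auto
  from this[of "take j ps"] have a: "a \<le> j" using j by (simp add: a_def)
  have s': "arrays s' 21 (p + j) = Suc (ps ! j)" "arrays s' 5 (ps ! j) = u" "regs s' 9 = p + j" "regs s' 13 = a"
    using fr r(4)[OF j] r(5)[of "ps ! j"] j I by (simp_all add: same_except_def written_regs_wire_body a_def u_def)
  have V': "u \<le> 1" "p + j + 1 \<le> V" "Suc (ps ! j) \<le> V" "j \<le> V"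
    using V j by (auto simp: u_def)
  have e: "take (Suc j) ps = take j ps @ [ps ! j]" using j by (simp add: take_Suc_conv_app_nth)
  show "wp V wire_body (\<lambda>k' s' \<omega>'. \<omega>' = \<omega> \<and> k' + 3 \<le> k + 2 + 8 * Suc j \<and>
    regs s' 9 = p + Suc j \<and> regs s' 13 = (\<Sum>v\<leftarrow>take (Suc j) ps. of_bool (b v))) k' s' \<omega>'"
    unfolding wire_body_def e map_append sum_list_append a_def[symmetric] list.map sum_list.Cons u_def[symmetric]
    apply (rule wp_Seq | (rule wp_basic; (use s' V' a in simp)?))+
    using I s' by simp
qed (use r V in \<open>auto simp: written_regs_wire_body\<close>)

lemma wp_gate:
  assumes r: "regs s 9 = p" "regs s 11 = w" "arrays s 21 p = length ps"
    "\<And>j. j < length ps \<Longrightarrow> arrays s 21 (Suc p + j) = Suc (ps ! j)"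
    "\<And>v. v \<in> set ps \<Longrightarrow> arrays s 5 v = of_bool (b v)"
    and V: "p + length ps + 2 \<le> V" "\<And>v. v \<in> set ps \<Longrightarrow> Suc v \<le> V" "w < V"
  shows "wp V gate_body (\<lambda>k' s' \<omega>'. \<omega>' = \<omega> \<and> k' \<le> k + 11 + 8 * length ps \<and>
    regs s' 9 = Suc p + length ps \<and> regs s' 11 = Suc w \<and>
    arrays s' 5 = (arrays s 5)(w := of_bool (odd (\<Sum>v\<leftarrow>ps. of_bool (b v) :: nat)))) k s \<omega>"
proof -
  let ?Q = "\<lambda>k' s' \<omega>'. \<omega>' = \<omega> \<and> k' \<le> k + 11 + 8 * length ps \<and>
    regs s' 9 = Suc p + length ps \<and> regs s' 11 = Suc w \<and>
    arrays s' 5 = (arrays s 5)(w := of_bool (odd (\<Sum>v\<leftarrow>ps. of_bool (b v) :: nat)))"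
  define a where "a = (\<Sum>v\<leftarrow>ps. of_bool (b v) :: nat)"
  have "a \<le> length ps" unfolding a_def by (induction ps) auto
  then have V': "p \<le> V" "length ps \<le> V" "1 \<le> V" "a \<le> V" "2 \<le> V" "a div 2 + a div 2 \<le> V" "w \<le> V"
    using V by auto
  let ?s1 = "set_reg 13 0 (set_reg 9 (Suc p) (set_reg 12 (length ps) s))"
  have main: "wp V (For 14 (Reg 12) wire_body ;;
     Op Div 15 (Reg 13) (Imm 2) ;; Op Add 15 (Reg 15) (Reg 15) ;; Op Sub 13 (Reg 13) (Reg 15) ;;
     Store 5 (Reg 11) (Reg 13) ;; Op Add 11 (Reg 11) (Imm 1)) ?Q (Suc (Suc (Suc k))) ?s1 \<omega>"
  proof (rule wp_seq_conseq[OF wp_wires[where p = "Suc p" and ps = ps and b = b]])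
    fix k' s' \<omega>'
    assume fr: "same_except (written_regs (For 14 (Reg 12) wire_body)) (written_arrays (For 14 (Reg 12) wire_body)) ?s1 s'"
      and I: "\<omega>' = \<omega> \<and> k' \<le> Suc (Suc (Suc k)) + 3 + 8 * length ps \<and>
        regs s' 9 = Suc p + length ps \<and> regs s' 13 = (\<Sum>v\<leftarrow>ps. of_bool (b v))"
    have s': "regs s' 11 = w" "arrays s' 5 = arrays s 5" "regs s' 13 = a"
      using fr I r by (simp_all add: same_except_def written_regs_wire_body a_def)
    show "wp V (Op Div 15 (Reg 13) (Imm 2) ;; Op Add 15 (Reg 15) (Reg 15) ;; Op Sub 13 (Reg 13) (Reg 15) ;;
     Store 5 (Reg 11) (Reg 13) ;; Op Add 11 (Reg 11) (Imm 1)) ?Q k' s' \<omega>'"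
      unfolding a_def[symmetric]
      apply (rule wp_Seq | (rule wp_basic; (use s' V' in \<open>simp add: minus_double_half split del: split_of_bool\<close>)?))+
      using I s' by (auto simp: minus_double_half)
  qed (use r V in auto)
  have "wp V gate_body Q k s \<omega>" if "wp V (For 14 (Reg 12) wire_body ;;
     Op Div 15 (Reg 13) (Imm 2) ;; Op Add 15 (Reg 15) (Reg 15) ;; Op Sub 13 (Reg 13) (Reg 15) ;;
     Store 5 (Reg 11) (Reg 13) ;; Op Add 11 (Reg 11) (Imm 1)) Q (Suc (Suc (Suc k))) ?s1 \<omega>" for Q
    unfolding gate_body_def
    apply (rule wp_Seq, ((rule wp_Load wp_Op wp_Move); (use r V' in simp)?))+
    using that r by simp
  from this[OF main] show ?thesis .
qed

text \<open>Time is charged to the encoding: a gate with \<open>l\<close> wires costs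
  \<open>14 + 8 * l\<close> ticks including loop overhead, at most 14 for each of its
  \<open>l + 1\<close> cells.\<close>

lemma wp_gates:
  fixes x :: "nat \<Rightarrow> bit"
  assumes C: "wf_circuit C" and r: "regs s 9 = 2" "regs s 10 = length (gates C)" "regs s 11 = inputs C"
    "\<And>i. i < length (encode_circuit C) \<Longrightarrow> arrays s 21 i = encode_circuit C ! i"
    "\<And>v. v < inputs C \<Longrightarrow> arrays s 5 v = of_bool (x v = 1)"
    and V: "length (encode_circuit C) + inputs C + 3 \<le> V"
  shows "wp V (For 7 (Reg 10) gate_body) (\<lambda>k' s' \<omega>'. \<omega>' = \<omega> \<and>
    k' \<le> k + 3 + 14 * positions (gates C) (length (gates C)) \<and>
    regs s' 9 = positions (gates C) (length (gates C)) \<and>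
    (\<forall>v<inputs C + length (gates C). arrays s' 5 v = of_bool (vertex_values sum_list x C ! v = 1))) k s \<omega>"
proof -
  let ?g = "gates C" and ?vs = "vertex_values sum_list x C"
  have enc: "encode_circuit C = inputs C # length ?g # concat (map (\<lambda>ps. length ps # map Suc ps) ?g) @
      length (outputs C) # map Suc (outputs C)"
    by (simp add: encode_circuit_def)
  have lenc: "length (encode_circuit C) = positions ?g (length ?g) + Suc (length (outputs C))"
    using length_blocks[of "length ?g" ?g Suc] by (simp add: enc)
  have lg: "length ?g \<le> positions ?g (length ?g)"
    unfolding positions_def using sum_bounded_below[of "{..<length ?g}" 1 "\<lambda>i. Suc (length (?g ! i))"] by simp
  show ?thesis
  proof (rule wp_For[where n = "length ?g" and I = "\<lambda>j k' s' \<omega>'. \<omega>' = \<omega> \<and> k' \<le> k + 2 + 14 * positions ?g j \<and>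
      regs s' 9 = positions ?g j \<and> regs s' 11 = inputs C + j \<and>
      (\<forall>v<inputs C + j. arrays s' 5 v = of_bool (?vs ! v = 1))"])
    fix j k' s' \<omega>'
    assume j: "j < length ?g" and fr: "same_except (insert 7 (insert 2 (written_regs gate_body))) (written_arrays gate_body) s s'"
      and I: "\<omega>' = \<omega> \<and> k' \<le> k + 2 + 14 * positions ?g j \<and>
        regs s' 9 = positions ?g j \<and> regs s' 11 = inputs C + j \<and>
        (\<forall>v<inputs C + j. arrays s' 5 v = of_bool (?vs ! v = 1))"
    have a21: "arrays s' 21 = arrays s 21" using fr by (simp add: same_except_def written_regs_gate_body)
    have sub: "set (?g ! j) \<subseteq> {..<inputs C + j}" using C j by (simp add: wf_circuit_def)
    have p: "Suc (positions ?g j) + length (?g ! j) \<le> positions ?g (length ?g)"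
      using positions_le[of "Suc j" ?g] j by (simp add: positions_simps)
    note nb = nth_blocks[OF j, where a = "inputs C" and b = "length ?g" and f = Suc and
        ys = "length (outputs C) # map Suc (outputs C)", folded enc]
    have val: "?vs ! (inputs C + j) = (\<Sum>v\<leftarrow>?g ! j. ?vs ! v)"
      by (rule vertex_values_gate[OF C j])
    show "wp V gate_body (\<lambda>k' s' \<omega>'. \<omega>' = \<omega> \<and> k' + 3 \<le> k + 2 + 14 * positions ?g (Suc j) \<and>
      regs s' 9 = positions ?g (Suc j) \<and> regs s' 11 = inputs C + Suc j \<and>
      (\<forall>v<inputs C + Suc j. arrays s' 5 v = of_bool (?vs ! v = 1))) k' s' \<omega>'"
    proof (rule wp_conseq[OF wp_gate[where p = "positions ?g j" and w = "inputs C + j" and ps = "?g ! j"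
          and b = "\<lambda>v. ?vs ! v = 1"]], goal_cases)
      case 3
      show ?case using r(4)[of "positions ?g j"] p lenc a21 nb(1) by simp
    next
      case (4 i)
      then show ?case using r(4)[of "Suc (positions ?g j) + i"] p lenc a21 nb(2) by simp
    next
      case (5 v)
      then show ?case using I sub by auto
    next
      case (7 v)
      then have "v < inputs C + j" using sub by auto
      then show ?case using V j lenc lg by linarith
    next
      case (9 k'' s'' \<omega>'')
      have "k'' + 3 \<le> k + 2 + 14 * positions ?g (Suc j)"
        using 9(2) I by (simp add: positions_simps)
      moreover have "\<forall>v<inputs C + Suc j. arrays s'' 5 v = of_bool (?vs ! v = 1)"
        using 9(2) I by (auto simp: less_Suc_eq val odd_sum_list_bit)
      ultimately show ?case using 9(2) I by (simp add: positions_simps)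
    qed (use I V p lenc lg j in auto)
  next
    show "length ?g \<le> V" using V lenc lg by linarith
  qed (use r V in \<open>auto simp: written_regs_gate_body positions_simps vertex_values_input\<close>)
qed

lemma wp_compare:
  assumes r: "regs s 9 = p" "arrays s 21 p = length vs"
    "\<And>j. j < length vs \<Longrightarrow> arrays s 21 (Suc p + j) = Suc (vs ! j)"
    "\<And>v. v \<in> set vs \<Longrightarrow> arrays s 5 v = of_bool (b v)" "regs s 21 = of_bool f"
    and V: "p + length vs + 2 \<le> V" "\<And>v. v \<in> set vs \<Longrightarrow> Suc v \<le> V" and vs: "vs \<noteq> []"
  shows "wp V compare (\<lambda>k' s' \<omega>'. \<omega>' = \<omega> \<and> k' \<le> k + 8 + 13 * length vs \<and>
    regs s' 21 = of_bool (f \<or> (\<exists>j<length vs. b (vs ! j) \<noteq> b (vs ! 0)))) k s \<omega>"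
proof -
  define u0 where "u0 = (of_bool (b (vs ! 0)) :: nat)"
  let ?s1 = "set_reg 13 u0 (set_reg 13 (vs ! 0) (set_reg 13 (Suc (vs ! 0)) (set_reg 9 (Suc p) (set_reg 12 (length vs) s))))"
  let ?Q = "\<lambda>k' s' \<omega>'. \<omega>' = \<omega> \<and> k' \<le> k + 8 + 13 * length vs \<and>
    regs s' 21 = of_bool (f \<or> (\<exists>j<length vs. b (vs ! j) \<noteq> b (vs ! 0)))"
  have u0: "u0 \<le> 1" by (simp add: u0_def)
  have main: "wp V (For 7 (Reg 12) compare_body) ?Q (Suc (Suc (Suc (Suc (Suc k))))) ?s1 \<omega>"
  proof (rule wp_For[where n = "length vs" and I = "\<lambda>i k' s' \<omega>'. \<omega>' = \<omega> \<and> k' \<le> k + 7 + 13 * i \<and>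
      regs s' 21 = of_bool (f \<or> (\<exists>j<i. b (vs ! j) \<noteq> b (vs ! 0)))"])
    fix i k' s' \<omega>'
    assume i: "i < length vs" and fr: "same_except (insert 7 (insert 2 (written_regs compare_body))) (written_arrays compare_body) ?s1 s'"
      and ri: "regs s' 7 = i" and I: "\<omega>' = \<omega> \<and> k' \<le> k + 7 + 13 * i \<and>
      regs s' 21 = of_bool (f \<or> (\<exists>j<i. b (vs ! j) \<noteq> b (vs ! 0)))"
    define u where "u = (of_bool (b (vs ! i)) :: nat)"
    have s': "regs s' 9 = Suc p" "regs s' 13 = u0" "arrays s' 21 (Suc p + i) = Suc (vs ! i)" "arrays s' 5 (vs ! i) = u"
      using fr r(3)[OF i] r(4)[of "vs ! i"] i by (simp_all add: same_except_def written_regs_compare_body u_def)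
    have u: "u \<le> 1" by (simp add: u_def)
    have V': "u \<le> V" "u0 \<le> V" "u0 - u \<le> V" "u - u0 \<le> V" "u0 - u + (u - u0) \<le> V" "1 \<le> V" "p + 1 + i \<le> V" "Suc (vs ! i) \<le> V"
      using V i u u0 by auto
    have d: "u0 - u + (u - u0) \<noteq> 0 \<longleftrightarrow> b (vs ! i) \<noteq> b (vs ! 0)"
      by (cases "b (vs ! i)"; cases "b (vs ! 0)"; simp add: u0_def u_def)
    have ex: "(\<exists>j<Suc i. b (vs ! j) \<noteq> b (vs ! 0)) \<longleftrightarrow> (\<exists>j<i. b (vs ! j) \<noteq> b (vs ! 0)) \<or> b (vs ! i) \<noteq> b (vs ! 0)"
      by (auto simp: less_Suc_eq)
    define P where "P = (\<lambda>k' (s' :: state) \<omega>'. \<omega>' = \<omega> \<and> k' + 3 \<le> k + 7 + 13 * Suc i \<and>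
      regs s' 21 = of_bool (f \<or> (\<exists>j<Suc i. b (vs ! j) \<noteq> b (vs ! 0))))"
    have P1: "P K (set_reg 21 (Suc 0) S) \<omega>'" if "b (vs ! i) \<noteq> b (vs ! 0)" "K \<le> k' + 9" for K S
      using that I unfolding P_def ex by simp
    have P0: "P K S \<omega>'" if "b (vs ! i) = b (vs ! 0)" "K \<le> k' + 9" "regs S 21 = regs s' 21" for K S
      using that I unfolding P_def ex by simp
    have "wp V compare_body P k' s' \<omega>'"
      unfolding compare_body_def
      apply (rule wp_Seq | ((rule wp_Load wp_Op); (use s' ri V' in simp)?))+
      apply (rule wp_Cond)
        apply (use V' in simp)
       apply (rule wp_Move, use V' in simp, unfold opval.simps(1), rule P1)
        apply (use d in simp)
       apply simp
      apply (rule wp_Skip, rule P0)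
        apply (use d in simp)
       apply simp_all
      done
    then show "wp V compare_body (\<lambda>k' s' \<omega>'. \<omega>' = \<omega> \<and> k' + 3 \<le> k + 7 + 13 * Suc i \<and>
      regs s' 21 = of_bool (f \<or> (\<exists>j<Suc i. b (vs ! j) \<noteq> b (vs ! 0)))) k' s' \<omega>'"
      by (simp only: P_def)
  qed (use r V in \<open>auto simp: written_regs_compare_body\<close>)
  have r': "arrays s 21 (Suc p) = Suc (vs ! 0)" "arrays s 5 (vs ! 0) = u0" "Suc (vs ! 0) \<le> V" "u0 \<le> V" "p \<le> V" "Suc p \<le> V"
      "length vs \<le> V"
    using r(3)[of 0] r(4)[of "vs ! 0"] vs V(1) V(2)[of "vs ! 0"] u0 by (auto simp: u0_def)
  have "wp V compare Q k s \<omega>" if "wp V (For 7 (Reg 12) compare_body) Q (Suc (Suc (Suc (Suc (Suc k))))) ?s1 \<omega>" for Q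
    unfolding compare_def
    apply (rule wp_Seq | ((rule wp_Load wp_Op); (use r(1,2) r' in simp)?))+
    using that r r' by simp
  from this[OF main] show ?thesis .
qed

lemma wp_flips:
  assumes r: "regs s 19 = length ws" and V: "length ws + 1 \<le> V"
  shows "wp V (For 7 (Reg 19) flip_body) (\<lambda>k' s' \<omega>'. \<omega>' = \<omega> \<and> k' \<le> k + 3 + 5 * length ws \<and>
    (\<forall>i<length ws. arrays s' 5 i = of_bool (ws ! i))) k s (ws @ \<omega>)"
proof (rule wp_For[where n = "length ws" and I = "\<lambda>j k' s' \<omega>'. \<omega>' = drop j ws @ \<omega> \<and> k' \<le> k + 2 + 5 * j \<and>
    (\<forall>i<j. arrays s' 5 i = of_bool (ws ! i))"])
  fix j k' \<omega>' and s' :: state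
  assume j: "j < length ws" and ri: "regs s' 7 = j" and I: "\<omega>' = drop j ws @ \<omega> \<and> k' \<le> k + 2 + 5 * j \<and>
    (\<forall>i<j. arrays s' 5 i = of_bool (ws ! i))"
  have w: "\<omega>' = ws ! j # (drop (Suc j) ws @ \<omega>)" using I j by (simp add: Cons_nth_drop_Suc[symmetric])
  show "wp V flip_body (\<lambda>k' s' \<omega>'. \<omega>' = drop (Suc j) ws @ \<omega> \<and> k' + 3 \<le> k + 2 + 5 * Suc j \<and>
    (\<forall>i<Suc j. arrays s' 5 i = of_bool (ws ! i))) k' s' \<omega>'"
    unfolding flip_body_def w
    by (intro wp_Seq wp_Flip wp_Store) (use ri j V I in \<open>auto simp: less_Suc_eq\<close>)
qed (use r V in \<open>auto simp: written_regs_flip_body\<close>)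

text \<open>The event detected by a trial. Output 0 of the circuits in question has the all-ones
  row, so a difference from it reveals a zero entry in some row.\<close>

definition rows_differ :: "circuit \<Rightarrow> (nat \<Rightarrow> bit) \<Rightarrow> bool" where
  "rows_differ C x \<longleftrightarrow> (\<exists>i<length (outputs C). output_value sum_list x C i \<noteq> output_value sum_list x C 0)"

lemma written_regs_trial: "written_regs trial = {2, 7, 8, 9, 10, 11, 12, 13, 14, 15, 16, 21}" "written_arrays trial = {5}"
  by (auto simp: trial_def compare_def written_regs_gate_body written_regs_compare_body written_regs_flip_body)

text \<open>A trial consumes one toss per input and leaves the remaining tosses for its successor;
  \<open>f\<close> is the result accumulated so far, which makes two runs in sequence compute a
  disjunction.\<close>

lemma wp_trial:
  assumes C: "wf_circuit C" and r: "regs s 19 = inputs C" "regs s 21 = of_bool f"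
    "\<And>i. i < length (encode_circuit C) \<Longrightarrow> arrays s 21 i = encode_circuit C ! i"
    and ws: "length ws = inputs C"
    and V: "length (encode_circuit C) + inputs C + 3 \<le> V"
  shows "wp V trial (\<lambda>k' s' \<omega>'. \<omega>' = \<omega> \<and> k' \<le> k + 20 + 5 * inputs C + 30 * length (encode_circuit C) \<and>
    regs s' 21 = of_bool (f \<or> rows_differ C (\<lambda>j. of_bool (ws ! j)))) k s (ws @ \<omega>)"
proof -
  let ?x = "\<lambda>j. of_bool (ws ! j) :: bit"
  let ?g = "gates C" and ?o = "outputs C"
  let ?Q = "\<lambda>k' s' \<omega>'. \<omega>' = \<omega> \<and> k' \<le> k + 20 + 5 * inputs C + 30 * length (encode_circuit C) \<and>
    regs s' 21 = of_bool (f \<or> rows_differ C ?x)"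
  have enc: "encode_circuit C = inputs C # length ?g # concat (map (\<lambda>ps. length ps # map Suc ps) ?g) @
      length ?o # map Suc ?o"
    by (simp add: encode_circuit_def)
  let ?p = "positions ?g (length ?g)"
  have pre: "length (inputs C # length ?g # concat (map (\<lambda>ps. length ps # map Suc ps) ?g)) = ?p"
    using length_blocks[of "length ?g" ?g Suc] by simp
  have enc': "encode_circuit C = (inputs C # length ?g # concat (map (\<lambda>ps. length ps # map Suc ps) ?g)) @
      length ?o # map Suc ?o"
    by (simp add: enc)
  have lenc: "length (encode_circuit C) = ?p + Suc (length ?o)"
    unfolding enc' length_append pre by simp
  have out: "encode_circuit C ! ?p = length ?o"
    "\<And>j. j < length ?o \<Longrightarrow> encode_circuit C ! (Suc ?p + j) = Suc (?o ! j)"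
    unfolding enc' pre[symmetric] add_Suc_shift nth_append_length_plus by (simp_all only: nth_append_length nth_Cons_0 nth_Cons_Suc nth_map)
  have lg: "length ?g \<le> ?p"
    unfolding positions_def using sum_bounded_below[of "{..<length ?g}" 1 "\<lambda>i. Suc (length (?g ! i))"] by simp
  have o_lt: "v < inputs C + length ?g" if "v \<in> set ?o" for v
    using C that by (auto simp: wf_circuit_def)
  have o0: "?o \<noteq> []" using C by (simp add: wf_circuit_def)
  have compare: "wp V compare ?Q k' s' \<omega>"
    if k': "k' \<le> k + 9 + 5 * inputs C + 14 * ?p" and s': "regs s' 9 = ?p" "arrays s' 21 = arrays s 21" "regs s' 21 = of_bool f"
      "\<forall>v<inputs C + length ?g. arrays s' 5 v = of_bool (vertex_values sum_list ?x C ! v = 1)" for k' s'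
  proof (rule wp_conseq[OF wp_compare[where p = ?p and vs = ?o and b = "\<lambda>v. vertex_values sum_list ?x C ! v = 1" and f = f]], goal_cases)
    case 2
    show ?case using s'(2) r(3)[of ?p] lenc out by simp
  next
    case (3 j)
    then show ?case using s'(2) r(3)[of "Suc ?p + j"] lenc out(2) by simp
  next
    case (4 v)
    then show ?case using s'(4) o_lt by simp
  next
    case (7 v)
    then show ?case using o_lt[of v] V lenc lg by simp
  next
    case (9 k'' s'' \<omega>'')
    have bit: "(x = 1) \<noteq> (y = 1) \<longleftrightarrow> x \<noteq> y" for x y :: bit
      by (cases x; cases y) auto
    have "k'' \<le> k + 20 + 5 * inputs C + 30 * length (encode_circuit C)"
      using 9(2) k' lenc by simp
    then show ?case using 9(2) unfolding bit rows_differ_def output_value_def by blast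
  qed (use s' V lenc o0 in auto)
  have main: "wp V (Load 10 21 (Imm 1) ;; Move 9 (Imm 2) ;; Move 11 (Reg 19) ;;
     For 7 (Reg 10) gate_body ;; compare) ?Q k' s' \<omega>"
    if k': "k' \<le> k + 3 + 5 * inputs C" and s': "regs s' 19 = inputs C" "arrays s' 21 = arrays s 21" "regs s' 21 = of_bool f"
      "\<forall>i<inputs C. arrays s' 5 i = of_bool (ws ! i)" for k' s'
  proof -
    let ?s1 = "set_reg 11 (inputs C) (set_reg 9 2 (set_reg 10 (length ?g) s'))"
    have loop: "wp V (For 7 (Reg 10) gate_body ;; compare) ?Q (Suc (Suc (Suc k'))) ?s1 \<omega>"
    proof (rule wp_seq_conseq[OF wp_gates[OF C, where x = ?x]], goal_cases)
      case (7 k2 s2 \<omega>2)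
      have "k2 \<le> k + 9 + 5 * inputs C + 14 * ?p" using 7(2) k' by simp
      moreover have "arrays s2 21 = arrays s 21" "regs s2 21 = of_bool f"
        using 7(1) s' by (simp_all add: same_except_def written_regs_gate_body)
      moreover have "\<omega>2 = \<omega>" using 7(2) by blast
      ultimately show ?case using 7(2) compare by blast
    qed (use s' r(3) V in auto)
    have e1: "arrays s' 21 (Suc 0) = length ?g" using s'(2) r(3)[of 1] by (simp add: enc)
    have V': "length ?g \<le> V" "2 \<le> V" "inputs C \<le> V" using V lenc lg by linarith+
    have "wp V (Load 10 21 (Imm 1) ;; Move 9 (Imm 2) ;; Move 11 (Reg 19) ;; For 7 (Reg 10) gate_body ;; compare) Q k' s' \<omega>"
      if "wp V (For 7 (Reg 10) gate_body ;; compare) Q (Suc (Suc (Suc k'))) ?s1 \<omega>" for Q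
      apply (rule wp_Seq, ((rule wp_Load wp_Move); (use s' e1 V' in simp)?))+
      using that s' e1 by simp
    from this[OF loop] show ?thesis .
  qed
  show ?thesis
    unfolding trial_def
  proof (rule wp_seq_conseq[OF wp_flips])
    fix k' s' \<omega>'
    assume fr: "same_except (written_regs (For 7 (Reg 19) flip_body)) (written_arrays (For 7 (Reg 19) flip_body)) s s'"
      and I: "\<omega>' = \<omega> \<and> k' \<le> k + 3 + 5 * length ws \<and> (\<forall>i<length ws. arrays s' 5 i = of_bool (ws ! i))"
    have s': "regs s' 19 = inputs C" "arrays s' 21 = arrays s 21" "regs s' 21 = of_bool f"
      using fr r by (simp_all add: same_except_def written_regs_flip_body)
    show "wp V (Load 10 21 (Imm 1) ;; Move 9 (Imm 2) ;; Move 11 (Reg 19) ;;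
      For 7 (Reg 10) gate_body ;; compare) ?Q k' s' \<omega>'"
      using main[of k' s', OF _ s'] I ws by simp
  qed (use r ws V in auto)
qed

section \<open>Correctness of the reduction\<close>

lemma gates_or_circuit:
  "length (gates (or_circuit M m A B)) = Suc (m + M)"
  "gates (or_circuit M m A B) ! 0 = [0..<Suc M]"
  "i < m \<Longrightarrow> gates (or_circuit M m A B) ! Suc i = 0 # map Suc (filter (A i) [0..<M])"
  "a < M \<Longrightarrow> gates (or_circuit M m A B) ! Suc (m + a) = 0 # map (\<lambda>i. i + (M + 2)) (filter (B a) [0..<m])"
  by (simp_all add: or_circuit_def nth_append del: upt_Suc)

lemma or_circuit_simps [simp]:
  "inputs (or_circuit M m A B) = Suc M"
  "length (outputs (or_circuit M m A B)) = Suc M"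
  "outputs (or_circuit M m A B) ! 0 = Suc M"
  "a < M \<Longrightarrow> outputs (or_circuit M m A B) ! Suc a = Suc M + Suc (m + a)"
  by (simp_all add: or_circuit_def)

lemma wf_or_circuit: "wf_circuit (or_circuit M m A B)"
  unfolding wf_circuit_def
proof (intro conjI allI impI)
  let ?C = "or_circuit M m A B"
  fix k assume k: "k < length (gates ?C)"
  consider "k = 0" | i where "k = Suc i" "i < m" | a where "k = Suc (m + a)" "a < M"
    using k unfolding gates_or_circuit(1) by (metis add_diff_inverse_nat less_Suc_eq_0_disj nat_add_left_cancel_less)
  then have "gates ?C ! k \<noteq> [] \<and> distinct (gates ?C ! k) \<and> set (gates ?C ! k) \<subseteq> {..<inputs ?C + k}"
  proof cases
    case 1
    then show ?thesis by (auto simp: gates_or_circuit simp del: upt_Suc)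
  next
    case 2
    then show ?thesis by (auto simp: gates_or_circuit distinct_map)
  next
    case 3
    then show ?thesis by (auto simp: gates_or_circuit distinct_map inj_on_def)
  qed
  then show "gates ?C ! k \<noteq> []" "distinct (gates ?C ! k)" "set (gates ?C ! k) \<subseteq> {..<inputs ?C + k}"
    by blast+
next
  let ?C = "or_circuit M m A B"
  show "outputs ?C \<noteq> []" "distinct (outputs ?C)" "set (outputs ?C) \<subseteq> {..<inputs ?C + length (gates ?C)}"
    by (auto simp: or_circuit_def distinct_map inj_on_def)
  show "inputs ?C \<le> wires ?C"
    by (simp add: or_circuit_def wires_def del: upt_Suc)
qed

text \<open>Gate 0 has \<open>M + 1\<close> wires, each of the \<open>m\<close> clause gates at most
  \<open>M + 1\<close>, each of the \<open>M\<close> output gates at most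
  \<open>m + 1\<close>.\<close>

lemma wires_or_circuit: "wires (or_circuit M m A B) \<le> 2 * (M + 1) * (m + 1)"
proof -
  have 1: "(\<Sum>i\<leftarrow>[0..<n]. Suc (length (filter (P i) [0..<c]))) \<le> n * Suc c" for n c and P :: "nat \<Rightarrow> nat \<Rightarrow> bool"
  proof (induction n)
    case (Suc n)
    have "length (filter (P n) [0..<c]) \<le> c" using length_filter_le[of "P n" "[0..<c]"] by simp
    with Suc show ?case by simp
  qed simp
  have "wires (or_circuit M m A B) = Suc M + (\<Sum>i\<leftarrow>[0..<m]. Suc (length (filter (A i) [0..<M])))
      + (\<Sum>a\<leftarrow>[0..<M]. Suc (length (filter (B a) [0..<m])))"
    by (simp add: or_circuit_def wires_def comp_def del: upt_Suc)
  then show ?thesis using 1[of A M m] 1[of B m M] by (simp add: algebra_simps)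
qed

lemma or_circuit_value:
  fixes x :: "nat \<Rightarrow> bool" and M m :: nat and A B :: "nat \<Rightarrow> nat \<Rightarrow> bool"
  defines "val \<equiv> output_value (\<lambda>bs. \<exists>b\<in>set bs. b) x (or_circuit M m A B)"
  shows "val 0 \<longleftrightarrow> (\<exists>j\<le>M. x j)"
    and "a < M \<Longrightarrow> val (Suc a) \<longleftrightarrow> x 0 \<or> (\<exists>i<m. B a i \<and> (x 0 \<or> (\<exists>c<M. A i c \<and> x (Suc c))))"
proof -
  let ?C = "or_circuit M m A B"
  let ?v = "vertex_values (\<lambda>bs. \<exists>b\<in>set bs. b) x ?C"
  note gate = vertex_values_gate[OF wf_or_circuit[of M m A B], of _ "\<lambda>bs. \<exists>b\<in>set bs. b" x, unfolded gates_or_circuit(1) or_circuit_simps(1)]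
  have inp: "?v ! j = x j" if "j \<le> M" for j
    using that by (simp add: vertex_values_input)
  show "val 0 \<longleftrightarrow> (\<exists>j\<le>M. x j)"
    using gate[of 0] inp by (auto simp: val_def output_value_def gates_or_circuit less_Suc_eq_le simp del: upt_Suc)
  have clause: "?v ! (Suc M + Suc i) \<longleftrightarrow> x 0 \<or> (\<exists>c<M. A i c \<and> x (Suc c))" if "i < m" for i
    using gate[of "Suc i"] inp that by (auto simp: gates_or_circuit(3))
  have idx: "i + (M + 2) = Suc M + Suc i" for i by simp
  show "val (Suc a) \<longleftrightarrow> x 0 \<or> (\<exists>i<m. B a i \<and> (x 0 \<or> (\<exists>c<M. A i c \<and> x (Suc c))))" if a: "a < M"
  proof -
    have "val (Suc a) \<longleftrightarrow> (\<exists>b\<in>set (map ((!) ?v) (0 # map (\<lambda>i. i + (M + 2)) (filter (B a) [0..<m]))). b)"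
      using gate[of "Suc (m + a)"] a
      by (simp only: val_def output_value_def or_circuit_simps(4)[OF a] gates_or_circuit(4)[OF a])
    also have "\<dots> \<longleftrightarrow> ?v ! 0 \<or> (\<exists>i<m. B a i \<and> ?v ! (Suc M + Suc i))"
      unfolding idx by (auto simp del: add_Suc add_Suc_right)
    also have "\<dots> \<longleftrightarrow> x 0 \<or> (\<exists>i<m. B a i \<and> (x 0 \<or> (\<exists>c<M. A i c \<and> x (Suc c))))"
      unfolding inp[OF le0] using clause by blast
    finally show ?thesis .
  qed
qed

text \<open>The matrix in \<open>rewrites_OR_circuits\<close> is only known to exist; its entries
  are recovered by evaluating the OR-circuit on unit vectors. Row 0 and column 0 are the added
  all-ones row and column, which shifts the assignments by one.\<close>

lemma OR_computes_or_circuit: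
  assumes "OR_computes (or_circuit M m A B) Q"
  shows "dim_row Q = Suc M" "dim_col Q = Suc M"
    and "j \<le> M \<Longrightarrow> Q $$ (0, j)"
    and "a < M \<Longrightarrow> j \<le> M \<Longrightarrow> Q $$ (Suc a, j) \<longleftrightarrow> j = 0 \<or> (\<exists>i<m. B a i \<and> A i (j - 1))"
proof -
  show d: "dim_row Q = Suc M" "dim_col Q = Suc M"
    using assms by (auto simp: OR_computes_def circuit_dims_def)
  have Q: "Q $$ (i, j) \<longleftrightarrow> output_value (\<lambda>bs. \<exists>b\<in>set bs. b) (\<lambda>j'. j' = j) (or_circuit M m A B) i"
    if "i \<le> M" "j \<le> M" for i j
    using assms that d by (auto simp: OR_computes_def)
  show "j \<le> M \<Longrightarrow> Q $$ (0, j)"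
    using Q[of 0 j] by (simp add: or_circuit_value)
  show "a < M \<Longrightarrow> j \<le> M \<Longrightarrow> Q $$ (Suc a, j) \<longleftrightarrow> j = 0 \<or> (\<exists>i<m. B a i \<and> A i (j - 1))"
    using Q[of "Suc a" j] by (cases j) (auto simp: or_circuit_value)
qed

text \<open>If entry \<open>(i, j)\<close> is zero, flipping \<open>x j\<close> leaves output
  \<open>i\<close> unchanged but changes output 0, whose row is all ones. Equal outputs before the
  flip thus become different, which pairs every failing input with a succeeding one.\<close>

lemma rows_differ_XOR:
  assumes C: "XOR_computes C Q" and ones: "\<And>j. j < dim_col Q \<Longrightarrow> Q $$ (0, j)" and row: "0 < dim_row Q"
  shows "(\<And>i j. i < dim_row Q \<Longrightarrow> j < dim_col Q \<Longrightarrow> Q $$ (i, j)) \<Longrightarrow> \<not> rows_differ C x"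
    and "i < dim_row Q \<Longrightarrow> j < dim_col Q \<Longrightarrow> \<not> Q $$ (i, j) \<Longrightarrow> \<not> rows_differ C x \<Longrightarrow> x' j \<noteq> x j \<Longrightarrow>
      (\<And>j'. j' < dim_col Q \<Longrightarrow> j' \<noteq> j \<Longrightarrow> x' j' = x j') \<Longrightarrow> rows_differ C x'"
proof -
  have out: "output_value sum_list x C i = (\<Sum>j < dim_col Q. of_bool (Q $$ (i, j)) * x j)"
    if "i < dim_row Q" for i and x :: "nat \<Rightarrow> bit"
    using C that unfolding XOR_computes_def by blast
  have "circuit_dims C Q" using C unfolding XOR_computes_def by blast
  then have len: "length (outputs C) = dim_row Q" by (auto simp: circuit_dims_def)
  show "\<not> rows_differ C x" if all: "\<And>i j. i < dim_row Q \<Longrightarrow> j < dim_col Q \<Longrightarrow> Q $$ (i, j)"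
  proof -
    have "output_value sum_list x C i = output_value sum_list x C 0" if "i < dim_row Q" for i
      unfolding out[OF that] out[OF row] using all that row by (intro sum.cong) auto
    then show ?thesis unfolding rows_differ_def len by blast
  qed
  show "rows_differ C x'" if ij: "i < dim_row Q" "j < dim_col Q" "\<not> Q $$ (i, j)"
    and x: "\<not> rows_differ C x" and x'j: "x' j \<noteq> x j" and x': "\<And>j'. j' < dim_col Q \<Longrightarrow> j' \<noteq> j \<Longrightarrow> x' j' = x j'"
  proof -
    have "output_value sum_list x' C i = output_value sum_list x C i"
      unfolding out[OF ij(1)]
    proof (intro sum.cong refl)
      fix j' assume "j' \<in> {..<dim_col Q}"
      then show "of_bool (Q $$ (i, j')) * x' j' = of_bool (Q $$ (i, j')) * x j'"
        by (cases "j' = j") (use ij(3) x' in simp_all)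
    qed
    also have "\<dots> = output_value sum_list x C 0"
      using x ij(1) unfolding rows_differ_def len by blast
    also have "\<dots> \<noteq> output_value sum_list x' C 0"
    proof -
      have s: "(\<Sum>j < dim_col Q. of_bool (Q $$ (0, j)) * y j) = y j + (\<Sum>j\<in>{..<dim_col Q} - {j}. y j)" for y :: "nat \<Rightarrow> bit"
      proof -
        have "(\<Sum>j < dim_col Q. of_bool (Q $$ (0, j)) * y j) = (\<Sum>j < dim_col Q. y j)"
          using ones by (intro sum.cong) auto
        also have "\<dots> = y j + (\<Sum>j\<in>{..<dim_col Q} - {j}. y j)"
          using ij(2) by (intro sum.remove) auto
        finally show ?thesis .
      qed
      have e: "(\<Sum>j\<in>{..<dim_col Q} - {j}. x' j) = (\<Sum>j\<in>{..<dim_col Q} - {j}. x j)"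
        using x' by (intro sum.cong) auto
      show ?thesis unfolding out[OF row] s e add_right_cancel using x'j by metis
    qed
    finally show ?thesis using ij(1) unfolding rows_differ_def len by blast
  qed
qed

text \<open>
  If flipping a fixed coin turns every failure of a trial into a success, then flipping that coin
  in either or both of two trials yields three further disjoint copies of the set of joint failures.
\<close>

lemma card_two_failures:
  fixes succ :: "bool list \<Rightarrow> bool"
  assumes j: "j < N" and T: "2 * N \<le> T"
    and succ: "\<And>ws. length ws = N \<Longrightarrow> \<not> succ ws \<Longrightarrow> succ (ws[j := (\<not> ws ! j)])"
  shows "4 * card {\<omega>. length \<omega> = T \<and> \<not> succ (take N \<omega>) \<and> \<not> succ (take N (drop N \<omega>))} \<le> 2 ^ T"
proof -
  let ?F = "{\<omega>. length \<omega> = T \<and> \<not> succ (take N \<omega>) \<and> \<not> succ (take N (drop N \<omega>))}"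
  define flip where "flip i \<omega> = list_update \<omega> i (\<not> \<omega> ! i)" for i and \<omega> :: "bool list"
  have flip_flip: "flip i (flip i \<omega>) = \<omega>" for i \<omega>
    by (cases "i < length \<omega>") (auto simp: flip_def list_update_beyond)
  have inj: "inj_on (flip i) S" for i S by (rule inj_on_inverseI[of _ "flip i"]) (rule flip_flip)
  have len: "length (flip i \<omega>) = length \<omega>" for i \<omega> by (simp add: flip_def)
  have t1: "take N (flip j \<omega>) = flip j (take N \<omega>)" "take N (drop N (flip j \<omega>)) = take N (drop N \<omega>)"
    if "length \<omega> = T" for \<omega>
    using j by (simp_all add: flip_def take_update_swap drop_update_cancel)
  have t2: "take N (flip (N + j) \<omega>) = take N \<omega>" "take N (drop N (flip (N + j) \<omega>)) = flip j (take N (drop N \<omega>))"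
    if "length \<omega> = T" for \<omega>
    using j T that by (simp_all add: flip_def take_update_swap drop_update_swap list_update_beyond)
  have s: "succ (flip j (take N \<omega>))" "succ (flip j (take N (drop N \<omega>)))" if "\<omega> \<in> ?F" for \<omega>
    using that T succ[of "take N \<omega>"] succ[of "take N (drop N \<omega>)"] by (simp_all add: flip_def)
  let ?F1 = "flip j ` ?F" and ?F2 = "flip (N + j) ` ?F" and ?F3 = "flip (N + j) ` flip j ` ?F"
  have F1: "length \<omega> = T \<and> succ (take N \<omega>) \<and> \<not> succ (take N (drop N \<omega>))" if "\<omega> \<in> ?F1" for \<omega>
    using that s by (auto simp: t1 len)
  have F2: "length \<omega> = T \<and> \<not> succ (take N \<omega>) \<and> succ (take N (drop N \<omega>))" if "\<omega> \<in> ?F2" for \<omega>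
    using that s by (auto simp: t2 len)
  have F3: "length \<omega> = T \<and> succ (take N \<omega>) \<and> succ (take N (drop N \<omega>))" if "\<omega> \<in> ?F3" for \<omega>
    using that s by (auto simp: t1 t2 len)
  have fin: "finite {\<omega> :: bool list. length \<omega> = T}" and cardT: "card {\<omega> :: bool list. length \<omega> = T} = 2 ^ T"
    using finite_lists_length_eq[of "UNIV :: bool set" T] card_lists_length_eq[of "UNIV :: bool set" T] by simp_all
  have finF: "finite ?F" by (rule finite_subset[OF _ fin]) auto
  have F0: "length \<omega> = T \<and> \<not> succ (take N \<omega>) \<and> \<not> succ (take N (drop N \<omega>))" if "\<omega> \<in> ?F" for \<omega>
    using that by simp
  define G0 G1 G2 G3 where G: "G0 = ?F" "G1 = ?F1" "G2 = ?F2" "G3 = ?F3"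
  note F = F0[folded G(1)] F1[folded G(2)] F2[folded G(3)] F3[folded G(4)]
  have finG: "finite G0" "finite G1" "finite G2" "finite G3" using finF unfolding G by simp_all
  have "card ((G0 \<union> G1) \<union> (G2 \<union> G3)) = card (G0 \<union> G1) + card (G2 \<union> G3)"
    by (rule card_Un_disjoint) (use finG F in blast)+
  also have "card (G0 \<union> G1) = card G0 + card G1"
    by (rule card_Un_disjoint) (use finG F in blast)+
  also have "card (G2 \<union> G3) = card G2 + card G3"
    by (rule card_Un_disjoint) (use finG F in blast)+
  also have "card G0 + card G1 + (card G2 + card G3) = 4 * card ?F"
    unfolding G by (simp add: card_image inj)
  finally have "4 * card ?F = card ((G0 \<union> G1) \<union> (G2 \<union> G3))" ..
  also have "\<dots> \<le> card {\<omega> :: bool list. length \<omega> = T}"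
    by (rule card_mono[OF fin]) (use F in blast)
  finally show ?thesis
    by (simp only: cardT)
qed

section \<open>Half assignments as binary numbers\<close>

lemma exists_nat_with_bits: "\<exists>a<2 ^ h. \<forall>v<h. odd ((a::nat) div 2 ^ v) = \<alpha> v"
proof (induction h arbitrary: \<alpha>)
  case (Suc h)
  obtain a :: nat where a: "a < 2 ^ h" "\<forall>v<h. odd (a div 2 ^ v) = \<alpha> (Suc v)"
    using Suc[of "\<lambda>v. \<alpha> (Suc v)"] by blast
  let ?a = "2 * a + of_bool (\<alpha> 0)"
  have half: "?a div 2 = a" by simp
  have "odd (?a div 2 ^ v) = \<alpha> v" if "v < Suc h" for v
  proof (cases v)
    case (Suc u)
    have "?a div 2 ^ Suc u = a div 2 ^ u" by (simp only: power_Suc div_mult2_eq half)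
    then show ?thesis using Suc a(2) that by simp
  qed simp
  moreover have "?a < 2 ^ Suc h"
    using a(1) by (cases "\<alpha> 0") simp_all
  ultimately show ?case by blast
qed simp

text \<open>The lower half is \<open>c\<close>, the upper half \<open>a\<close>. For an odd number
  of variables the upper half has one spare bit, which is why \<open>h\<close> need only satisfy an
  inequality.\<close>

lemma satisfiable_iff_halves:
  assumes wf: "wf_cnf \<phi>" and h: "num_vars \<phi> \<le> 2 * h"
  shows "satisfiable \<phi> \<longleftrightarrow> (\<exists>a<2 ^ h. \<exists>c<2 ^ h. \<forall>cl\<in>set (clauses \<phi>).
    \<not> ((\<forall>l\<in>set cl. falsifiesL h c l) \<and> (\<forall>l\<in>set cl. falsifiesR h a l)))"
proof
  assume "satisfiable \<phi>"
  then obtain \<alpha> where \<alpha>: "\<And>cl. cl \<in> set (clauses \<phi>) \<Longrightarrow> \<exists>(v, b)\<in>set cl. \<alpha> v = b"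
    by (auto simp: satisfiable_def)
  obtain c :: nat where c: "c < 2 ^ h" "\<forall>v<h. odd (c div 2 ^ v) = \<alpha> v"
    using exists_nat_with_bits[of h \<alpha>] by blast
  obtain a :: nat where a: "a < 2 ^ h" "\<forall>v<h. odd (a div 2 ^ v) = \<alpha> (v + h)"
    using exists_nat_with_bits[of h "\<lambda>v. \<alpha> (v + h)"] by blast
  have "\<not> ((\<forall>l\<in>set cl. falsifiesL h c l) \<and> (\<forall>l\<in>set cl. falsifiesR h a l))" if cl: "cl \<in> set (clauses \<phi>)" for cl
  proof -
    obtain v b where vb: "(v, b) \<in> set cl" "\<alpha> v = b" using \<alpha>[OF cl] by auto
    have "v < num_vars \<phi>" using wf cl vb(1) unfolding wf_cnf_def by blast
    then have v: "v < 2 * h" using h by simp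
    show ?thesis
    proof (cases "v < h")
      case True
      then have "\<not> falsifiesL h c (v, b)" using c vb by (simp add: falsifiesL_def)
      then show ?thesis using vb by blast
    next
      case False
      then have "\<not> falsifiesR h a (v, b)" using a(2)[rule_format, of "v - h"] v vb by (simp add: falsifiesR_def)
      then show ?thesis using vb by blast
    qed
  qed
  then show "\<exists>a<2 ^ h. \<exists>c<2 ^ h. \<forall>cl\<in>set (clauses \<phi>).
    \<not> ((\<forall>l\<in>set cl. falsifiesL h c l) \<and> (\<forall>l\<in>set cl. falsifiesR h a l))"
    using a(1) c(1) by blast
next
  assume "\<exists>a<2 ^ h. \<exists>c<2 ^ h. \<forall>cl\<in>set (clauses \<phi>).
    \<not> ((\<forall>l\<in>set cl. falsifiesL h c l) \<and> (\<forall>l\<in>set cl. falsifiesR h a l))"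
  then obtain a c where ac: "\<And>cl. cl \<in> set (clauses \<phi>) \<Longrightarrow>
    \<exists>l\<in>set cl. \<not> falsifiesL h c l \<or> \<not> falsifiesR h a l" by blast
  show "satisfiable \<phi>"
    unfolding satisfiable_def
  proof (intro exI ballI)
    fix cl assume "cl \<in> set (clauses \<phi>)"
    from ac[OF this] obtain v b where vb: "(v, b) \<in> set cl" "\<not> falsifiesL h c (v, b) \<or> \<not> falsifiesR h a (v, b)"
      by auto
    \<comment> \<open>The satisfying assignment is glued together from the bits of the two
      numbers.\<close>
    show "\<exists>(v, b)\<in>set cl. (if v < h then odd (c div 2 ^ v) else odd (a div 2 ^ (v - h))) = b"
      by (rule bexI[OF _ vb(1)]) (use vb(2) in \<open>auto simp: falsifiesL_def falsifiesR_def split: if_splits\<close>)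
  qed
qed

text \<open>Literals within a clause are distinct, so there are at most two per variable. This makes
  the scan of the formula polynomial in the numbers of variables and clauses.\<close>

lemma length_clause_le:
  assumes "wf_cnf \<phi>" "cl \<in> set (clauses \<phi>)"
  shows "length cl \<le> 2 * num_vars \<phi>"
proof -
  have "set cl \<subseteq> {..<num_vars \<phi>} \<times> UNIV" using assms by (auto simp: wf_cnf_def)
  then have "card (set cl) \<le> card ({..<num_vars \<phi>} \<times> (UNIV :: bool set))" by (intro card_mono) auto
  then show ?thesis
    using assms by (simp add: wf_cnf_def distinct_card card_cartesian_product mult.commute)
qed

text \<open>
  Only the first two numbers in the encoding of a circuit can be zero, and every nonzero cell of the
  output array has been written.
\<close>

lemma length_encode_circuit_le:
  assumes C: "wf_circuit C" and run: "exec p (initial_state xs) \<omega> t s \<omega>'" and out: "output_of s = encode_circuit C"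
  shows "length (encode_circuit C) \<le> t + 2"
proof -
  let ?n = "length (encode_circuit C)"
  have a: "arrays s 1 i = encode_circuit C ! i" if "i < ?n" for i
    using that unfolding out[symmetric] by (simp add: output_of_def)
  have init: "{i. arrays (initial_state xs) 1 i \<noteq> 0} = {}" by (simp add: initial_state_def)
  have card: "finite {i. arrays s 1 i \<noteq> 0}" "card {i. arrays s 1 i \<noteq> 0} \<le> t"
    using exec_card_nonzero_cells[OF run, of 1] by (simp_all only: init finite.emptyI card.empty add_0)
  \<comment> \<open>Fan-ins and the number of outputs are positive by well-formedness, and vertices
    are numbered from 1.\<close>
  have pos: "0 \<notin> set (concat (map (\<lambda>ps. length ps # map Suc ps) (gates C)) @ length (outputs C) # map Suc (outputs C))"
    using C by (auto simp: wf_circuit_def in_set_conv_nth)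
  have "encode_circuit C ! i \<noteq> 0" if "i \<in> {2..<?n}" for i
  proof -
    define i' where "i' = i - 2"
    have i': "i = Suc (Suc i')" using that unfolding i'_def atLeastLessThan_iff by linarith
    then have nz: "encode_circuit C ! i = (concat (map (\<lambda>ps. length ps # map Suc ps) (gates C)) @ length (outputs C) # map Suc (outputs C)) ! i'"
      "i' < length (concat (map (\<lambda>ps. length ps # map Suc ps) (gates C)) @ length (outputs C) # map Suc (outputs C))"
      using that by (simp_all add: encode_circuit_def)
    show ?thesis unfolding nz(1) using pos nth_mem[OF nz(2)] by metis
  qed
  then have "{2..<?n} \<subseteq> {i. arrays s 1 i \<noteq> 0}" using a by auto
  from card_mono[OF card(1) this] card(2) have "card {2..<?n} \<le> t" by simp
  then show ?thesis by simp
qed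

section \<open>The satisfiability algorithm\<close>

definition reduction :: com where
  "reduction = prepare ;; tabulate ;; build"

lemma written_regs_reduction:
  "written_regs reduction = {2, 3, 4, 5, 6, 7, 8, 9, 10, 11, 12, 13, 14, 15, 16, 17, 18, 19, 20, 100}"
  "written_arrays reduction = {2, 3, 4, 20}"
  by (auto simp: reduction_def prepare_def tabulate_def build_def powers_body_def clause_body_def
      assignment_body_def literal_body_def mark_def push_def emit_range_def emit_def emit_body_def)

text \<open>Inputs stand for assignments to the lower half, outputs for assignments to the upper
  half, and clause gate \<open>i\<close> connects those that both falsify clause
  \<open>i\<close>.\<close>

definition cnf_circuit :: "cnf \<Rightarrow> circuit" where
  "cnf_circuit \<phi> = (let h = (num_vars \<phi> + 1) div 2 in
     or_circuit (2 ^ h) (length (clauses \<phi>))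
       (\<lambda>i a. \<forall>l\<in>set (clauses \<phi> ! i). falsifiesL h a l)
       (\<lambda>a i. \<forall>l\<in>set (clauses \<phi> ! i). falsifiesR h a l))"

lemma wp_reduction:
  assumes wf: "wf_cnf \<phi>"
  defines "n \<equiv> num_vars \<phi>" and "m \<equiv> length (clauses \<phi>)"
  defines "M \<equiv> 2 ^ ((n + 1) div 2) :: nat"
  assumes V: "40 * ((M + 1) * (m + 1) * (n + 1)) \<le> V"
  shows "wp V reduction (\<lambda>k' s' \<omega>'. \<omega>' = \<omega> \<and> k' \<le> 162 * ((M + 1) * (m + 1) * (n + 1)) \<and>
    regs s' 19 = M + 1 \<and> holds (encode_circuit (cnf_circuit \<phi>)) s') 0 (initial_state (encode_cnf \<phi>)) \<omega>"
proof -
  let ?s = "initial_state (encode_cnf \<phi>)" and ?cls = "clauses \<phi>"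
  define h where "h = (n + 1) div 2"
  define P where "P = (M + 1) * (m + 1) * (n + 1)"
  have M: "M = 2 ^ h" by (simp add: M_def h_def)
  have hM: "h < M" unfolding M by simp
  have nh: "n \<le> 2 * h" "2 * h \<le> n + 1" by (simp_all add: h_def)
  have P_bounds: "M + 1 \<le> P" "m + 1 \<le> P" "n + 1 \<le> P" "(M + 1) * (m + 1) \<le> P" "(m + 1) * (n + 1) \<le> P" "1 \<le> P"
    unfolding P_def by (auto simp: algebra_simps)
  have V': "40 * P \<le> V" using V by (simp add: P_def)
  define A where "A i a \<longleftrightarrow> (\<forall>l\<in>set (?cls ! i). falsifiesL h a l)" for i a
  define B where "B a i \<longleftrightarrow> (\<forall>l\<in>set (?cls ! i). falsifiesR h a l)" for a i
  let ?Q = "\<lambda>k' s' \<omega>'. \<omega>' = \<omega> \<and> k' \<le> 162 * ((M + 1) * (m + 1) * (n + 1)) \<and>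
    regs s' 19 = M + 1 \<and> holds (encode_circuit (cnf_circuit \<phi>)) s'"
  have circ: "cnf_circuit \<phi> = or_circuit M m A B"
    by (simp add: cnf_circuit_def Let_def M_def h_def n_def m_def A_def[abs_def] B_def[abs_def])
  have enc: "encode_cnf \<phi> = n # m # concat (map (\<lambda>cl. length cl # map (\<lambda>(v, b). 2 * v + of_bool b) cl) ?cls)"
    by (simp add: encode_cnf_def n_def m_def)
  have lenc: "length (encode_cnf \<phi>) = positions ?cls m"
    using length_blocks[of m ?cls "\<lambda>(v, b). 2 * v + of_bool b"] by (simp add: enc m_def)
  have init: "arrays ?s 0 i = encode_cnf \<phi> ! i" if "i < positions ?cls m" for i
    using that by (simp add: initial_state_def lenc)
  have pos: "positions ?cls m \<le> 4 * ((m + 1) * (n + 1))"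
  proof -
    have "(\<Sum>i<m. Suc (length (?cls ! i))) \<le> m * (Suc (2 * n))"
      using sum_bounded_above[of "{..<m}" "\<lambda>i. Suc (length (?cls ! i))" "Suc (2 * n)"]
        length_clause_le[OF wf] by (simp add: n_def m_def)
    then show ?thesis by (simp add: positions_def algebra_simps)
  qed
  have pos2: "2 \<le> positions ?cls m" by (simp add: positions_def)
  have a0: "arrays ?s 0 0 = n" "arrays ?s 0 1 = m"
    using init[of 0] init[of 1] pos2 by (simp_all add: enc)
  have clause: "arrays ?s 0 (positions ?cls k) = length (?cls ! k)"
    "j < length (?cls ! k) \<Longrightarrow> arrays ?s 0 (Suc (positions ?cls k) + j) = (case ?cls ! k ! j of (v, b) \<Rightarrow> 2 * v + of_bool b)"
    if k: "k < m" for k j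
  proof -
    have le: "Suc (positions ?cls k) + length (?cls ! k) \<le> positions ?cls m"
      using positions_le[of "Suc k" ?cls] k by (simp add: positions_simps m_def)
    note nb = nth_blocks[OF k[unfolded m_def], where a = n and b = m and ys = "[]"
        and f = "\<lambda>(v, b). 2 * v + of_bool b", unfolded append_Nil2, folded enc]
    show "arrays ?s 0 (positions ?cls k) = length (?cls ! k)"
      using init[of "positions ?cls k"] le nb(1) by simp
    show "j < length (?cls ! k) \<Longrightarrow> arrays ?s 0 (Suc (positions ?cls k) + j) = (case ?cls ! k ! j of (v, b) \<Rightarrow> 2 * v + of_bool b)"
      using init[of "Suc (positions ?cls k) + j"] le nb(2) by simp
  qed
  have vars: "v < 2 * h" if "cl \<in> set ?cls" "(v, b) \<in> set cl" for cl v b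
  proof -
    have "v < n" using wf that unfolding wf_cnf_def n_def by blast
    then show ?thesis using nh by simp
  qed
  have bounds: "2 * M * m + 10 * (M + m) + 20 \<le> V" "M * m + M + m \<le> V" "positions ?cls m \<le> V" "4 * h + 2 \<le> V"
    "n + 3 \<le> V" "m \<le> V" "M \<le> V" "2 ^ h \<le> V"
  proof -
    have "2 * M * m + 10 * (M + m) + 20 \<le> 20 * ((M + 1) * (m + 1))" by (simp add: algebra_simps)
    then show "2 * M * m + 10 * (M + m) + 20 \<le> V" using P_bounds V' by linarith
    have "M * m + M + m \<le> (M + 1) * (m + 1)" by (simp add: algebra_simps)
    then show "M * m + M + m \<le> V" using P_bounds V' by linarith
    show "positions ?cls m \<le> V" using pos P_bounds V' by linarith
    show "4 * h + 2 \<le> V" "n + 3 \<le> V" "m \<le> V" "M \<le> V" "2 ^ h \<le> V"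
      using nh P_bounds V' M by linarith+
  qed
  \<comment> \<open>Tabulation takes \<open>42 * P\<close> by the bound \<open>2 * n\<close> on
    clause lengths, writing the circuit \<open>100 * P\<close>; the remaining terms are absorbed
    using \<open>h < M\<close>.\<close>
  have time: "8 + 7 * h + 4 + m * (9 + M * (14 + 21 * (2 * n))) + 100 * (M + 1) * (m + 1) \<le> 162 * P"
  proof -
    have "9 + M * (14 + 21 * (2 * n)) \<le> 42 * ((M + 1) * (n + 1))" by (simp add: algebra_simps)
    then have "m * (9 + M * (14 + 21 * (2 * n))) \<le> (m + 1) * (42 * ((M + 1) * (n + 1)))"
      by (intro mult_le_mono) simp_all
    also have "\<dots> = 42 * P" by (simp add: P_def algebra_simps)
    finally show ?thesis using P_bounds hM by linarith
  qed
  show ?thesis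
    unfolding reduction_def
  proof (rule wp_seq_conseq[OF wp_prepare[OF a0 h_def bounds(5,6,8)]])
    fix k1 s1 \<omega>1
    assume fr1: "same_except (written_regs prepare) (written_arrays prepare) ?s s1"
      and I1: "\<omega>1 = \<omega> \<and> k1 \<le> 0 + 8 + 7 * h \<and> regs s1 3 = n \<and> regs s1 4 = m \<and> regs s1 5 = h \<and>
        regs s1 6 = 2 ^ h \<and> (\<forall>v<h. arrays s1 2 v = 2 ^ v \<and> arrays s1 2 (v + h) = 2 ^ v)"
    have s1: "arrays s1 0 = arrays ?s 0" "arrays s1 20 = arrays ?s 20" "regs s1 100 = regs ?s 100"
      using fr1 by (simp_all add: same_except_def prepare_def powers_body_def)
    show "wp V (tabulate ;; build) ?Q k1 s1 \<omega>1"
    proof (rule wp_seq_conseq[OF wp_tabulate[where h = h and M = M and cls = ?cls and D = "2 * n"]], goal_cases)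
      case (4 k) then show ?case using clause(1) s1 by (simp add: m_def)
    next
      case (5 k j) then show ?case using clause(2) s1 by (simp add: m_def)
    next
      case (7 cl v b) then show ?case by (rule vars)
    next
      case (8 cl) then show ?case using length_clause_le[OF wf] by (simp add: n_def)
    next
      case (13 k2 s2 \<omega>2)
      have s2: "regs s2 6 = M" "regs s2 4 = m" "arrays s2 20 = arrays ?s 20" "regs s2 100 = regs ?s 100"
        using 13(1) I1 s1 M by (simp_all add: same_except_def tabulate_def clause_body_def assignment_body_def literal_body_def mark_def)
      have h2: "holds [] s2"
        using s2 by (auto simp: holds_def initial_state_def cells_def)
      show ?case
      proof (rule wp_conseq[OF wp_build[where A = A and B = B and M = M and m = m]], goal_cases)
        case (7 k3 s3 \<omega>3)
        have "k3 \<le> 162 * P" using time 7(2) 13(2) I1 by (simp add: m_def)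
        then show ?case using 7(2) 13(2) I1 circ by (simp add: P_def)
      qed (use s2 h2 13(2) bounds in \<open>auto simp: A_def B_def m_def\<close>)
    qed (use I1 bounds in \<open>auto simp: M m_def\<close>)
  qed
qed

text \<open>Two trials, since one may fail with probability 1/2 and the limit is 1/3. Register 21 is
  untouched by the reduction and by the shifted program, so it still has its initial value 0 when
  the first trial starts.\<close>

definition solver :: "com \<Rightarrow> com" where
  "solver p = reduction ;; shift_com 100 20 p ;; trial ;; trial ;; Store 1 (Imm 0) (Reg 21) ;; Move 1 (Imm 1)"

text \<open>The clock with \<open>V = 40 * P + t\<close> governs the code around the rewriting
  algorithm only; the run of the latter enters with its own time \<open>t\<close>, whatever numbers
  it handles. The trials stay within \<open>V\<close> because the encoding of \<open>C\<close> has
  at most \<open>t + 2\<close> cells.\<close>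

lemma exec_solver:
  assumes wf: "wf_cnf \<phi>"
  defines "n \<equiv> num_vars \<phi>" and "m \<equiv> length (clauses \<phi>)"
  defines "M \<equiv> 2 ^ ((n + 1) div 2) :: nat"
  defines "P \<equiv> (M + 1) * (m + 1) * (n + 1)"
  assumes run: "exec p (initial_state (encode_circuit (cnf_circuit \<phi>))) [] t s []"
    and out: "output_of s = encode_circuit C" and C: "wf_circuit C" "inputs C = M + 1"
    and ws: "length ws1 = M + 1" "length ws2 = M + 1"
  shows "\<exists>t' s' . exec (solver p) (initial_state (encode_cnf \<phi>)) (ws1 @ ws2 @ \<rho>) t' s' \<rho> \<and>
    t' \<le> (400 * P + 61 * t) * (2 * bit_cost (40 * P + t)) \<and>
    output_of s' = [of_bool (rows_differ C (\<lambda>j. of_bool (ws1 ! j)) \<or> rows_differ C (\<lambda>j. of_bool (ws2 ! j)))]"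
proof -
  let ?V = "40 * P + t" and ?s = "initial_state (encode_cnf \<phi>)" and ?rest = "ws1 @ ws2 @ \<rho>"
  let ?L = "length (encode_circuit C)" and ?C = "cnf_circuit \<phi>"
  have P: "M + 1 \<le> P" "1 \<le> P" unfolding P_def by simp_all
  have L: "?L \<le> t + 2" by (rule length_encode_circuit_le[OF C(1) run out])
  have "wp ?V reduction (\<lambda>k' s' \<omega>'. \<omega>' = ?rest \<and> k' \<le> 162 * P \<and>
    regs s' 19 = M + 1 \<and> holds (encode_circuit ?C) s') 0 ?s ?rest"
    using wp_reduction[OF wf, of ?V ?rest] by (simp only: n_def m_def M_def P_def)
  then obtain t1 s1 k1 where r1: "exec reduction ?s ?rest t1 s1 ?rest" "t1 \<le> k1 * (2 * bit_cost ?V)" "k1 \<le> 162 * P"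
    "regs s1 19 = M + 1" "holds (encode_circuit ?C) s1"
    unfolding wp_def by auto
  have fr1: "same_except (written_regs reduction) (written_arrays reduction) ?s s1" by (rule exec_same_except[OF r1(1)])
  \<comment> \<open>Apart from its input in register 100 and array 20, the region reserved for the
    shifted program is still zero, as its initial state demands.\<close>
  have "embeds 100 20 (initial_state (encode_circuit ?C)) s1"
    unfolding embeds_def
  proof (intro conjI allI)
    show "regs s1 (r + 100) = regs (initial_state (encode_circuit ?C)) r" for r
      using r1(5) same_exceptD(1)[OF fr1, of "r + 100"]
      by (cases "r = 0") (simp_all add: initial_state_def holds_def written_regs_reduction)
    show "arrays s1 (a + 20) i = arrays (initial_state (encode_circuit ?C)) a i" for a i
      using r1(5) same_exceptD(2)[OF fr1, of "a + 20"]
      by (cases "a = 0") (simp_all add: initial_state_def holds_def written_regs_reduction cells_def)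
  qed
  from exec_shift_com[OF run this, of ?rest] obtain s2 where
    r2: "exec (shift_com 100 20 p) s1 ?rest t s2 ?rest" and emb: "embeds 100 20 s s2" and
    fr2: "same_except {100..} {20..} s1 s2" by auto
  have s2: "regs s2 19 = inputs C" "regs s2 21 = of_bool False"
    using fr2 r1(4) C(2) same_exceptD(1)[OF fr1, of 21]
    by (simp_all add: same_except_def written_regs_reduction initial_state_def)
  have a21: "arrays s2 21 i = encode_circuit C ! i" if "i < ?L" for i
  proof -
    have "arrays s2 (1 + 20) i = arrays s 1 i" using emb unfolding embeds_def by blast
    also have "\<dots> = encode_circuit C ! i"
      using that unfolding out[symmetric] by (simp add: output_of_def)
    finally show ?thesis by simp
  qed
  have V: "?L + inputs C + 3 \<le> ?V" "1 \<le> ?V" using L P C(2) by linarith+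
  let ?x = "\<lambda>ws j. of_bool (ws ! j) :: bit"
  let ?ans = "rows_differ C (?x ws1) \<or> rows_differ C (?x ws2)"
  let ?end = "Store 1 (Imm 0) (Reg 21) ;; Move 1 (Imm 1)"
  have "wp ?V (trial ;; trial ;; ?end) (\<lambda>k' s' \<omega>'. \<omega>' = \<rho> \<and> k' \<le> 200 * P + 60 * t \<and>
      output_of s' = [of_bool ?ans]) 0 s2 ?rest"
  proof (rule wp_seq_conseq[OF wp_trial[OF C(1) s2 a21 _ V(1)]])
    show "length ws1 = inputs C" using ws C by simp
    fix k3 s3 \<omega>3
    assume fr3: "same_except (written_regs trial) (written_arrays trial) s2 s3"
      and I3: "\<omega>3 = ws2 @ \<rho> \<and> k3 \<le> 0 + 20 + 5 * inputs C + 30 * ?L \<and>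
        regs s3 21 = of_bool (False \<or> rows_differ C (?x ws1))"
    have s3: "regs s3 19 = inputs C" "arrays s3 21 = arrays s2 21"
      using fr3 s2 by (simp_all add: same_except_def written_regs_trial)
    have "wp ?V (trial ;; ?end) (\<lambda>k' s' \<omega>'. \<omega>' = \<rho> \<and> k' \<le> 200 * P + 60 * t \<and>
      output_of s' = [of_bool ?ans]) k3 s3 (ws2 @ \<rho>)"
    proof (rule wp_seq_conseq[OF wp_trial[OF C(1) s3(1) _ _ _ V(1), where f = "rows_differ C (?x ws1)"]], goal_cases)
      case (2 i) then show ?case using a21 s3 by simp
    next
      case (4 k4 s4 \<omega>4)
      have "k4 + 2 \<le> 200 * P + 60 * t"
        using 4(2) I3 L P C(2) by linarith
      then show ?case
        by (intro wp_Seq wp_Store wp_Move) (use 4(2) V in \<open>auto simp: output_of_def\<close>)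
    qed (use I3 ws C in auto)
    then show "wp ?V (trial ;; ?end) (\<lambda>k' s' \<omega>'. \<omega>' = \<rho> \<and> k' \<le> 200 * P + 60 * t \<and>
      output_of s' = [of_bool ?ans]) k3 s3 \<omega>3"
      using I3 by simp
  qed
  then obtain t3 s3 k3 where r3: "exec (trial ;; trial ;; ?end) s2 ?rest t3 s3 \<rho>" "t3 \<le> k3 * (2 * bit_cost ?V)"
    "k3 \<le> 200 * P + 60 * t" "output_of s3 = [of_bool ?ans]"
    unfolding wp_def by auto
  have "t1 + (t + t3) \<le> (k1 + t + k3) * (2 * bit_cost ?V)"
  proof -
    have "t * 1 \<le> t * (2 * bit_cost ?V)" using bit_cost_pos[of ?V] by (intro mult_le_mono2) simp
    then show ?thesis using r1(2) r3(2) unfolding add_mult_distrib by linarith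
  qed
  also have "\<dots> \<le> (400 * P + 61 * t) * (2 * bit_cost ?V)"
    using r1(3) r3(3) by (intro mult_le_mono1) simp
  finally have t: "t1 + (t + t3) \<le> (400 * P + 61 * t) * (2 * bit_cost ?V)" .
  have "exec (solver p) ?s ?rest (t1 + (t + t3)) s3 \<rho>"
    unfolding solver_def by (rule exec.Seq[OF r1(1) exec.Seq[OF r2 r3(1)]])
  with t r3(4) show ?thesis by blast
qed


text \<open>\<open>T\<close> may depend on the formula, so it is taken to be the time bound obtained
  from the actual \<open>t\<close>. It is at least the \<open>2 * N\<close> tosses used by the
  trials; surplus tosses remain unread.\<close>

lemma solver_decides:
  assumes wf: "wf_cnf \<phi>"
  defines "n \<equiv> num_vars \<phi>" and "m \<equiv> length (clauses \<phi>)"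
  defines "M \<equiv> 2 ^ ((n + 1) div 2) :: nat"
  defines "P \<equiv> (M + 1) * (m + 1) * (n + 1)"
  assumes run: "exec p (initial_state (encode_circuit (cnf_circuit \<phi>))) [] t s []"
    and out: "output_of s = encode_circuit C" and C: "wf_circuit C"
    and Q: "OR_computes (cnf_circuit \<phi>) Q" "XOR_computes C Q"
    and T: "(400 * P + 61 * t) * (2 * bit_cost (40 * P + t)) = T"
  shows "monte_carlo_decides_within (solver p) (encode_cnf \<phi>) (satisfiable \<phi>) T"
proof -
  let ?cls = "clauses \<phi>"
  define h where "h = (n + 1) div 2"
  define A where "A i a \<longleftrightarrow> (\<forall>l\<in>set (?cls ! i). falsifiesL h a l)" for i a
  define B where "B a i \<longleftrightarrow> (\<forall>l\<in>set (?cls ! i). falsifiesR h a l)" for a i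
  define N where "N = M + 1"
  define succ where "succ ws \<longleftrightarrow> rows_differ C (\<lambda>j. of_bool (ws ! j))" for ws :: "bool list"
  have circ: "cnf_circuit \<phi> = or_circuit M m A B"
    by (simp add: cnf_circuit_def Let_def M_def h_def n_def m_def A_def[abs_def] B_def[abs_def])
  note Q_entries = OR_computes_or_circuit[OF Q(1)[unfolded circ]]
  have "circuit_dims C Q" using Q(2) unfolding XOR_computes_def by blast
  then have inputs: "inputs C = N" using Q_entries(2) by (auto simp: circuit_dims_def N_def)
  have TN: "2 * N \<le> T"
  proof -
    have "N \<le> 400 * P + 61 * t" by (simp add: P_def N_def)
    from mult_le_mono[OF this, of 2 "2 * bit_cost (40 * P + t)"] bit_cost_pos[of "40 * P + t"] T
    show ?thesis by simp
  qed
  have run_solver: "\<exists>t' s' \<omega>'. exec (solver p) (initial_state (encode_cnf \<phi>)) \<omega> t' s' \<omega>' \<and> t' \<le> T \<and>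
      output_of s' = [of_bool (succ (take N \<omega>) \<or> succ (take N (drop N \<omega>)))]" if "length \<omega> = T" for \<omega>
  proof -
    have \<omega>: "\<omega> = take N \<omega> @ take N (drop N \<omega>) @ drop N (drop N \<omega>)"
      by (simp only: append_take_drop_id)
    have "length (take N \<omega>) = M + 1" "length (take N (drop N \<omega>)) = M + 1"
      using TN that by (simp_all add: N_def)
    from exec_solver[OF wf run out C inputs[unfolded N_def M_def n_def] this[unfolded M_def n_def], of "drop N (drop N \<omega>)",
        folded n_def m_def, folded M_def, folded P_def, folded succ_def]
    show ?thesis unfolding T \<omega>[symmetric] by blast
  qed
  have sat: "satisfiable \<phi> \<longleftrightarrow> (\<exists>a<M. \<exists>c<M. \<forall>i<m. \<not> (B a i \<and> A i c))"
  proof -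
    have "num_vars \<phi> \<le> 2 * h" by (simp add: h_def n_def)
    moreover have Mh: "M = 2 ^ h" by (simp only: M_def h_def)
    ultimately show ?thesis
      using satisfiable_iff_halves[OF wf]
      by (simp add: all_set_conv_all_nth A_def B_def Mh m_def conj_commute)
  qed
  have row: "0 < dim_row Q" and ones: "Q $$ (0, j)" if "j < dim_col Q" for j
    using Q_entries that by auto
  let ?\<Omega> = "{\<omega> :: bool list. length \<omega> = T}"
  let ?good = "{\<omega>. \<exists>t s \<omega>'. exec (solver p) (initial_state (encode_cnf \<phi>)) \<omega> t s \<omega>' \<and>
      output_of s = [of_bool (satisfiable \<phi>)]}"
  let ?F = "{\<omega>. length \<omega> = T \<and> \<not> succ (take N \<omega>) \<and> \<not> succ (take N (drop N \<omega>))}"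
  have fin: "finite ?\<Omega>" and card: "card ?\<Omega> = 2 ^ T"
    using finite_lists_length_eq[of "UNIV :: bool set" T] card_lists_length_eq[of "UNIV :: bool set" T] by simp_all
  \<comment> \<open>Success probability 3/4, in counting form.\<close>
  have "3 * card ?\<Omega> \<le> 4 * card (?\<Omega> \<inter> ?good)"
  proof (cases "satisfiable \<phi>")
    case True
    then obtain a c where ac: "a < M" "c < M" "\<forall>i<m. \<not> (B a i \<and> A i c)" using sat by blast
    \<comment> \<open>Indices are raised by one because of the all-ones row and the dummy column;
      the coin flipped below is accordingly number \<open>Suc c\<close>.\<close>
    have Qac: "\<not> Q $$ (Suc a, Suc c)" using Q_entries(4)[of a "Suc c"] ac by auto
    have "succ (ws[Suc c := (\<not> ws ! Suc c)])" if "length ws = N" "\<not> succ ws" for ws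
      unfolding succ_def
    proof (rule rows_differ_XOR(2)[OF Q(2) ones row _ _ Qac])
      show "\<not> rows_differ C (\<lambda>j. of_bool (ws ! j))" using that by (simp add: succ_def)
    qed (use ac Q_entries(1,2) that in \<open>auto simp: N_def\<close>)
    then have F: "4 * card ?F \<le> 2 ^ T"
      using card_two_failures[of "Suc c" N T succ] ac(2) TN by (simp add: N_def)
    have "?\<Omega> - ?F \<subseteq> ?\<Omega> \<inter> ?good"
      using run_solver True by fastforce
    then have "card (?\<Omega> - ?F) \<le> card (?\<Omega> \<inter> ?good)" using fin by (intro card_mono) auto
    moreover have "card (?\<Omega> - ?F) = card ?\<Omega> - card ?F"
      by (rule card_Diff_subset) (auto intro: finite_subset[OF _ fin])
    ultimately show ?thesis using F card by linarith
  next
    case False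
    have "Q $$ (i, j)" if "i < dim_row Q" "j < dim_col Q" for i j
    proof (cases i)
      case 0
      then show ?thesis using ones that by simp
    next
      case (Suc a)
      then have a: "a < M" "j \<le> M" using that Q_entries(1,2) by auto
      show ?thesis
        using Q_entries(4)[OF a] sat False a Suc by (cases j) auto
    qed
    \<comment> \<open>One-sided error: on unsatisfiable formulas no toss sequence makes a trial
      succeed.\<close>
    then have "\<not> succ ws" for ws
      unfolding succ_def using rows_differ_XOR(1)[OF Q(2) ones] Q_entries(1) by auto
    then have "?\<Omega> \<inter> ?good = ?\<Omega>" using run_solver False by fastforce
    then show ?thesis by simp
  qed
  then have "3 * real (card ?\<Omega>) \<le> 4 * real (card (?\<Omega> \<inter> ?good))" by linarith
  then have "real (card (?\<Omega> \<inter> ?good)) / real (card ?\<Omega>) \<ge> 2 / 3"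
    using card by (simp add: field_simps)
  moreover have "?\<Omega> \<noteq> {}" using card by (metis card.empty power_not_zero zero_neq_numeral)
  ultimately have "measure_pmf.prob (pmf_of_set ?\<Omega>) ?good \<ge> 2 / 3"
    using fin by (simp add: measure_pmf_of_set)
  then show ?thesis
    unfolding monte_carlo_decides_within_def using run_solver by blast
qed

section \<open>Running time of the solver\<close>

lemma bit_cost_less_power: "k < 2 ^ e \<Longrightarrow> bit_cost k \<le> e + 1"
  by (simp add: bit_cost_def floorlog_leI)

text \<open>The finitely many values before the asymptotic bound sets in are absorbed by adding the
  sum of their absolute values to the constant; this works because the power is at least 1 when
  \<open>N \<ge> 1\<close> and \<open>0 \<le> e\<close>.\<close>

lemma bigo_powr_bound:
  assumes "T \<in> O(\<lambda>N. real N powr e)" "0 \<le> e"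
  shows "\<exists>c. 0 \<le> c \<and> (\<forall>N\<ge>1. T N \<le> c * real N powr e)"
proof -
  from assms(1) obtain c where c: "c > 0" "\<forall>\<^sub>F N in at_top. norm (T N) \<le> c * norm (real N powr e)"
    by (elim landau_o.bigE)
  then obtain N0 where N0: "\<And>N. N \<ge> N0 \<Longrightarrow> norm (T N) \<le> c * norm (real N powr e)"
    by (auto simp: eventually_at_top_linorder)
  define c' where "c' = c + (\<Sum>N<N0. \<bar>T N\<bar>)"
  have c': "0 \<le> (\<Sum>N<N0. \<bar>T N\<bar>)" by (simp add: sum_nonneg)
  have "T N \<le> c' * real N powr e" if "N \<ge> 1" for N
  proof (cases "N < N0")
    case True
    have "T N \<le> (\<Sum>N<N0. \<bar>T N\<bar>)"
      using member_le_sum[of N "{..<N0}" "\<lambda>N. \<bar>T N\<bar>"] True by force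
    also have "\<dots> \<le> c'" using c by (simp add: c'_def)
    also have "c' * 1 \<le> c' * real N powr e"
      using that assms(2) c c' by (intro mult_left_mono) (auto simp: c'_def ge_one_powr_ge_zero)
    finally show ?thesis by simp
  next
    case False
    then have "T N \<le> c * real N powr e" using N0[of N] by simp
    also have "\<dots> \<le> c' * real N powr e" using c' by (intro mult_right_mono) (auto simp: c'_def)
    finally show ?thesis .
  qed
  then show ?thesis using c c' by (intro exI[of _ c']) (auto simp: c'_def)
qed

text \<open>Two of the three polynomial factors bound \<open>P\<close> and the rewriting time, the
  third bounds the bit cost, which is logarithmic in an exponential quantity and hence linear in
  \<open>n + m + 1\<close>.\<close>

lemma solver_time_bound:
  fixes \<epsilon> :: real
  assumes \<epsilon>: "0 < \<epsilon>" "\<epsilon> \<le> 1" and T: "\<And>N. N \<ge> 1 \<Longrightarrow> T N \<le> c * real N powr (2 - \<epsilon>)" and c: "0 \<le> c"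
  shows "\<exists>c'. \<forall>n m M P W t. M = 2 ^ ((n + 1) div 2) \<longrightarrow> P = (M + 1) * (m + 1) * (n + 1) \<longrightarrow>
    1 \<le> W \<longrightarrow> W \<le> 2 * (M + 1) * (m + 1) \<longrightarrow> real t \<le> T W \<longrightarrow>
    real ((400 * P + 61 * t) * (2 * bit_cost (40 * P + t))) \<le>
      2 powr ((1 - \<epsilon> / 2) * real n) * real (c' * (n + m + 1) ^ 3)"
proof -
  \<comment> \<open>\<open>40 * P\<close> contributes \<open>160 = 40 * 4\<close>, and
    \<open>t\<close> contributes \<open>32 * c\<close>.\<close>
  define c2 where "c2 = nat \<lceil>160 + 32 * c\<rceil>"
  have c2: "160 + 32 * c \<le> real c2" using c by (simp add: c2_def)
  show ?thesis
  proof (intro exI[of _ "122 * c2 * (c2 + 4)"] allI impI)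
    fix n m M P W t :: nat
    assume M: "M = 2 ^ ((n + 1) div 2)" and P: "P = (M + 1) * (m + 1) * (n + 1)"
      and W: "1 \<le> W" "W \<le> 2 * (M + 1) * (m + 1)" and t: "real t \<le> T W"
    define E where "E = 2 powr ((1 - \<epsilon> / 2) * real n)"
    define S where "S = n + m + 1"
    define h where "h = (n + 1) div 2"
    have "2 * h \<le> n + 1" by (simp add: h_def)
    then have "real (2 * h) \<le> real (n + 1)" by (simp only: of_nat_le_iff)
    then have h: "real h \<le> (real n + 1) / 2" by simp
    have Mh: "real M = 2 powr real h" by (simp add: M h_def powr_realpow)
    have M1: "1 \<le> M" by (simp add: M)
    have E0: "0 < E" by (simp add: E_def)
    have E2: "2 * E = 2 powr (1 + (1 - \<epsilon> / 2) * real n)" by (simp add: E_def powr_add)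
    \<comment> \<open>Here \<open>\<epsilon> \<le> 1\<close> matters: the reduction alone takes time
      about \<open>M\<close>, that is \<open>2 ^ (n / 2)\<close>, which must not exceed the target
      \<open>E\<close>.\<close>
    have "real n / 2 \<le> (1 - \<epsilon> / 2) * real n" using \<epsilon> mult_right_mono[of "1/2" "1 - \<epsilon>/2" "real n"] by simp
    then have ME: "real M \<le> 2 * E"
      unfolding Mh E2 using h by (intro powr_mono) auto
    have "real M powr (2 - \<epsilon>) = 2 powr (real h * (2 - \<epsilon>))"
      by (simp add: Mh powr_powr)
    \<comment> \<open>Rounding \<open>h\<close> up costs at most a factor of 2, since \<open>(n + 1)
      / 2 * (2 - \<epsilon>) \<le> 1 + (1 - \<epsilon> / 2) * n\<close>.\<close>
    also have "\<dots> \<le> 2 powr ((real n + 1) / 2 * (2 - \<epsilon>))"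
      using h \<epsilon> by (intro powr_mono mult_right_mono) auto
    also have "\<dots> \<le> 2 * E"
      unfolding E2 using \<epsilon> by (intro powr_mono) (auto simp: field_simps)
    finally have MpE: "real M powr (2 - \<epsilon>) \<le> 2 * E" .
    have "W \<le> M * (4 * (m + 1))"
    proof -
      have "2 * (M + 1) * (m + 1) \<le> 4 * M * (m + 1)" using M1 by (intro mult_le_mono1) simp
      then show ?thesis using W(2) by (simp add: algebra_simps)
    qed
    then have "real W \<le> real M * real (4 * (m + 1))" by (metis of_nat_le_iff of_nat_mult)
    then have "real W powr (2 - \<epsilon>) \<le> (real M * real (4 * (m + 1))) powr (2 - \<epsilon>)"
      using \<epsilon> by (intro powr_mono2) simp_all
    also have "\<dots> = real M powr (2 - \<epsilon>) * real (4 * (m + 1)) powr (2 - \<epsilon>)"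
      by (simp add: powr_mult)
    also have "\<dots> \<le> 2 * E * real (4 * (m + 1)) powr 2"
      using MpE E0 \<epsilon> by (intro mult_mono powr_mono) auto
    also have "\<dots> = 32 * E * real (m + 1) ^ 2"
      by (simp add: power2_eq_square powr_numeral algebra_simps)
    also have "\<dots> \<le> 32 * E * real S ^ 2"
      using E0 by (intro mult_left_mono power_mono) (auto simp: S_def)
    finally have "real W powr (2 - \<epsilon>) \<le> 32 * E * real S ^ 2" .
    from mult_left_mono[OF this c] t T[OF W(1)] have tE: "real t \<le> 32 * c * (E * real S ^ 2)"
      by simp
    have PE: "real P \<le> 4 * (E * real S ^ 2)"
    proof -
      have "P = (M + 1) * ((m + 1) * (n + 1))" by (simp only: P mult.assoc)
      also have "\<dots> \<le> (2 * M) * (S * S)"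
        using M1 by (intro mult_le_mono) (auto simp: S_def)
      finally have "real P \<le> (2 * real M) * (real S * real S)" by (metis of_nat_le_iff of_nat_mult of_nat_numeral)
      also have "\<dots> \<le> (2 * (2 * E)) * (real S * real S)"
        using ME by (intro mult_right_mono) auto
      finally show ?thesis by (simp add: power2_eq_square)
    qed
    have ES: "0 \<le> E * real S ^ 2" using E0 by simp
    have "real (40 * P + t) \<le> (160 + 32 * c) * (E * real S ^ 2)"
      using PE tE by (simp add: algebra_simps)
    also have "\<dots> \<le> real c2 * (E * real S ^ 2)" using c2 ES by (intro mult_right_mono)
    finally have VE: "real (40 * P + t) \<le> real c2 * (E * real S ^ 2)" .
    have "real (400 * P + 61 * t) \<le> (1600 + 61 * 32 * c) * (E * real S ^ 2)"
      using PE tE by (simp add: algebra_simps)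
    also have "\<dots> \<le> (61 * real c2) * (E * real S ^ 2)" using c2 c ES by (intro mult_right_mono) auto
    finally have KE: "real (400 * P + 61 * t) \<le> (61 * real c2) * (E * real S ^ 2)" .
    have "E \<le> 2 powr real n"
      unfolding E_def using \<epsilon> mult_right_mono[of "1 - \<epsilon> / 2" 1 "real n"] by (intro powr_mono) auto
    then have E: "E \<le> 2 ^ n" by (simp add: powr_realpow)
    \<comment> \<open>Bounding each factor by a power of 2 is crude, but only the exponent matters
      for the bit cost.\<close>
    have "real c2 * (E * real S ^ 2) < 2 ^ c2 * (2 ^ n * (2 ^ S) ^ 2)"
    proof (intro mult_less_le_imp_less mult_mono power_mono)
      show "real c2 < 2 ^ c2" "real S \<le> 2 ^ S" using of_nat_less_two_power[of c2, where ?'a = real] of_nat_less_two_power[of S, where ?'a = real] by auto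
    qed (use E E0 in \<open>auto simp: S_def\<close>)
    also have "\<dots> = 2 ^ (c2 + n + S * 2)" by (simp add: power_add power_mult)
    finally have "real (40 * P + t) < real (2 ^ (c2 + n + S * 2))" using VE by simp
    then have "40 * P + t < 2 ^ (c2 + n + S * 2)" by (simp only: of_nat_less_iff)
    then have "bit_cost (40 * P + t) \<le> c2 + n + S * 2 + 1" by (rule bit_cost_less_power)
    also have "\<dots> \<le> (c2 + 4) * S" by (simp add: S_def algebra_simps)
    finally have "real (bit_cost (40 * P + t)) \<le> real ((c2 + 4) * S)" by (simp only: of_nat_le_iff)
    then have "2 * real (bit_cost (40 * P + t)) \<le> 2 * real ((c2 + 4) * S)" by linarith
    from mult_mono[OF KE this] have "real (400 * P + 61 * t) * (2 * real (bit_cost (40 * P + t))) \<le>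
        (61 * real c2) * (E * real S ^ 2) * (2 * real ((c2 + 4) * S))"
      using ES by simp
    also have "\<dots> = E * real (122 * c2 * (c2 + 4) * S ^ 3)"
      by (simp add: power2_eq_square power3_eq_cube algebra_simps)
    finally show "real ((400 * P + 61 * t) * (2 * bit_cost (40 * P + t))) \<le>
      2 powr ((1 - \<epsilon> / 2) * real n) * real (122 * c2 * (c2 + 4) * (n + m + 1) ^ 3)"
      by (simp add: E_def S_def)
  qed
qed

lemma XOR_rewriting_refutes_SETH:
  fixes \<epsilon> :: real
  assumes \<epsilon>: "\<epsilon> > 0" and T: "T \<in> O(\<lambda>N. real N powr (2 - \<epsilon>))" and p: "rewrites_OR_circuits XOR_computes p T"
  shows "\<not> SETH"
proof -
  \<comment> \<open>Capping is harmless since a larger saving implies a smaller one. It keeps the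
    exponent \<open>2 - \<epsilon>'\<close> nonnegative and supplies the upper bound 1 required for
    the time estimate.\<close>
  define \<epsilon>' where "\<epsilon>' = min \<epsilon> 1"
  have \<epsilon>': "0 < \<epsilon>'" "\<epsilon>' \<le> 1" "\<epsilon>' \<le> \<epsilon>" using \<epsilon> by (auto simp: \<epsilon>'_def)
  have "(\<lambda>N. real N powr (2 - \<epsilon>)) \<in> O(\<lambda>N. real N powr (2 - \<epsilon>'))"
    by (intro bigoI[of _ 1] eventually_mono[OF eventually_ge_at_top[of 1]])
      (use \<epsilon>'(3) in \<open>auto intro: powr_mono\<close>)
  with T have "T \<in> O(\<lambda>N. real N powr (2 - \<epsilon>'))" by (rule landau_o.big_trans)
  from bigo_powr_bound[OF this] \<epsilon>' obtain c where c: "0 \<le> c" "\<And>N. N \<ge> 1 \<Longrightarrow> T N \<le> c * real N powr (2 - \<epsilon>')"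
    by auto
  from solver_time_bound[OF \<epsilon>'(1,2) c(2,1)] obtain c' where c': "\<And>n m M P W t. M = 2 ^ ((n + 1) div 2) \<Longrightarrow>
    P = (M + 1) * (m + 1) * (n + 1) \<Longrightarrow> 1 \<le> W \<Longrightarrow> W \<le> 2 * (M + 1) * (m + 1) \<Longrightarrow> real t \<le> T W \<Longrightarrow>
    real ((400 * P + 61 * t) * (2 * bit_cost (40 * P + t))) \<le>
      2 powr ((1 - \<epsilon>' / 2) * real n) * real (c' * (n + m + 1) ^ 3)"
    by blast
  have "\<exists>K. real K \<le> 2 powr ((1 - \<epsilon>' / 2) * real (num_vars \<phi>)) *
        real (c' * (num_vars \<phi> + length (clauses \<phi>) + 1) ^ 3) \<and>
      monte_carlo_decides_within (solver p) (encode_cnf \<phi>) (satisfiable \<phi>) K" if wf: "wf_cnf \<phi>" for \<phi>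
  proof -
    let ?C = "cnf_circuit \<phi>"
    have wfC: "wf_circuit ?C" by (simp add: cnf_circuit_def Let_def wf_or_circuit)
    from p[unfolded rewrites_OR_circuits_def, rule_format, OF this] obtain t s C' A where
      run: "exec p (initial_state (encode_circuit ?C)) [] t s []" "real t \<le> T (wires ?C)"
      "output_of s = encode_circuit C'" "wf_circuit C'" "OR_computes ?C A" "XOR_computes C' A"
      by blast
    have W: "wires ?C \<le> 2 * (2 ^ ((num_vars \<phi> + 1) div 2) + 1) * (length (clauses \<phi>) + 1)"
      unfolding cnf_circuit_def Let_def by (rule wires_or_circuit)
    have W1: "1 \<le> wires ?C"
      using wfC by (auto simp: wf_circuit_def cnf_circuit_def Let_def)
    show ?thesis
      using solver_decides[OF wf run(1,3,4,5,6) refl] c'[OF refl refl W1 W run(2)] by blast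
  qed
  then show ?thesis
    unfolding SETH_def using \<epsilon>'(1) by (metis half_gt_zero)
qed

theorem theorem5:
  shows "((\<exists>\<epsilon> > (0 :: real). \<exists>p. \<exists>T \<in> O(\<lambda>N. real N powr (2 - \<epsilon>)).
             rewrites_OR_circuits SUM_computes p T) \<longrightarrow> \<not> SETH) \<and>
         ((\<exists>\<epsilon> > (0 :: real). \<exists>p. \<exists>T \<in> O(\<lambda>N. real N powr (2 - \<epsilon>)).
             rewrites_OR_circuits XOR_computes p T) \<longrightarrow> \<not> SETH)"
proof -
  have "rewrites_OR_circuits XOR_computes p T" if "rewrites_OR_circuits SUM_computes p T" for p T
    using that SUM_computes_imp_XOR_computes unfolding rewrites_OR_circuits_def by meson
  then show ?thesis using XOR_rewriting_refutes_SETH by blast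
qed

end
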